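(* Let $K\in\mathrm{GL}(n,\mathbf C)$ and $J_K=\begin{pmatrix}0&-K^*\\ K&0\end{pmatrix}$. Let $\gamma(t)=\begin{pmatrix}M_{1,1}(t)&0\\ M_{2,1}(t)&M_{2,2}(t)\end{pmatrix}$, $0\le t\le T$, be a (continuous) path in $\mathrm{GL}(2n,\mathbf C)$ (with $n\times n$ blocks) such that $M_{2,2}(t)^*KM_{1,1}(t)=K$ and $M_{1,1}(t)^*K^*M_{2,1}(t)$ is self-adjoint for each $t$ (so that $\gamma(t)^*J_K\gamma(t)=J_K$). Let $R\subset\mathbf C^{2n}$ be a linear subspace and define $$R^K=\{(x_1,x_2)\in\mathbf C^{2n}:\langle Kx_1,y_1\rangle-\langle Kx_2,y_2\rangle=0\ \text{for all }(y_1,y_2)\in R\},$$ $$W_K(R)=\{(x_1,x_2,x_3,x_4)\in\mathbf C^{4n}:x_i\in\mathbf C^n,\ (x_1,x_3)\in R^K,\ (x_2,x_4)\in R\},$$ $$S(t)=\{x\in\mathbf C^n:(x,M_{1,1}(t)x)\in R^K\}.$$ Then for all $t\in[0,T]$ $$\dim(\mathrm{Gr}(\gamma(t))\cap W_K(R))=\dim\ker\big((M_{1,1}(t)^*K^*M_{2,1}(t))|_{S(t)}\big)+\dim S(t)+\dim(\mathrm{Gr}(I_n)\cap R)-\dim(\mathrm{Gr}(I_n)\cap R^K),$$ and $$i_{W_K(R)}(\gamma)=m^+\big((M_{1,1}(T)^*K^*M_{2,1}(T))|_{S(T)}\big)-m^+\big((M_{1,1}(0)^*K^*M_{2,1}(0))|_{S(0)}\big)+\dim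 S(0)-\dim S(T).$$
   Context: $\langle\cdot,\cdot\rangle$ is the standard Hermitian inner product (linear in the first variable), $A^*$ the conjugate transpose, $\dim$ the complex dimension, $\mathrm{Gr}(M)=\{(x,Mx)\}$. For a self-adjoint matrix $A$ and a subspace $S$, $A|_S$ denotes the Hermitian form $(x,y)\mapsto\langle Ax,y\rangle$ restricted to $S$; $\ker$ is the kernel (radical) of this form and $m^+$ is its positive Morse index (maximal dimension of a positive definite subspace). **Maslov(-type) index.** Let $(V,\omega)$ be a finite-dimensional complex symplectic space ($\omega$ sesquilinear, linear in the first variable, $\omega(y,x)=-\overline{\omega(x,y)}$, nondegenerate); $\lambda\subset V$ is Lagrangian if it equals its $\omega$-annihilator. Choose an $\omega$-orthogonal splitting $V=V^+\oplus V^-$ with $-\sqrt{-1}\,\omega$ positive definite on $V^+$ and negative definite on $V^-$. Each Lagrangian subspace is the graph of a unique $U:V^+\to V^-$ with $\omega(Ux,Uy)=-\omega(x,y)$. For continuous paths of Lagrangians $\lambda_t=\mathrm{Gr}(U_t)$, $\mu_t=\mathrm{Gr}(V_t)$, $t\in[a,b]$, the map $U_tV_t^{-1}$ is unitary on $(V^-,\sqrt{-1}\,\omega)$. Choose $a=t_0<\dots<t_N=b$ and $\epsilon_k\in(0,\pi)$ with $e^{\pm\sqrt{-1}\epsilon_k}\notin\sigma(U_tV_t^{-1})$ on $[t_k,t_{k+1}]$, and let $d_k(t)$ be the number, with multiplicity, of eigenvalues of $U_tV_t^{-1}$ in $\{e^{\sqrt{-1}\theta}:-\epsilon_k\le\theta<0\}$.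 Then $\mathrm{Mas}\{\lambda_t,\mu_t\}=-\sum_k(d_k(t_k)-d_k(t_{k+1}))$. With $\omega(x,y)=\langle J_Kx,y\rangle$ on $\mathbf C^{2n}$ and $W$ a Lagrangian subspace of $(\mathbf C^{2n}\oplus\mathbf C^{2n},(-\omega)\oplus\omega)$ (such as $W_K(R)$), $i_W(\gamma)=\mathrm{Mas}\{\mathrm{Gr}(\gamma(t)),W;\,0\le t\le T\}$. *)

theory Defs
  imports "HOL-Analysis.Analysis"
begin

text \<open>
  All spaces are coordinate spaces \<^typ>\<open>complex^'m\<close> over the field of complex numbers, with the
  scalar multiplication \<open>*s\<close>; subspaces and complex dimensions are \<^const>\<open>vec.subspace\<close> and
  \<^const>\<open>vec.dim\<close>. (The overloaded constants \<^const>\<open>subspace\<close>, \<^const>\<open>dim\<close> and \<open>inner\<close> would be the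
  real ones.) A direct sum of two coordinate spaces is indexed by the sum of the index types.
\<close>

subsection \<open>Hermitian inner product, adjoints, blocks\<close>

definition cinner :: "complex^'m \<Rightarrow> complex^'m \<Rightarrow> complex" where
  "cinner x y = (\<Sum>i\<in>UNIV. x $ i * cnj (y $ i))"

definition cadj :: "complex^'m^'k \<Rightarrow> complex^'k^'m" where
  "cadj A = (\<chi> i j. cnj (A $ j $ i))"

definition vpair :: "'a^'m \<Rightarrow> 'a^'k \<Rightarrow> 'a^('m::finite + 'k::finite)" where
  "vpair x y = (\<chi> i. case i of Inl j \<Rightarrow> x $ j | Inr j \<Rightarrow> y $ j)"

definition vfst :: "'a^('m::finite + 'k::finite) \<Rightarrow> 'a^'m" where
  "vfst z = (\<chi> j. z $ Inl j)"

definition vsnd :: "'a^('m::finite + 'k::finite) \<Rightarrow> 'a^'k" where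
  "vsnd z = (\<chi> j. z $ Inr j)"

text \<open>\<open>block A B C D\<close> has first block row \<open>A B\<close> and second block row \<open>C D\<close>.\<close>

definition block ::
    "'a^'m^'m \<Rightarrow> 'a^'k^'m \<Rightarrow> 'a^'m^'k \<Rightarrow> 'a^'k^'k \<Rightarrow> 'a^('m::finite + 'k::finite)^('m + 'k)" where
  "block A B C D = (\<chi> i. case i of Inl k \<Rightarrow> vpair (A $ k) (B $ k) | Inr k \<Rightarrow> vpair (C $ k) (D $ k))"

definition Gr :: "complex^'m^'m \<Rightarrow> (complex^('m + 'm)) set" where
  "Gr M = {vpair x (M *v x) | x. True}"

subsection \<open>Hermitian forms on subspaces\<close>

definition hform :: "complex^'m^'m \<Rightarrow> complex^'m \<Rightarrow> complex^'m \<Rightarrow> complex" where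
  "hform A x y = cinner (A *v x) y"

definition pos_def_on :: "(complex^'m \<Rightarrow> complex^'m \<Rightarrow> complex) \<Rightarrow> (complex^'m) set \<Rightarrow> bool" where
  "pos_def_on q P \<longleftrightarrow> (\<forall>x\<in>P. x \<noteq> 0 \<longrightarrow> q x x \<in> \<real> \<and> 0 < Re (q x x))"

definition form_ker :: "(complex^'m \<Rightarrow> complex^'m \<Rightarrow> complex) \<Rightarrow> (complex^'m) set \<Rightarrow> (complex^'m) set" where
  "form_ker q S = {x \<in> S. \<forall>y\<in>S. q x y = 0}"

definition morse_pos :: "(complex^'m \<Rightarrow> complex^'m \<Rightarrow> complex) \<Rightarrow> (complex^'m) set \<Rightarrow> nat" where
  "morse_pos q S = Max {vec.dim P | P. vec.subspace P \<and> P \<subseteq> S \<and> pos_def_on q P}"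

subsection \<open>Symplectic spaces and Lagrangian subspaces\<close>

definition symplectic_form :: "(complex^'m \<Rightarrow> complex^'m \<Rightarrow> complex) \<Rightarrow> bool" where
  "symplectic_form \<omega> \<longleftrightarrow>
     (\<forall>c x y z. \<omega> (c *s x + y) z = c * \<omega> x z + \<omega> y z) \<and>
     (\<forall>x y. \<omega> y x = - cnj (\<omega> x y)) \<and>
     (\<forall>x. (\<forall>y. \<omega> x y = 0) \<longrightarrow> x = 0)"

definition lagrangian :: "(complex^'m \<Rightarrow> complex^'m \<Rightarrow> complex) \<Rightarrow> (complex^'m) set \<Rightarrow> bool" where
  "lagrangian \<omega> L \<longleftrightarrow> L = {x. \<forall>y\<in>L. \<omega> x y = 0}"

definition symplectic_splitting ::
    "(complex^'m \<Rightarrow> complex^'m \<Rightarrow> complex) \<Rightarrow> (complex^'m) set \<Rightarrow> (complex^'m) set \<Rightarrow> bool" where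
  "symplectic_splitting \<omega> Vp Vm \<longleftrightarrow>
     vec.subspace Vp \<and> vec.subspace Vm \<and>
     Vp \<inter> Vm = {0} \<and> {x + y | x y. x \<in> Vp \<and> y \<in> Vm} = UNIV \<and>
     (\<forall>x\<in>Vp. \<forall>y\<in>Vm. \<omega> x y = 0) \<and>
     pos_def_on (\<lambda>x y. - \<i> * \<omega> x y) Vp \<and>
     pos_def_on (\<lambda>x y. \<i> * \<omega> x y) Vm"

text \<open>
  \<open>graph_map Vp Vm L\<close> is, on \<open>Vp\<close>, the map \<open>U : Vp \<rightarrow> Vm\<close> whose graph \<open>{x + U x | x \<in> Vp}\<close> is the
  Lagrangian subspace \<open>L\<close>; its values outside \<open>Vp\<close> are irrelevant.
\<close>

definition graph_map ::
    "(complex^'m) set \<Rightarrow> (complex^'m) set \<Rightarrow> (complex^'m) set \<Rightarrow> complex^'m \<Rightarrow> complex^'m" where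
  "graph_map Vp Vm L x = (THE y. y \<in> Vm \<and> x + y \<in> L)"

subsection \<open>Eigenvalues of an operator on a subspace\<close>

definition spectrum_on :: "(complex^'m) set \<Rightarrow> (complex^'m \<Rightarrow> complex^'m) \<Rightarrow> complex set" where
  "spectrum_on V F = {z. \<exists>x\<in>V. x \<noteq> 0 \<and> F x = z *s x}"

text \<open>Algebraic multiplicity: the dimension of the generalized eigenspace.\<close>

definition multiplicity_on :: "(complex^'m) set \<Rightarrow> (complex^'m \<Rightarrow> complex^'m) \<Rightarrow> complex \<Rightarrow> nat" where
  "multiplicity_on V F z = vec.dim {x \<in> V. \<exists>j. ((\<lambda>v. F v - z *s v) ^^ j) x = 0}"

definition eig_count :: "(complex^'m) set \<Rightarrow> (complex^'m \<Rightarrow> complex^'m) \<Rightarrow> real \<Rightarrow> nat" where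
  "eig_count V F \<epsilon> =
     (\<Sum>z \<in> spectrum_on V F \<inter> {cis \<theta> | \<theta>. - \<epsilon> \<le> \<theta> \<and> \<theta> < 0}. multiplicity_on V F z)"

subsection \<open>The Maslov index\<close>

definition lagrangian_path ::
    "(complex^'m \<Rightarrow> complex^'m \<Rightarrow> complex) \<Rightarrow> (complex^'m) set \<Rightarrow> (complex^'m) set \<Rightarrow>
     real \<Rightarrow> real \<Rightarrow> (real \<Rightarrow> (complex^'m) set) \<Rightarrow> bool" where
  "lagrangian_path \<omega> Vp Vm a b L \<longleftrightarrow>
     (\<forall>t\<in>{a..b}. lagrangian \<omega> (L t)) \<and>
     (\<forall>x\<in>Vp. continuous_on {a..b} (\<lambda>t. graph_map Vp Vm (L t) x))"

text \<open>The operator \<open>U V\<^sup>-\<^sup>1\<close> on \<open>Vm\<close>, where \<open>L\<close> and \<open>L'\<close> are the graphs of \<open>U\<close> and \<open>V\<close>.\<close>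

definition relative_unitary ::
    "(complex^'m) set \<Rightarrow> (complex^'m) set \<Rightarrow> (complex^'m) set \<Rightarrow> (complex^'m) set \<Rightarrow>
     complex^'m \<Rightarrow> complex^'m" where
  "relative_unitary Vp Vm L L' = graph_map Vp Vm L \<circ> inv_into Vp (graph_map Vp Vm L')"

text \<open>
  \<open>is_maslov_index \<omega> a b \<lambda> \<mu> m\<close>: the integer \<open>m\<close> is obtained from some admissible choice of
  splitting, subdivision and angles. The Maslov index is the only such integer; it does not
  depend on the choices.
\<close>

definition is_maslov_index ::
    "(complex^'m \<Rightarrow> complex^'m \<Rightarrow> complex) \<Rightarrow> real \<Rightarrow> real \<Rightarrow>
     (real \<Rightarrow> (complex^'m) set) \<Rightarrow> (real \<Rightarrow> (complex^'m) set) \<Rightarrow> int \<Rightarrow> bool" where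
  "is_maslov_index \<omega> a b L L' m \<longleftrightarrow>
     symplectic_form \<omega> \<and>
     (\<exists>Vp Vm. \<exists>N :: nat. \<exists>s \<epsilon> :: nat \<Rightarrow> real.
        symplectic_splitting \<omega> Vp Vm \<and>
        lagrangian_path \<omega> Vp Vm a b L \<and> lagrangian_path \<omega> Vp Vm a b L' \<and>
        s 0 = a \<and> s N = b \<and>
        (\<forall>k<N. s k < s (Suc k) \<and> 0 < \<epsilon> k \<and> \<epsilon> k < pi \<and>
           (\<forall>t\<in>{s k..s (Suc k)}.
              cis (\<epsilon> k) \<notin> spectrum_on Vm (relative_unitary Vp Vm (L t) (L' t)) \<and>
              cis (- \<epsilon> k) \<notin> spectrum_on Vm (relative_unitary Vp Vm (L t) (L' t)))) \<and>
        m = - (\<Sum>k<N.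
           int (eig_count Vm (relative_unitary Vp Vm (L (s k)) (L' (s k))) (\<epsilon> k)) -
           int (eig_count Vm (relative_unitary Vp Vm (L (s (Suc k))) (L' (s (Suc k)))) (\<epsilon> k))))"

definition maslov_index ::
    "(complex^'m \<Rightarrow> complex^'m \<Rightarrow> complex) \<Rightarrow> real \<Rightarrow> real \<Rightarrow>
     (real \<Rightarrow> (complex^'m) set) \<Rightarrow> (real \<Rightarrow> (complex^'m) set) \<Rightarrow> int" where
  "maslov_index \<omega> a b L L' = (THE m. is_maslov_index \<omega> a b L L' m)"

subsection \<open>The index of a symplectic path\<close>

definition JK :: "complex^'n^'n \<Rightarrow> complex^('n + 'n)^('n + 'n)" where
  "JK K = block 0 (- cadj K) K 0"

definition omegaK :: "complex^'n^'n \<Rightarrow> complex^('n + 'n) \<Rightarrow> complex^('n + 'n) \<Rightarrow> complex" where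
  "omegaK K x y = cinner (JK K *v x) y"

text \<open>The form \<open>(-\<omega>) \<oplus> \<omega>\<close> on the doubled space.\<close>

definition double_form ::
    "(complex^'m \<Rightarrow> complex^'m \<Rightarrow> complex) \<Rightarrow> complex^('m + 'm) \<Rightarrow> complex^('m + 'm) \<Rightarrow> complex" where
  "double_form \<omega> z w = - \<omega> (vfst z) (vfst w) + \<omega> (vsnd z) (vsnd w)"

definition path_index ::
    "complex^'n^'n \<Rightarrow> (complex^(('n + 'n) + ('n + 'n))) set \<Rightarrow> real \<Rightarrow>
     (real \<Rightarrow> complex^('n + 'n)^('n + 'n)) \<Rightarrow> int" where
  "path_index K W T \<gamma> = maslov_index (double_form (omegaK K)) 0 T (\<lambda>t. Gr (\<gamma> t)) (\<lambda>t. W)"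

definition RK :: "complex^'n^'n \<Rightarrow> (complex^('n + 'n)) set \<Rightarrow> (complex^('n + 'n)) set" where
  "RK K R = {vpair x1 x2 | x1 x2.
     \<forall>y1 y2. vpair y1 y2 \<in> R \<longrightarrow> cinner (K *v x1) y1 - cinner (K *v x2) y2 = 0}"

definition WK :: "complex^'n^'n \<Rightarrow> (complex^('n + 'n)) set \<Rightarrow> (complex^(('n + 'n) + ('n + 'n))) set" where
  "WK K R = {vpair (vpair x1 x2) (vpair x3 x4) | x1 x2 x3 x4.
     vpair x1 x3 \<in> RK K R \<and> vpair x2 x4 \<in> R}"

definition SK :: "complex^'n^'n \<Rightarrow> (complex^('n + 'n)) set \<Rightarrow> complex^'n^'n \<Rightarrow> (complex^'n) set" where
  "SK K R M = {x. vpair x (M *v x) \<in> RK K R}"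

end

theory Submission
  imports Defs "HOL-Computational_Algebra.Fundamental_Theorem_Algebra"
begin

text \<open>
  \<^bold>\<open>Why the theorem holds.\<close> Put \<open>\<lambda>\<^sub>t = Gr (\<gamma> t)\<close> and \<open>\<mu> = W\<^sub>K(R)\<close>. For complementary Lagrangian subspaces
  \<open>A\<close> and \<open>B\<close> let \<open>pform \<omega> A B\<close> be the form \<open>(x, y) \<mapsto> \<omega> x\<^sub>A y\<^sub>B\<close>. It is Hermitian on every Lagrangian
  subspace, because \<open>\<omega>\<close> vanishes on that subspace, on \<open>A\<close> and on \<open>B\<close>. Everything is expressed through
  positive Morse indices of such forms, and Sylvester's law of inertia
  (\<open>sylvester_inertia\<close>) together with lower semicontinuity makes these indices constant along any
  continuous family whose kernel has constant dimension (\<open>morse_pos_constant\<close>).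

  \<^bold>\<open>Eigenvalues as Morse indices.\<close> Let \<open>\<mu>\<close> be the graph of \<open>V\<close>, and let \<open>\<rho>\<close> be the graph of
  \<open>e\<^bsup>-i\<epsilon>\<^esup> V\<close>. On an eigenvector of \<open>U V\<^sup>-\<^sup>1\<close> with eigenvalue \<open>e\<^bsup>i\<theta>\<^esup>\<close> the form \<open>pform \<omega> \<mu> \<rho>\<close>, evaluated
  on \<open>\<lambda> = Gr(U)\<close>, is a positive multiple of \<open>- sin ((\<epsilon> + \<theta>) / 2) sin (\<theta> / 2)\<close>. Among the angles between
  \<open>-\<epsilon>\<close> and \<open>2\<pi> - \<epsilon>\<close> it is positive exactly for \<open>-\<epsilon> < \<theta> < 0\<close>. Since eigenvectors of an isometry of a definite form span, the number of
  eigenvalues that the Maslov index counts is \<open>m\<^sup>+\<close> of this form (\<open>eig_count_eq_morse_pos\<close>).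

  \<^bold>\<open>Changing the auxiliary Lagrangian.\<close> If \<open>\<rho>\<close> and \<open>\<rho>'\<close> are both transversal to \<open>\<lambda>\<close> and \<open>\<mu>\<close>, two
  completions of the square in a single Hermitian form show that the indices for \<open>\<rho>\<close> and for \<open>\<rho>'\<close>
  differ by \<open>m\<^sup>+(pform \<omega> \<mu> \<rho>) - m\<^sup>+(pform \<omega> \<lambda> \<rho>)\<close> on \<open>\<rho>'\<close> (\<open>morse_exchange\<close>). The second form has kernel
  \<open>\<rho> \<inter> \<rho>'\<close>, so along a path the difference does not change. Therefore, whatever splitting,
  subdivision and angles are used, the Maslov index is the increment of \<open>m\<^sup>+(pform \<omega> \<mu> \<rho>')\<close> on \<open>\<lambda>\<^sub>t\<close>
  for any one \<open>\<rho>'\<close> transversal to the whole path and to \<open>\<mu>\<close> (\<open>maslov_index_by_reference\<close>). In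
  particular it does not depend on those choices.

  \<^bold>\<open>The lower triangular path.\<close> The form \<open>(-\<omega>) \<oplus> \<omega>\<close> pairs positions \<open>(x\<^sub>1, x\<^sub>3)\<close> with momenta
  \<open>(x\<^sub>2, x\<^sub>4)\<close>. With respect to this pairing \<open>\<mu>\<close> is the conormal space \<open>R\<^sup>K \<times> R\<close>, while \<open>\<lambda>\<^sub>t\<close> consists
  of the points over \<open>Gr(M\<^sub>1\<^sub>1)\<close> whose momentum is prescribed by the Hermitian matrix \<open>A = M\<^sub>1\<^sub>1\<^sup>* K\<^sup>* M\<^sub>2\<^sub>1\<close> modulo
  the annihilator of \<open>Gr(M\<^sub>1\<^sub>1)\<close>. Hence \<open>\<lambda>\<^sub>t \<inter> \<mu>\<close> fibres over the kernel of \<open>A\<close> on \<open>S\<close>, which gives the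
  dimension formula (\<open>dim_intersection\<close>). For the index take \<open>\<rho>'\<close> to be the
  subspace on which the momentum is \<open>\<kappa>\<close> times the position, with \<open>\<kappa>\<close> so large that \<open>\<kappa> + A\<close> is positive for all \<open>t\<close>.
  Comparing the reference form with \<open>A\<close> on \<open>S\<close> bounds both its positive and its negative index
  from above, and the dimension formula forces equality:
  \<open>m\<^sup>+ = m\<^sup>+(A|\<^sub>S) - dim S + dim R\<^sup>K\<close> (\<open>morse_pos_reference\<close>).
\<close>

section \<open>Linear algebra over the complex numbers\<close>

abbreviation lin :: "(complex^'m \<Rightarrow> complex^'k) \<Rightarrow> bool" where
  "lin \<equiv> Vector_Spaces.linear (*s) (*s)"

lemma linI:
  assumes "\<And>c x y. f (c *s x + y) = c *s f x + f y"
  shows "lin f"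
proof -
  have z: "f 0 = 0"
    using assms[of 1 0 0] by simp
  show ?thesis
  proof (unfold Vector_Spaces.linear_iff, intro conjI allI)
    show "vector_space ((*s) :: complex \<Rightarrow> complex^'a \<Rightarrow> _)" "vector_space ((*s) :: complex \<Rightarrow> complex^'b \<Rightarrow> _)"
      by unfold_locales
    show "f (x + y) = f x + f y" for x y
      using assms[of 1 x y] by simp
    show "f (c *s x) = c *s f x" for c x
      using assms[of c x 0] z by simp
  qed
qed

lemma lin_add: "lin f \<Longrightarrow> f (x + y) = f x + f y"
  and lin_scale: "lin f \<Longrightarrow> f (c *s x) = c *s f x"
  and lin_0: "lin f \<Longrightarrow> f 0 = 0"
  and lin_diff: "lin f \<Longrightarrow> f (x - y) = f x - f y"
  and lin_neg: "lin f \<Longrightarrow> f (- x) = - f x"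
  by (auto simp: vec.linear_add vec.linear_scale vec.linear_0 vec.linear_diff vec.linear_neg)

lemmas lin_simps = lin_add lin_scale lin_0 lin_diff lin_neg

lemma lin_compose: "lin f \<Longrightarrow> lin g \<Longrightarrow> lin (\<lambda>x. g (f x))"
  by (rule linI) (simp add: lin_simps)

lemma lin_plus: "lin f \<Longrightarrow> lin g \<Longrightarrow> lin (\<lambda>x. f x + g x)"
  by (rule linI) (simp add: lin_simps vec.scale_right_distrib)

lemma lin_minus: "lin f \<Longrightarrow> lin g \<Longrightarrow> lin (\<lambda>x. f x - g x)"
  by (rule linI) (simp add: lin_simps vec.scale_right_diff_distrib)

lemma lin_cmult: "lin f \<Longrightarrow> lin (\<lambda>x. c *s f x)"
  by (rule linI) (simp add: lin_simps vec.scale_right_distrib mult.commute)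

lemma lin_id: "lin (\<lambda>x. x)"
  by (rule linI) simp

lemma subspace_image: "lin f \<Longrightarrow> vec.subspace S \<Longrightarrow> vec.subspace (f ` S)"
  by (rule vec.linear_subspace_image)

lemma subspace_restrict_preimage:
  assumes "lin f" "vec.subspace S" "vec.subspace T"
  shows "vec.subspace {x \<in> S. f x \<in> T}"
  using assms by (auto intro!: vec.subspaceI simp: lin_simps vec.subspace_0 vec.subspace_add vec.subspace_scale)

lemma subspace_restrict_kernel:
  assumes "lin f" "vec.subspace S"
  shows "vec.subspace {x \<in> S. f x = 0}"
  using subspace_restrict_preimage[OF assms vec.subspace_single_0] by simp

lemma dim_injective_image:
  assumes "lin f" "vec.subspace S" "\<And>x. x \<in> S \<Longrightarrow> f x = 0 \<Longrightarrow> x = 0"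
  shows "vec.dim (f ` S) = vec.dim S"
proof (rule vec.dim_image_eq[OF assms(1)])
  show "inj_on f (vec.span S)"
  proof (rule inj_onI)
    fix x y assume "x \<in> vec.span S" "y \<in> vec.span S" "f x = f y"
    moreover have "vec.span S = S" using assms(2) by simp
    ultimately have "x - y \<in> S" "f (x - y) = 0"
      using assms(1,2) by (auto simp: lin_diff intro: vec.subspace_diff)
    then show "x = y" using assms(3) by fastforce
  qed
qed

lemma dim_sum_le:
  assumes "vec.subspace S" "vec.subspace A" "vec.subspace B" "A \<subseteq> S" "B \<subseteq> S"
  shows "vec.dim A + vec.dim B \<le> vec.dim S + vec.dim (A \<inter> B)"
proof -
  have "{x + y |x y. x \<in> A \<and> y \<in> B} \<subseteq> S"
    using assms by (auto intro: vec.subspace_add)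
  then have "vec.dim {x + y |x y. x \<in> A \<and> y \<in> B} \<le> vec.dim S"
    by (rule vec.dim_subset)
  then show ?thesis using vec.dim_sums_Int[OF assms(2,3)] by simp
qed

lemma dim_direct_sum:
  assumes "vec.subspace A" "vec.subspace B" "A \<inter> B \<subseteq> {0}"
  shows "vec.dim {x + y |x y. x \<in> A \<and> y \<in> B} = vec.dim A + vec.dim B"
proof -
  have "vec.dim (A \<inter> B) = 0"
    using assms(3) by simp
  then show ?thesis using vec.dim_sums_Int[OF assms(1,2)] by linarith
qed

lemma dim_disjoint_le:
  assumes "vec.subspace S" "vec.subspace A" "vec.subspace B" "A \<subseteq> S" "B \<subseteq> S" "A \<inter> B \<subseteq> {0}"
  shows "vec.dim A + vec.dim B \<le> vec.dim S"
proof -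
  have "vec.dim (A \<inter> B) = 0"
    using assms(6) by simp
  then show ?thesis using dim_sum_le[OF assms(1-5)] by linarith
qed

lemma subspace_complement:
  assumes "vec.subspace S" "vec.subspace A" "A \<subseteq> S"
  obtains C where "vec.subspace C" "C \<subseteq> S" "A \<inter> C = {0}" "S = {x + y |x y. x \<in> A \<and> y \<in> C}"
proof -
  obtain B where B: "B \<subseteq> A" "vec.independent B" "A \<subseteq> vec.span B"
    using vec.maximal_independent_subset by blast
  obtain D where D: "B \<subseteq> D" "D \<subseteq> S" "vec.independent D" "S \<subseteq> vec.span D"
    using vec.maximal_independent_subset_extend[of B S] B assms by blast
  define C where "C = vec.span (D - B)"
  have A: "A = vec.span B"
    using B assms by (metis vec.span_subspace)
  have S: "S = vec.span D"
    using D assms by (metis vec.span_subspace)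
  have sums: "S = {x + y |x y. x \<in> A \<and> y \<in> C}"
    using vec.span_Un[of B "D - B"] D(1) unfolding A S C_def by (simp add: Un_absorb1)
  have fin: "finite D" using D(3) vec.finiteI_independent by blast
  have "vec.dim A = card B"
    using A B(2) vec.dim_span_eq_card_independent by blast
  moreover have "vec.dim C = card (D - B)"
    unfolding C_def using D(3) vec.dim_span_eq_card_independent vec.independent_mono by blast
  moreover have "vec.dim S = card D"
    using S D(3) vec.dim_span_eq_card_independent by blast
  moreover have "card D = card B + card (D - B)"
    using fin D(1) by (metis add.commute card_Diff_subset card_mono finite_subset le_add_diff_inverse2)
  moreover have subC: "vec.subspace C" by (simp add: C_def)
  ultimately have "vec.dim (A \<inter> C) = 0"
    using vec.dim_sums_Int[OF assms(2) subC] sums by simp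
  then have "A \<inter> C \<subseteq> {0}" by simp
  moreover have "0 \<in> A \<inter> C"
    using assms subC by (simp add: vec.subspace_0)
  ultimately have "A \<inter> C = {0}" by blast
  moreover have "C \<subseteq> S"
    unfolding C_def S by (rule vec.span_mono) auto
  ultimately show thesis using that[OF subC] sums by blast
qed

lemma rank_nullity:
  assumes "lin f" "vec.subspace S"
  shows "vec.dim (f ` S) + vec.dim {x \<in> S. f x = 0} = vec.dim S"
proof -
  let ?N = "{x \<in> S. f x = 0}"
  have N: "vec.subspace ?N" using subspace_restrict_kernel assms by blast
  obtain C where C: "vec.subspace C" "C \<subseteq> S" "?N \<inter> C = {0}" "S = {x + y |x y. x \<in> ?N \<and> y \<in> C}"
    using subspace_complement[OF assms(2) N] by blast
  have "f ` S = f ` C"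
  proof
    show "f ` S \<subseteq> f ` C"
    proof
      fix z assume "z \<in> f ` S"
      then obtain s where s: "s \<in> S" "z = f s" by blast
      then obtain x y where "s = x + y" "f x = 0" "y \<in> C" using C(4) by blast
      then show "z \<in> f ` C" using s lin_add[OF assms(1)] by auto
    qed
  qed (use C(2) in blast)
  moreover have "vec.dim (f ` C) = vec.dim C"
    by (rule dim_injective_image[OF assms(1) C(1)]) (use C(2,3) in blast)
  moreover have "vec.dim S = vec.dim ?N + vec.dim C"
    using dim_direct_sum[OF N C(1)] C(3,4) by simp
  ultimately show ?thesis by simp
qed

text \<open>
  Cutting \<open>P\<close> down by the condition \<open>f x \<in> T\<close> costs at most the codimension of \<open>T\<close> in \<open>W\<close>. This
  turns inequalities between forms on subspaces into inequalities between Morse indices.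
\<close>

lemma dim_preimage_ge:
  assumes "lin f" "vec.subspace P" "vec.subspace W" "vec.subspace T" "f ` P \<subseteq> W" "T \<subseteq> W"
  shows "vec.dim P + vec.dim T \<le> vec.dim {x \<in> P. f x \<in> T} + vec.dim W"
proof -
  let ?P = "{x \<in> P. f x \<in> T}"
  have "f ` ?P = f ` P \<inter> T" by blast
  moreover have "{x \<in> ?P. f x = 0} = {x \<in> P. f x = 0}"
    using vec.subspace_0[OF assms(4)] by auto
  moreover have "vec.dim (f ` P) + vec.dim T \<le> vec.dim W + vec.dim (f ` P \<inter> T)"
    using dim_sum_le assms subspace_image by blast
  ultimately show ?thesis
    using rank_nullity[OF assms(1,2)] rank_nullity[OF assms(1) subspace_restrict_preimage[OF assms(1,2,4)]]
    by simp
qed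

subsection \<open>Complementary subspaces and projections\<close>

definition complementary :: "(complex^'m) set \<Rightarrow> (complex^'m) set \<Rightarrow> bool" where
  "complementary A B \<longleftrightarrow> vec.subspace A \<and> vec.subspace B \<and> A \<inter> B \<subseteq> {0} \<and>
     (\<forall>v. \<exists>a\<in>A. v - a \<in> B)"

definition proj :: "(complex^'m) set \<Rightarrow> (complex^'m) set \<Rightarrow> complex^'m \<Rightarrow> complex^'m" where
  "proj A B v = (THE a. a \<in> A \<and> v - a \<in> B)"

lemma complementary_dim:
  fixes A B :: "(complex^'m) set"
  assumes "vec.subspace A" "vec.subspace B" "A \<inter> B \<subseteq> {0}" "CARD('m) \<le> vec.dim A + vec.dim B"
  shows "complementary A B"
proof -
  let ?S = "{x + y |x y. x \<in> A \<and> y \<in> B}"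
  have "vec.dim ?S = vec.dim A + vec.dim B"
    by (rule dim_direct_sum) fact+
  then have "vec.dim (UNIV :: (complex^'m) set) \<le> vec.dim ?S"
    using assms(4) by (simp only: vec_dim_card)
  then have "?S = UNIV"
    using vec.subspace_dim_equal[OF vec.subspace_sums[OF assms(1,2)] vec.subspace_UNIV] by simp
  moreover have "\<exists>a\<in>A. v - a \<in> B" if "v \<in> ?S" for v
    using that by force
  ultimately show ?thesis
    using assms unfolding complementary_def by blast
qed

lemma complementary_sym: "complementary A B \<Longrightarrow> complementary B A"
  unfolding complementary_def
proof (intro conjI allI; elim conjE)
  fix v assume "\<forall>v. \<exists>a\<in>A. v - a \<in> B"
  then obtain a where "a \<in> A" "v - a \<in> B" by blast
  then show "\<exists>b\<in>B. v - b \<in> A" by (intro bexI[of _ "v - a"]) auto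
qed blast+

lemma proj_unique:
  assumes "complementary A B" "a \<in> A" "v - a \<in> B"
  shows "proj A B v = a"
  unfolding proj_def
proof (rule the_equality)
  fix a' assume a': "a' \<in> A \<and> v - a' \<in> B"
  have "a' - a \<in> A" "(v - a) - (v - a') \<in> B"
    using assms a' unfolding complementary_def by (blast intro: vec.subspace_diff)+
  then have "a' - a \<in> A \<inter> B" by simp
  then have "a' - a = 0" using assms(1) unfolding complementary_def by blast
  then show "a' = a" by simp
qed (use assms in simp)

lemma proj_in: "complementary A B \<Longrightarrow> proj A B v \<in> A"
  and proj_diff_in: "complementary A B \<Longrightarrow> v - proj A B v \<in> B"
proof -
  assume c: "complementary A B"
  then obtain a where "a \<in> A" "v - a \<in> B" unfolding complementary_def by blast
  with proj_unique[OF c this] show "proj A B v \<in> A" "v - proj A B v \<in> B" by simp_all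
qed

lemma proj_swap: "complementary A B \<Longrightarrow> proj B A v = v - proj A B v"
  by (rule proj_unique[OF complementary_sym]) (auto simp: proj_in proj_diff_in)

lemma proj_decomp: "complementary A B \<Longrightarrow> proj A B v + proj B A v = v"
  by (simp add: proj_swap)

lemma proj_lin:
  assumes "complementary A B" shows "lin (proj A B)"
proof (rule linI, rule proj_unique[OF assms])
  have sub: "vec.subspace A" "vec.subspace B" using assms unfolding complementary_def by auto
  fix c x y
  show "c *s proj A B x + proj A B y \<in> A"
    using sub proj_in[OF assms] by (simp add: vec.subspace_add vec.subspace_scale)
  have "c *s (x - proj A B x) + (y - proj A B y) \<in> B"
    by (intro vec.subspace_add vec.subspace_scale sub proj_diff_in[OF assms])
  then show "c *s x + y - (c *s proj A B x + proj A B y) \<in> B"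
    by (simp add: vec.scale_right_diff_distrib algebra_simps)
qed

lemma proj_id: "complementary A B \<Longrightarrow> x \<in> A \<Longrightarrow> proj A B x = x"
  by (rule proj_unique) (auto simp: complementary_def vec.subspace_0)

lemma proj_zero: "complementary A B \<Longrightarrow> x \<in> B \<Longrightarrow> proj A B x = 0"
  by (rule proj_unique) (auto simp: complementary_def vec.subspace_0)

lemma complementary_subspaces:
  "complementary A B \<Longrightarrow> vec.subspace A" "complementary A B \<Longrightarrow> vec.subspace B"
  by (auto simp: complementary_def)

lemma complementary_dims:
  fixes A B :: "(complex^'m) set"
  assumes "complementary A B"
  shows "vec.dim A + vec.dim B = CARD('m)"
proof -
  have "{x + y |x y. x \<in> A \<and> y \<in> B} = UNIV"
  proof (intro set_eqI iffI UNIV_I CollectI)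
    fix v
    show "\<exists>x y. v = x + y \<and> x \<in> A \<and> y \<in> B"
      using proj_in[OF assms, of v] proj_diff_in[OF assms, of v] 
      by (intro exI[of _ "proj A B v"] exI[of _ "v - proj A B v"]) auto
  qed
  then show ?thesis
    using dim_direct_sum[of A B] assms vec_dim_card[where 'a=complex and 'n='m]
    by (simp add: complementary_def)
qed

section \<open>Hermitian forms and their Morse indices\<close>

definition sesquilinear :: "(complex^'m \<Rightarrow> complex^'m \<Rightarrow> complex) \<Rightarrow> bool" where
  "sesquilinear q \<longleftrightarrow> (\<forall>c x y z. q (c *s x + y) z = c * q x z + q y z) \<and>
     (\<forall>c x y z. q z (c *s x + y) = cnj c * q z x + q z y)"

definition hermitian_on :: "(complex^'m \<Rightarrow> complex^'m \<Rightarrow> complex) \<Rightarrow> (complex^'m) set \<Rightarrow> bool" where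
  "hermitian_on q S \<longleftrightarrow> (\<forall>x\<in>S. \<forall>y\<in>S. q y x = cnj (q x y))"

lemma sesq_simps:
  assumes "sesquilinear q"
  shows "q (x + y) z = q x z + q y z" "q (c *s x) z = c * q x z"
    "q z (x + y) = q z x + q z y" "q z (c *s x) = cnj c * q z x"
    "q 0 z = 0" "q z 0 = 0" "q (- x) z = - q x z" "q z (- x) = - q z x"
    "q (x - y) z = q x z - q y z" "q z (x - y) = q z x - q z y"
proof -
  have l: "q (c *s x + y) z = c * q x z + q y z" and r: "q z (c *s x + y) = cnj c * q z x + q z y"
    for c x y z using assms unfolding sesquilinear_def by auto
  show add: "q (x + y) z = q x z + q y z" "q z (x + y) = q z x + q z y" for x y z
    using l[where c=1 and x=x and y=y and z=z] r[where c=1 and x=x and y=y and z=z] by auto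
  show zero: "q 0 z = 0" "q z 0 = 0" for z
    using l[where c=1 and x=0 and y=0 and z=z] r[where c=1 and x=0 and y=0 and z=z] by auto
  show sc: "q (c *s x) z = c * q x z" "q z (c *s x) = cnj c * q z x" for c x z
    using l[where c=c and x=x and y=0 and z=z] r[where c=c and x=x and y=0 and z=z] zero by auto
  show neg: "q (- x) z = - q x z" "q z (- x) = - q z x" for x z
    using sc(1)[where c="-1" and x=x and z=z] sc(2)[where c="-1" and x=x and z=z] by auto
  show "q (x - y) z = q x z - q y z" "q z (x - y) = q z x - q z y"
    using add(1)[where x=x and y="-y" and z=z] add(2)[where x=x and y="-y" and z=z] neg[where x=y and z=z] by auto
qed

lemma sesq_left_lin: "sesquilinear q \<Longrightarrow> q (c *s x + y) z = c * q x z + q y z"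
  by (simp add: sesquilinear_def)

lemma sesq_sum_left: "sesquilinear q \<Longrightarrow> q (\<Sum>i\<in>A. f i) y = (\<Sum>i\<in>A. q (f i) y)"
  by (induction A rule: infinite_finite_induct) (auto simp: sesq_simps)

lemma sesq_sum_right: "sesquilinear q \<Longrightarrow> q y (\<Sum>i\<in>A. f i) = (\<Sum>i\<in>A. q y (f i))"
  by (induction A rule: infinite_finite_induct) (auto simp: sesq_simps)

lemma sesq_expand:
  assumes "sesquilinear q"
  shows "q x y = (\<Sum>i\<in>UNIV. \<Sum>j\<in>UNIV. x $ i * cnj (y $ j) * q (axis i 1) (axis j 1))"
proof -
  have "q x y = q (\<Sum>i\<in>UNIV. x $ i *s axis i 1) (\<Sum>j\<in>UNIV. y $ j *s axis j 1)"
    by (simp add: basis_expansion)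
  also have "\<dots> = (\<Sum>i\<in>UNIV. \<Sum>j\<in>UNIV. x $ i * cnj (y $ j) * q (axis i 1) (axis j 1))"
    unfolding sesq_sum_left[OF assms] unfolding sesq_sum_right[OF assms]
    by (simp add: sesq_simps[OF assms] mult_ac)
  finally show ?thesis .
qed

lemma sesquilinear_minus: "sesquilinear q \<Longrightarrow> sesquilinear (\<lambda>x y. - q x y)"
  by (simp add: sesquilinear_def)

lemma sesquilinear_compose:
  "sesquilinear q \<Longrightarrow> lin f \<Longrightarrow> lin g \<Longrightarrow> sesquilinear (\<lambda>x y. q (f x) (g y))"
  unfolding sesquilinear_def by (intro conjI allI) (simp_all only: lin_add lin_scale)

lemma hermitian_on_subset: "hermitian_on q S \<Longrightarrow> T \<subseteq> S \<Longrightarrow> hermitian_on q T"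
  unfolding hermitian_on_def by blast

lemma hermitianD: "hermitian_on q S \<Longrightarrow> x \<in> S \<Longrightarrow> y \<in> S \<Longrightarrow> q y x = cnj (q x y)"
  unfolding hermitian_on_def by blast

lemma hermitian_on_minus:
  assumes "hermitian_on q S" shows "hermitian_on (\<lambda>x y. - q x y) S"
  unfolding hermitian_on_def
proof (intro ballI)
  fix x y assume "x \<in> S" "y \<in> S"
  then show "- q y x = cnj (- q x y)" by (simp only: hermitianD[OF assms, of x y] complex_cnj_minus)
qed

lemma hermitian_real:
  assumes "hermitian_on q S" "x \<in> S" shows "q x x \<in> \<real>"
proof -
  have "cnj (q x x) = q x x" using hermitianD[OF assms(1,2,2)] by (rule sym)
  then show ?thesis by (simp only: Reals_cnj_iff)
qed

lemma hermitian_pos_def: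
  "hermitian_on q S \<Longrightarrow> P \<subseteq> S \<Longrightarrow> (\<And>x. x \<in> P \<Longrightarrow> x \<noteq> 0 \<Longrightarrow> 0 < Re (q x x)) \<Longrightarrow> pos_def_on q P"
  unfolding pos_def_on_def using hermitian_real by blast

lemma subspace_form_ker:
  assumes "sesquilinear q" "vec.subspace S" shows "vec.subspace (form_ker q S)"
  unfolding form_ker_def using assms
  by (auto intro!: vec.subspaceI simp: sesq_simps vec.subspace_0 vec.subspace_add vec.subspace_scale)

definition form_perp ::
    "(complex^'m \<Rightarrow> complex^'m \<Rightarrow> complex) \<Rightarrow> (complex^'m) set \<Rightarrow> (complex^'m) set \<Rightarrow> (complex^'m) set" where
  "form_perp q S U = {x \<in> S. \<forall>y\<in>U. q x y = 0}"

lemma subspace_form_perp: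
  assumes "sesquilinear q" "vec.subspace S" shows "vec.subspace (form_perp q S U)"
  unfolding form_perp_def using assms
  by (auto intro!: vec.subspaceI simp: sesq_simps vec.subspace_0 vec.subspace_add vec.subspace_scale)

text \<open>
  For a basis \<open>B\<close> of \<open>U\<close>, the linear map \<open>x \<mapsto> \<Sum>u\<in>B. q x u *s u\<close> takes values in \<open>U\<close>, and by independence
  of \<open>B\<close> its kernel is the complement in question.
\<close>

lemma dim_form_perp_ge:
  assumes q: "sesquilinear q" and S: "vec.subspace S" and U: "vec.subspace U"
  shows "vec.dim S \<le> vec.dim U + vec.dim (form_perp q S U)"
proof -
  obtain B where B: "B \<subseteq> U" "vec.independent B" "U \<subseteq> vec.span B"
    using vec.maximal_independent_subset by blast
  have fin: "finite B" using B(2) vec.finiteI_independent by blast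
  define f where "f x = (\<Sum>u\<in>B. q x u *s u)" for x
  have lf: "lin f"
    by (rule linI) (simp add: f_def sesq_left_lin[OF q] vec.scale_left_distrib sum.distrib
        vec.scale_sum_right)
  have "f ` S \<subseteq> U"
    unfolding f_def using B(1) U by (auto intro!: vec.subspace_sum vec.subspace_scale)
  then have "vec.dim (f ` S) \<le> vec.dim U" by (rule vec.dim_subset)
  moreover have "{x \<in> S. f x = 0} \<subseteq> form_perp q S U"
  proof
    fix x assume x: "x \<in> {x \<in> S. f x = 0}"
    then have *: "q x u = 0" if "u \<in> B" for u
      using vec.independentD[OF B(2) fin subset_refl, of "q x" u] that unfolding f_def by blast
    have "q x y = 0" if "y \<in> vec.span B" for y
      using that by (induction rule: vec.span_induct_alt) (auto simp: sesq_simps[OF q] *)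
    then show "x \<in> form_perp q S U" using x B(3) unfolding form_perp_def by blast
  qed
  then have "vec.dim {x \<in> S. f x = 0} \<le> vec.dim (form_perp q S U)" by (rule vec.dim_subset)
  ultimately show ?thesis using rank_nullity[OF lf S] by linarith
qed

subsection \<open>The positive Morse index\<close>

lemma morse_pos_dims:
  fixes S :: "(complex^'m) set"
  shows "finite {vec.dim P | P. vec.subspace P \<and> P \<subseteq> S \<and> pos_def_on q P}"
proof (rule finite_subset)
  show "{vec.dim P | P. vec.subspace P \<and> P \<subseteq> S \<and> pos_def_on q P} \<subseteq> {..vec.dim S}"
    by (auto intro: vec.dim_subset)
qed simp

lemma morse_pos_ge:
  assumes "vec.subspace P" "P \<subseteq> S" "pos_def_on q P"
  shows "vec.dim P \<le> morse_pos q S"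
  unfolding morse_pos_def by (rule Max_ge[OF morse_pos_dims]) (use assms in blast)

lemma morse_pos_attained:
  assumes "vec.subspace S"
  obtains P where "vec.subspace P" "P \<subseteq> S" "pos_def_on q P" "vec.dim P = morse_pos q S"
proof -
  have "{0} \<subseteq> S" using assms vec.subspace_0 by blast
  then have "vec.dim {0} \<in> {vec.dim P | P. vec.subspace P \<and> P \<subseteq> S \<and> pos_def_on q P}"
    by (auto simp: pos_def_on_def intro!: exI[of _ "{0}"])
  then have "morse_pos q S \<in> {vec.dim P | P. vec.subspace P \<and> P \<subseteq> S \<and> pos_def_on q P}"
    unfolding morse_pos_def using Max_in[OF morse_pos_dims] by blast
  then show thesis using that by auto
qed

text \<open>
  The equality case of the Cauchy--Schwarz inequality: if \<open>q x y\<close> were nonzero, then adding to \<open>y\<close> a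
  suitable multiple of the null vector \<open>x\<close> would make the value of the form positive.
\<close>

lemma semidefinite_null:
  assumes q: "sesquilinear q" and h: "hermitian_on q T" and T: "vec.subspace T"
    and le: "\<And>x. x \<in> T \<Longrightarrow> Re (q x x) \<le> 0"
    and x: "x \<in> T" "q x x = 0" and y: "y \<in> T"
  shows "q x y = 0"
proof (rule ccontr)
  assume ne: "q x y \<noteq> 0"
  define r where "r = (cmod (q x y))\<^sup>2"
  have r: "r > 0" unfolding r_def using ne by simp
  \<comment> \<open>the value of the form at \<open>c *s x + y\<close> is \<open>2 * s * r + q y y\<close>, which this \<open>s\<close> makes equal to 1\<close>
  define s where "s = (1 - Re (q y y)) / (2 * r)"
  define c where "c = complex_of_real s * cnj (q x y)"
  have yx: "q y x = cnj (q x y)" by (rule hermitianD[OF h x(1) y])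
  have m: "q x y * cnj (q x y) = complex_of_real r"
    unfolding r_def by (simp only: complex_norm_square)
  have "c * q x y = complex_of_real (s * r)"
    unfolding c_def using m by (simp add: mult.commute mult.left_commute)
  moreover have "q (c *s x + y) (c *s x + y) = c * q x y + cnj (c * q x y) + q y y"
    using x(2) by (simp add: sesq_simps[OF q] yx)
  ultimately have "Re (q (c *s x + y) (c *s x + y)) = 2 * (s * r) + Re (q y y)"
    by simp
  also have "\<dots> = 1" unfolding s_def using r by (simp add: field_simps)
  finally show False
    using le[of "c *s x + y"] x(1) y T by (simp add: vec.subspace_add vec.subspace_scale)
qed

text \<open>
  A maximal positive definite subspace \<open>P\<close> leaves a form that is negative semidefinite on the
  orthogonal complement of \<open>P\<close>, and there the null vectors are exactly the kernel.
\<close>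

lemma inertia_decomposition:
  assumes q: "sesquilinear q" and h: "hermitian_on q S" and S: "vec.subspace S"
  obtains P N where "vec.subspace P" "vec.subspace N" "P \<subseteq> S" "N \<subseteq> S"
    "pos_def_on q P" "pos_def_on (\<lambda>x y. - q x y) N" "\<And>x y. x \<in> P \<Longrightarrow> y \<in> N \<Longrightarrow> q x y = 0"
    "vec.dim P = morse_pos q S" "vec.dim P + vec.dim N + vec.dim (form_ker q S) = vec.dim S"
proof -
  obtain P where P: "vec.subspace P" "P \<subseteq> S" "pos_def_on q P" "vec.dim P = morse_pos q S"
    using morse_pos_attained[OF S] by blast
  define T where "T = form_perp q S P"
  have T: "vec.subspace T" "T \<subseteq> S" and TP: "\<And>x y. x \<in> T \<Longrightarrow> y \<in> P \<Longrightarrow> q x y = 0"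
    using subspace_form_perp[OF q S] by (auto simp: T_def form_perp_def)
  have PT: "q y x = 0" if "x \<in> T" "y \<in> P" for x y
    using TP[OF that] hermitianD[OF h, of x y] that T P by auto
  have disj: "P \<inter> T \<subseteq> {0}"
  proof
    fix x assume "x \<in> P \<inter> T"
    then have "q x x = 0" "x \<in> P" using TP by auto
    then show "x \<in> {0}" using P(3) unfolding pos_def_on_def by fastforce
  qed
  have dimPT: "vec.dim {x + y |x y. x \<in> P \<and> y \<in> T} = vec.dim P + vec.dim T"
    by (rule dim_direct_sum) fact+
  have ge: "vec.dim S \<le> vec.dim P + vec.dim T"
    unfolding T_def by (rule dim_form_perp_ge[OF q S P(1)])
  have "{x + y |x y. x \<in> P \<and> y \<in> T} \<subseteq> S"
    using P(2) T(2) S by (auto intro: vec.subspace_add)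
  then have sums: "{x + y |x y. x \<in> P \<and> y \<in> T} = S"
    using vec.subspace_dim_equal[OF vec.subspace_sums[OF P(1) T(1)] S] ge dimPT by simp
  have le: "Re (q x x) \<le> 0" if x: "x \<in> T" for x
  proof (rule ccontr)
    assume "\<not> Re (q x x) \<le> 0"
    then have pos: "Re (q x x) > 0" by simp
    then have x0: "x \<noteq> 0" using sesq_simps[OF q] by auto
    let ?L = "vec.span {x}"
    let ?P = "{p + y |p y. p \<in> P \<and> y \<in> ?L}"
    have LT: "?L \<subseteq> T" using x T(1) vec.span_minimal by blast
    have "pos_def_on q ?P"
    proof (rule hermitian_pos_def[OF h])
      show "?P \<subseteq> S" using P(2) LT T(2) S by (auto intro!: vec.subspace_add)
      fix z assume "z \<in> ?P" and z0: "z \<noteq> 0"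
      then obtain p c where z: "z = p + c *s x" "p \<in> P"
        by (auto simp: vec.span_singleton)
      have "q z z = q p p + c * cnj c * q x x"
        using TP[OF x z(2)] PT[OF x z(2)] by (simp add: z sesq_simps[OF q])
      also have "c * cnj c = complex_of_real ((cmod c)\<^sup>2)" by (simp only: complex_norm_square)
      finally have *: "Re (q z z) = Re (q p p) + (cmod c)\<^sup>2 * Re (q x x)" by simp
      show "0 < Re (q z z)"
      proof (cases "p = 0")
        case True
        then have "c \<noteq> 0" using z z0 by auto
        then show ?thesis using * True pos sesq_simps(5)[OF q] by simp
      next
        case False
        then have "0 < Re (q p p)" using P(3) z(2) unfolding pos_def_on_def by blast
        moreover have "0 \<le> (cmod c)\<^sup>2 * Re (q x x)" using pos by simp
        ultimately show ?thesis using * by linarith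
      qed
    qed
    moreover have "vec.subspace ?P" using vec.subspace_sums P(1) vec.subspace_span by blast
    moreover have "?P \<subseteq> S" using P(2) LT T(2) S by (auto intro!: vec.subspace_add)
    moreover have "vec.dim ?P = vec.dim P + vec.dim ?L"
      by (rule dim_direct_sum) (use P(1) disj LT in auto)
    moreover have "vec.dim ?L = 1" using x0 by simp
    ultimately show False using morse_pos_ge[of ?P S q] P(4) by simp
  qed
  define K where "K = form_ker q S"
  have K: "vec.subspace K" "K \<subseteq> T"
    using subspace_form_ker[OF q S] P(2) by (auto simp: K_def T_def form_ker_def form_perp_def)
  have null: "x \<in> K" if "x \<in> T" "q x x = 0" for x
  proof -
    have "q x s = 0" if "s \<in> S" for s
    proof -
      obtain p t where "s = p + t" "p \<in> P" "t \<in> T" using \<open>s \<in> S\<close> sums by blast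
      then show ?thesis
        using TP[OF \<open>x \<in> T\<close>] semidefinite_null[OF q hermitian_on_subset[OF h T(2)] T(1) le \<open>x \<in> T\<close> \<open>q x x = 0\<close>]
        by (simp add: sesq_simps[OF q])
    qed
    then show ?thesis using that T(2) unfolding K_def form_ker_def by blast
  qed
  obtain N where N: "vec.subspace N" "N \<subseteq> T" "K \<inter> N = {0}" "T = {x + y |x y. x \<in> K \<and> y \<in> N}"
    using subspace_complement[OF T(1) K] by blast
  have "pos_def_on (\<lambda>x y. - q x y) N"
  proof (rule hermitian_pos_def[OF hermitian_on_minus[OF h]])
    fix x assume x: "x \<in> N" "x \<noteq> 0"
    then have "x \<notin> K" "x \<in> T" using N by auto
    then have "q x x \<noteq> 0" "Re (q x x) \<le> 0" "q x x \<in> \<real>"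
      using null le hermitian_real[OF h] T(2) by auto
    then show "0 < Re (- q x x)" by (auto elim!: Reals_cases)
  qed (use N T in blast)
  moreover have "vec.dim T = vec.dim K + vec.dim N"
    using dim_direct_sum[OF K(1) N(1)] N(3,4) by simp
  moreover have "vec.dim S = vec.dim P + vec.dim T"
    using dimPT sums by simp
  ultimately have "vec.dim P + vec.dim N + vec.dim (form_ker q S) = vec.dim S" "pos_def_on (\<lambda>x y. - q x y) N"
    unfolding K_def by simp_all
  moreover have "N \<subseteq> S" "\<And>x y. x \<in> P \<Longrightarrow> y \<in> N \<Longrightarrow> q x y = 0"
    using N(2) T(2) PT by blast+
  ultimately show thesis
    using that[OF P(1) N(1) P(2) _ P(3) _ _ P(4)] by blast
qed

lemma definite_disjoint:
  assumes "pos_def_on q P" "\<And>x. x \<in> N \<Longrightarrow> Re (q x x) \<le> 0"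
  shows "P \<inter> N \<subseteq> {0}"
proof
  fix x assume x: "x \<in> P \<inter> N"
  then have "x \<noteq> 0 \<Longrightarrow> 0 < Re (q x x)" using assms(1) unfolding pos_def_on_def by blast
  then show "x \<in> {0}" using assms(2)[of x] x by fastforce
qed

text \<open>
  One inequality is the decomposition above. For the other, a positive definite subspace meets the
  sum of a negative definite one and the kernel only in zero, since the form is nonpositive there.
\<close>

theorem sylvester_inertia:
  assumes q: "sesquilinear q" and h: "hermitian_on q S" and S: "vec.subspace S"
  shows "morse_pos q S + morse_pos (\<lambda>x y. - q x y) S + vec.dim (form_ker q S) = vec.dim S"
proof (rule antisym)
  show "vec.dim S \<le> morse_pos q S + morse_pos (\<lambda>x y. - q x y) S + vec.dim (form_ker q S)"
  proof (rule inertia_decomposition[OF q h S])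
    fix P N assume "vec.subspace N" "N \<subseteq> S" "pos_def_on (\<lambda>x y. - q x y) N" "vec.dim P = morse_pos q S"
      and *: "vec.dim P + vec.dim N + vec.dim (form_ker q S) = vec.dim S"
    then show ?thesis using morse_pos_ge[of N S] by fastforce
  qed
  obtain P where P: "vec.subspace P" "P \<subseteq> S" "pos_def_on q P" "vec.dim P = morse_pos q S"
    using morse_pos_attained[OF S] by blast
  obtain N where N: "vec.subspace N" "N \<subseteq> S" "pos_def_on (\<lambda>x y. - q x y) N"
      "vec.dim N = morse_pos (\<lambda>x y. - q x y) S"
    using morse_pos_attained[OF S] by blast
  let ?K = "form_ker q S"
  have K: "vec.subspace ?K" "?K \<subseteq> S" and K0: "\<And>x y. x \<in> ?K \<Longrightarrow> y \<in> S \<Longrightarrow> q x y = 0"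
    using subspace_form_ker[OF q S] by (auto simp: form_ker_def)
  have K0': "q y x = 0" if "x \<in> ?K" "y \<in> S" for x y
    using K0[OF that] hermitianD[OF h, of x y] that K by auto
  let ?T = "{x + y |x y. x \<in> N \<and> y \<in> ?K}"
  have "N \<inter> ?K \<subseteq> {0}"
    by (rule definite_disjoint[OF N(3)]) (use K K0 in auto)
  then have dT: "vec.dim ?T = vec.dim N + vec.dim ?K"
    by (rule dim_direct_sum[OF N(1) K(1)])
  have "P \<inter> ?T \<subseteq> {0}"
  proof (rule definite_disjoint[OF P(3)])
    fix x assume "x \<in> ?T"
    then obtain y z where x: "x = y + z" "y \<in> N" "z \<in> ?K" by blast
    then have "q x x = q y y"
      using K0 K0' N(2) K(2) by (auto simp: sesq_simps[OF q] subset_iff)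
    moreover have "Re (q y y) \<le> 0"
    proof (cases "y = 0")
      case False
      then show ?thesis using N(3) x(2) unfolding pos_def_on_def by fastforce
    qed (simp add: sesq_simps[OF q])
    ultimately show "Re (q x x) \<le> 0" by simp
  qed
  then have "vec.dim P + vec.dim ?T \<le> vec.dim S"
  proof (rule dim_disjoint_le[OF S P(1) _ P(2), rotated 2])
    show "vec.subspace ?T" by (rule vec.subspace_sums[OF N(1) K(1)])
    show "?T \<subseteq> S" using N(2) K(2) S by (auto intro!: vec.subspace_add)
  qed
  then show "morse_pos q S + morse_pos (\<lambda>x y. - q x y) S + vec.dim ?K \<le> vec.dim S"
    using dT P(4) N(4) by simp
qed

lemma morse_pos_sum_ge:
  assumes q: "sesquilinear q" and h: "hermitian_on q S" and S: "vec.subspace S"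
    and A: "vec.subspace A" "A \<subseteq> S" and B: "vec.subspace B" "B \<subseteq> S" and disj: "A \<inter> B \<subseteq> {0}"
    and orth: "\<And>a b. a \<in> A \<Longrightarrow> b \<in> B \<Longrightarrow> q a b = 0"
  shows "morse_pos q A + morse_pos q B \<le> morse_pos q S"
proof -
  obtain P where P: "vec.subspace P" "P \<subseteq> A" "pos_def_on q P" "vec.dim P = morse_pos q A"
    using morse_pos_attained[OF A(1)] by blast
  obtain N where N: "vec.subspace N" "N \<subseteq> B" "pos_def_on q N" "vec.dim N = morse_pos q B"
    using morse_pos_attained[OF B(1)] by blast
  let ?P = "{x + y |x y. x \<in> P \<and> y \<in> N}"
  have sub: "?P \<subseteq> S" using P(2) N(2) A(2) B(2) S by (auto intro!: vec.subspace_add)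
  have "pos_def_on q ?P"
  proof (rule hermitian_pos_def[OF h sub])
    fix z assume "z \<in> ?P" and z0: "z \<noteq> 0"
    then obtain x y where z: "z = x + y" "x \<in> P" "y \<in> N" by blast
    have xy: "q x y = 0" "x \<in> S" "y \<in> S" using orth z P(2) N(2) A B by auto
    then have "q y x = 0" using hermitianD[OF h, of x y] by simp
    then have *: "q z z = q x x + q y y" using xy by (simp add: z sesq_simps[OF q])
    have "x \<noteq> 0 \<Longrightarrow> 0 < Re (q x x)" "y \<noteq> 0 \<Longrightarrow> 0 < Re (q y y)"
      using z P(3) N(3) unfolding pos_def_on_def by auto
    then show "0 < Re (q z z)"
      using * z0 z(1) sesq_simps(5)[OF q, of 0] by (cases "x = 0"; cases "y = 0") auto
  qed
  moreover have "vec.dim ?P = vec.dim P + vec.dim N"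
    by (rule dim_direct_sum[OF P(1) N(1)]) (use P(2) N(2) disj in blast)
  ultimately show ?thesis
    using morse_pos_ge[OF vec.subspace_sums[OF P(1) N(1)] sub] P(4) N(4) by simp
qed

text \<open>
  The positive index, the negative index and the dimension of the kernel are each superadditive.
  Their sum is a dimension, which is additive, so none of the three inequalities can be strict.
\<close>

lemma morse_pos_orthogonal_sum:
  assumes q: "sesquilinear q" and h: "hermitian_on q S" and S: "S = {a + b |a b. a \<in> A \<and> b \<in> B}"
    and A: "vec.subspace A" and B: "vec.subspace B" and disj: "A \<inter> B \<subseteq> {0}"
    and orth: "\<And>a b. a \<in> A \<Longrightarrow> b \<in> B \<Longrightarrow> q a b = 0"
  shows "morse_pos q S = morse_pos q A + morse_pos q B"
proof -
  have S': "vec.subspace S" unfolding S by (rule vec.subspace_sums[OF A B])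
  have AS: "A \<subseteq> S" "B \<subseteq> S"
  proof -
    show "A \<subseteq> S" unfolding S using vec.subspace_0[OF B] by force
    show "B \<subseteq> S" unfolding S using vec.subspace_0[OF A] by force
  qed
  have "morse_pos q A + morse_pos q B \<le> morse_pos q S"
    using morse_pos_sum_ge[OF q h S' A AS(1) B AS(2) disj orth] .
  moreover have "morse_pos (\<lambda>x y. - q x y) A + morse_pos (\<lambda>x y. - q x y) B \<le> morse_pos (\<lambda>x y. - q x y) S"
    using morse_pos_sum_ge[OF sesquilinear_minus[OF q] hermitian_on_minus[OF h] S' A AS(1) B AS(2) disj] orth
    by simp
  moreover have "vec.dim (form_ker q A) + vec.dim (form_ker q B) \<le> vec.dim (form_ker q S)"
  proof (rule dim_disjoint_le)
    have orth': "q b a = 0" if "a \<in> A" "b \<in> B" for a b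
      using orth[OF that] hermitianD[OF h, of a b] that AS by auto
    show "form_ker q A \<subseteq> form_ker q S" "form_ker q B \<subseteq> form_ker q S"
      using orth orth' AS unfolding form_ker_def S by (auto simp: sesq_simps[OF q])
    show "form_ker q A \<inter> form_ker q B \<subseteq> {0}"
      using disj unfolding form_ker_def by blast
  qed (use subspace_form_ker[OF q] A B S' in auto)
  moreover have "vec.dim S = vec.dim A + vec.dim B"
    unfolding S by (rule dim_direct_sum[OF A B disj])
  ultimately show ?thesis
    using sylvester_inertia[OF q h S'] sylvester_inertia[OF q hermitian_on_subset[OF h AS(1)] A]
      sylvester_inertia[OF q hermitian_on_subset[OF h AS(2)] B] by linarith
qed

lemma morse_pos_pullback:
  assumes f: "lin f" and S: "vec.subspace S" and inj: "\<And>x. x \<in> S \<Longrightarrow> f x = 0 \<Longrightarrow> x = 0"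
    and eq: "\<And>x. x \<in> S \<Longrightarrow> q' (f x) (f x) = q x x"
  shows "morse_pos q' (f ` S) = morse_pos q S"
proof (rule antisym)
  have fS: "vec.subspace (f ` S)" by (rule subspace_image[OF f S])
  obtain P where P: "vec.subspace P" "P \<subseteq> S" "pos_def_on q P" "vec.dim P = morse_pos q S"
    using morse_pos_attained[OF S] by blast
  have "pos_def_on q' (f ` P)"
    using P(2,3) eq lin_0[OF f] unfolding pos_def_on_def by (auto simp: subset_iff)
  moreover have "vec.dim (f ` P) = vec.dim P"
    using dim_injective_image[OF f P(1)] inj P(2) by blast
  ultimately show "morse_pos q S \<le> morse_pos q' (f ` S)"
    using morse_pos_ge[OF subspace_image[OF f P(1)], of "f ` S" q'] P(2,4) by auto
  obtain P' where P': "vec.subspace P'" "P' \<subseteq> f ` S" "pos_def_on q' P'" "vec.dim P' = morse_pos q' (f ` S)"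
    using morse_pos_attained[OF fS] by blast
  let ?P = "{x \<in> S. f x \<in> P'}"
  have sub: "vec.subspace ?P" by (rule subspace_restrict_preimage[OF f S P'(1)])
  have "pos_def_on q ?P"
    unfolding pos_def_on_def
  proof (intro ballI impI)
    fix x assume x: "x \<in> ?P" "x \<noteq> 0"
    then have "f x \<noteq> 0" using inj by blast
    then show "q x x \<in> \<real> \<and> 0 < Re (q x x)"
      using x P'(3) eq[of x] unfolding pos_def_on_def by auto
  qed
  moreover have "f ` ?P = P'" using P'(2) by blast
  then have "vec.dim ?P = vec.dim P'"
    using dim_injective_image[OF f sub] inj by simp
  ultimately show "morse_pos q' (f ` S) \<le> morse_pos q S"
    using morse_pos_ge[OF sub, of S q] P'(4) by auto
qed

lemma morse_pos_cong:
  assumes "\<And>x. x \<in> S \<Longrightarrow> q x x = q' x x"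
  shows "morse_pos q S = morse_pos q' S"
proof -
  have "pos_def_on q P \<longleftrightarrow> pos_def_on q' P" if "P \<subseteq> S" for P
    unfolding pos_def_on_def using assms that by (auto simp: subset_iff)
  then have "(vec.subspace P \<and> P \<subseteq> S \<and> pos_def_on q P) = (vec.subspace P \<and> P \<subseteq> S \<and> pos_def_on q' P)" for P
    by blast
  then show ?thesis unfolding morse_pos_def by (simp only:)
qed

subsection \<open>Continuous families of forms\<close>

lemma complex_of_real_smult: "complex_of_real r *s x = r *\<^sub>R (x :: complex^'m)"
  by (rule vec_eq_iff[THEN iffD2], intro allI)
    (subst vector_smult_component, subst vector_scaleR_component, rule scaleR_conv_of_real[symmetric])

lemma closed_complex_subspace:
  fixes P :: "(complex^'m) set"
  assumes "vec.subspace P" shows "closed P"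
proof -
  have "subspace P"
  proof (rule subspaceI)
    show "r *\<^sub>R x \<in> P" if "x \<in> P" for r x
      using vec.subspace_scale[OF assms that, of "complex_of_real r"] by (simp add: complex_of_real_smult)
  qed (use assms vec.subspace_0 vec.subspace_add in auto)
  then show ?thesis by (rule closed_subspace)
qed

lemma sesq_scaleR:
  assumes "sesquilinear q" shows "q (r *\<^sub>R x) (r *\<^sub>R x) = complex_of_real (r\<^sup>2) * q x x"
  unfolding complex_of_real_smult[symmetric] by (simp add: sesq_simps[OF assms] power2_eq_square)

lemma normalize_in_subspace:
  fixes P :: "(complex^'m) set"
  assumes "vec.subspace P" "x \<in> P" "x \<noteq> 0"
  obtains u where "u \<in> P" "norm u = 1" "x = norm x *\<^sub>R u"
proof
  let ?u = "(1 / norm x) *\<^sub>R x"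
  show "?u \<in> P"
    using vec.subspace_scale[OF assms(1,2), of "complex_of_real (1 / norm x)"]
    by (simp only: complex_of_real_smult)
qed (use assms(3) in auto)

lemma continuous_on_sesq:
  assumes "sesquilinear q" shows "continuous_on A (\<lambda>x. q x x)"
proof -
  have "continuous_on A (\<lambda>x. \<Sum>i\<in>UNIV. \<Sum>j\<in>UNIV. x $ i * cnj (x $ j) * q (axis i 1) (axis j 1))"
    by (intro continuous_intros)
  then show ?thesis by (simp only: sesq_expand[OF assms, symmetric])
qed

lemma pos_def_lower_bound:
  fixes P :: "(complex^'m) set"
  assumes q: "sesquilinear q" and P: "vec.subspace P" "pos_def_on q P"
  obtains c where "c > 0" "\<And>x. x \<in> P \<Longrightarrow> c * (norm x)\<^sup>2 \<le> Re (q x x)"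
proof (cases "P \<inter> sphere 0 1 = {}")
  case True
  have zero: "x = 0" if x: "x \<in> P" for x
  proof (rule ccontr)
    assume "x \<noteq> 0"
    then obtain u where "u \<in> P" "norm u = 1" by (rule normalize_in_subspace[OF P(1) x])
    then show False using True by auto
  qed
  have "1 * (norm x)\<^sup>2 \<le> Re (q x x)" if "x \<in> P" for x
    unfolding zero[OF that] by (simp add: sesq_simps[OF q])
  then show thesis by (intro that[of 1]) auto
next
  case False
  have "compact (P \<inter> sphere 0 1)"
    by (rule closed_Int_compact[OF closed_complex_subspace[OF P(1)] compact_sphere])
  moreover have "continuous_on (P \<inter> sphere 0 1) (\<lambda>x. Re (q x x))"
    by (intro continuous_intros continuous_on_sesq[OF q])
  ultimately have "\<exists>u\<in>P \<inter> sphere 0 1. \<forall>x\<in>P \<inter> sphere 0 1. Re (q u u) \<le> Re (q x x)"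
    by (rule continuous_attains_inf[OF _ False])
  then obtain u where u: "u \<in> P \<inter> sphere 0 1" "\<And>x. x \<in> P \<inter> sphere 0 1 \<Longrightarrow> Re (q u u) \<le> Re (q x x)"
    by blast
  have "u \<noteq> 0" using u(1) by auto
  then have "0 < Re (q u u)" using u(1) P(2) unfolding pos_def_on_def by blast
  moreover have "Re (q u u) * (norm x)\<^sup>2 \<le> Re (q x x)" if x: "x \<in> P" for x
  proof (cases "x = 0")
    case False
    obtain v where v: "v \<in> P" "norm v = 1" and xv: "x = norm x *\<^sub>R v"
      by (rule normalize_in_subspace[OF P(1) x False])
    then have "Re (q u u) \<le> Re (q v v)" using u(2) by simp
    then have "Re (q u u) * (norm x)\<^sup>2 \<le> (norm x)\<^sup>2 * Re (q v v)"
      using mult_right_mono[of "Re (q u u)" "Re (q v v)" "(norm x)\<^sup>2"] by (simp add: mult.commute)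
    also have "\<dots> = Re (q (norm x *\<^sub>R v) (norm x *\<^sub>R v))"
      unfolding sesq_scaleR[OF q] by simp
    finally show ?thesis unfolding xv[symmetric] .
  qed (simp add: sesq_simps[OF q])
  ultimately show thesis using that by blast
qed

lemma sesq_bound:
  fixes x :: "complex^'m"
  assumes q: "sesquilinear q"
  shows "cmod (q x x) \<le> (\<Sum>i\<in>UNIV. \<Sum>j\<in>UNIV. cmod (q (axis i 1) (axis j 1))) * (norm x)\<^sup>2"
proof -
  have "cmod (q x x) \<le> (\<Sum>i\<in>UNIV. \<Sum>j\<in>UNIV. cmod (x $ i * cnj (x $ j) * q (axis i 1) (axis j 1)))"
    by (subst sesq_expand[OF q]) (intro order_trans[OF norm_sum] sum_mono norm_sum)
  also have "\<dots> \<le> (\<Sum>i\<in>UNIV. \<Sum>j\<in>UNIV. cmod (q (axis i 1) (axis j 1)) * (norm x)\<^sup>2)"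
  proof (intro sum_mono)
    fix i j
    have "cmod (x $ i) * cmod (x $ j) \<le> norm x * norm x"
      by (intro mult_mono Finite_Cartesian_Product.norm_nth_le) auto
    then have "cmod (q (axis i 1) (axis j 1)) * (cmod (x $ i) * cmod (x $ j)) \<le> cmod (q (axis i 1) (axis j 1)) * (norm x)\<^sup>2"
      unfolding power2_eq_square by (intro mult_left_mono) auto
    then show "cmod (x $ i * cnj (x $ j) * q (axis i 1) (axis j 1)) \<le> cmod (q (axis i 1) (axis j 1)) * (norm x)\<^sup>2"
      by (simp add: norm_mult mult.commute)
  qed
  finally show ?thesis by (simp add: sum_distrib_right)
qed

text \<open>
  On a maximal positive definite subspace at time \<open>a\<close> the form is bounded below by a multiple of the
  squared norm, so that it stays positive there under small perturbations.
\<close>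

lemma morse_pos_lower_semicontinuous:
  fixes q :: "real \<Rightarrow> complex^'m \<Rightarrow> complex^'m \<Rightarrow> complex"
  assumes q: "\<And>t. t \<in> I \<Longrightarrow> sesquilinear (q t)" and h: "\<And>t. t \<in> I \<Longrightarrow> hermitian_on (q t) S"
    and S: "vec.subspace S" and cont: "\<And>x y. continuous_on I (\<lambda>t. q t x y)" and a: "a \<in> I"
  shows "\<forall>\<^sub>F t in at a within I. morse_pos (q a) S \<le> morse_pos (q t) S"
proof -
  obtain P where P: "vec.subspace P" "P \<subseteq> S" "pos_def_on (q a) P" "vec.dim P = morse_pos (q a) S"
    using morse_pos_attained[OF S] by blast
  obtain c where c: "c > 0" "\<And>x. x \<in> P \<Longrightarrow> c * (norm x)\<^sup>2 \<le> Re (q a x x)"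
    using pos_def_lower_bound[OF q[OF a] P(1,3)] by blast
  define d where "d t = (\<Sum>i\<in>UNIV. \<Sum>j\<in>UNIV. cmod (q t (axis i 1) (axis j 1) - q a (axis i 1) (axis j 1)))" for t
  have "continuous_on I d"
    unfolding d_def by (intro continuous_intros cont)
  then have "(d \<longlongrightarrow> d a) (at a within I)"
    using a unfolding continuous_on_def by blast
  moreover have "d a < c" using c(1) by (simp add: d_def)
  ultimately have "\<forall>\<^sub>F t in at a within I. d t < c" by (rule order_tendstoD)
  moreover have "\<forall>\<^sub>F t in at a within I. t \<in> I" by (simp add: eventually_at_filter)
  ultimately show ?thesis
  proof eventually_elim
    case (elim t)
    have diff: "sesquilinear (\<lambda>x y. q t x y - q a x y)"
      using q[OF elim(2)] q[OF a] by (simp add: sesquilinear_def algebra_simps)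
    have "pos_def_on (q t) P"
    proof (rule hermitian_pos_def[OF h[OF elim(2)] P(2)])
      fix x assume x: "x \<in> P" "x \<noteq> 0"
      have "Re (q a x x) - Re (q t x x) \<le> cmod (q t x x - q a x x)"
        using abs_Re_le_cmod[of "q t x x - q a x x"] by simp
      also have "\<dots> \<le> d t * (norm x)\<^sup>2"
        using sesq_bound[OF diff, of x] unfolding d_def .
      also have "\<dots> < c * (norm x)\<^sup>2" using x(2) elim(1) by simp
      finally show "0 < Re (q t x x)" using c(2)[OF x(1)] by linarith
    qed
    then show ?case using morse_pos_ge[OF P(1,2)] P(4) by simp
  qed
qed

text \<open>
  Both indices can only jump upwards near any given time, while their sum is constant because the
  dimension of the kernel is.
\<close>

lemma morse_pos_constant:
  fixes q :: "real \<Rightarrow> complex^'m \<Rightarrow> complex^'m \<Rightarrow> complex"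
  assumes q: "\<And>t. t \<in> I \<Longrightarrow> sesquilinear (q t)" and h: "\<And>t. t \<in> I \<Longrightarrow> hermitian_on (q t) S"
    and S: "vec.subspace S" and cont: "\<And>x y. continuous_on I (\<lambda>t. q t x y)"
    and ker: "\<And>t. t \<in> I \<Longrightarrow> vec.dim (form_ker (q t) S) = k"
    and I: "connected I" "a \<in> I" "b \<in> I"
  shows "morse_pos (q a) S = morse_pos (q b) S"
proof (rule connected_local_const[OF I], intro ballI)
  fix t assume t: "t \<in> I"
  have "\<forall>\<^sub>F s in at t within I. morse_pos (q t) S \<le> morse_pos (q s) S"
    by (rule morse_pos_lower_semicontinuous[OF q h S cont t])
  moreover have "\<forall>\<^sub>F s in at t within I. morse_pos (\<lambda>x y. - q t x y) S \<le> morse_pos (\<lambda>x y. - q s x y) S"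
    by (rule morse_pos_lower_semicontinuous[OF sesquilinear_minus[OF q] hermitian_on_minus[OF h] S _ t])
      (auto intro!: continuous_intros cont)
  moreover have "\<forall>\<^sub>F s in at t within I. s \<in> I" by (simp add: eventually_at_filter)
  ultimately show "\<forall>\<^sub>F s in at t within I. morse_pos (q t) S = morse_pos (q s) S"
  proof eventually_elim
    case (elim s)
    then show ?case
      using sylvester_inertia[OF q h S, of t] sylvester_inertia[OF q h S, of s] ker[of t] ker[of s] t
      by linarith
  qed
qed

subsection \<open>Continuity of projections along a moving subspace\<close>

lemma continuous_on_cart:
  fixes f :: "'b::topological_space \<Rightarrow> complex^'m"
  assumes "\<And>i. continuous_on I (\<lambda>t. f t $ i)" shows "continuous_on I f"
proof -
  have "continuous_on I (\<lambda>t. \<chi> i. f t $ i)" by (intro continuous_on_vec_lambda assms)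
  then show ?thesis by simp
qed

lemma lin_matrix: "lin f \<Longrightarrow> matrix f *v x = f x"
  by (simp add: matrix_works)

text \<open>
  By Cramer's rule the solution is a quotient of polynomials in the entries.
\<close>

lemma continuous_on_linear_solution:
  fixes E :: "real \<Rightarrow> complex^'m \<Rightarrow> complex^'m"
  assumes E: "\<And>t. t \<in> I \<Longrightarrow> lin (E t)" and inj: "\<And>t x. t \<in> I \<Longrightarrow> E t x = 0 \<Longrightarrow> x = 0"
    and cont: "\<And>x. continuous_on I (\<lambda>t. E t x)" and x: "\<And>t. t \<in> I \<Longrightarrow> E t (x t) = b"
  shows "continuous_on I x"
proof -
  define A where "A t = matrix (E t)" for t
  have Aij: "A t $ i $ j = E t (axis j 1) $ i" for t i j
    by (simp add: A_def matrix_def)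
  have contA: "continuous_on I (\<lambda>t. A t $ i $ j)" for i j
    unfolding Aij by (intro continuous_intros cont)
  have nz: "det (A t) \<noteq> 0" if t: "t \<in> I" for t
  proof -
    have "x = 0" if "A t *v x = 0" for x
      using inj[OF t, of x] that lin_matrix[OF E[OF t]] by (simp add: A_def)
    then have "\<exists>B. B ** A t = mat 1" using matrix_left_invertible_ker by blast
    then show ?thesis by (simp add: invertible_left_inverse flip: invertible_det_nz)
  qed
  have "x t = (\<chi> k. det (\<chi> i j. if j = k then b $ i else A t $ i $ j) / det (A t))" if t: "t \<in> I" for t
    using cramer[OF nz[OF t], of "x t" b] lin_matrix[OF E[OF t]] x[OF t] by (simp add: A_def)
  moreover have "continuous_on I (\<lambda>t. \<chi> k. det (\<chi> i j. if j = k then b $ i else A t $ i $ j) / det (A t))"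
  proof (intro continuous_on_vec_lambda continuous_on_divide)
    show "continuous_on I (\<lambda>t. det (A t))"
      unfolding det_def by (intro continuous_intros contA)
    show "continuous_on I (\<lambda>t. det (\<chi> i j. if j = k then b $ i else A t $ i $ j))" for k
    proof -
      have "continuous_on I (\<lambda>t. if j = k then b $ i else A t $ i $ j)" for i j
        using contA by (cases "j = k") auto
      then show ?thesis unfolding det_def vec_lambda_beta by (intro continuous_intros)
    qed
  qed (use nz in blast)
  ultimately show ?thesis by (simp cong: continuous_on_cong)
qed

lemma continuous_on_lin: "lin f \<Longrightarrow> continuous_on I g \<Longrightarrow> continuous_on I (\<lambda>t. f (g t))"
  for f :: "complex^'m \<Rightarrow> complex^'k"
proof -
  assume f: "lin f" and g: "continuous_on I g"
  have "f (g t) $ i = (\<Sum>j\<in>UNIV. matrix f $ i $ j * g t $ j)" for t i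
    using lin_matrix[OF f, of "g t"] by (simp add: matrix_vector_mult_def flip: lin_matrix[OF f])
  then show ?thesis
    by (intro continuous_on_cart) (simp, intro continuous_intros g)
qed

lemma continuous_on_lin_family:
  fixes E :: "real \<Rightarrow> complex^'k \<Rightarrow> complex^'m"
  assumes E: "\<And>t. t \<in> I \<Longrightarrow> lin (E t)" and cont: "\<And>x. continuous_on I (\<lambda>t. E t x)"
    and g: "continuous_on I g"
  shows "continuous_on I (\<lambda>t. E t (g t))"
proof -
  have "E t (g t) = (\<Sum>j\<in>UNIV. g t $ j *s E t (axis j 1))" if "t \<in> I" for t
  proof -
    have "E t (g t) = E t (\<Sum>j\<in>UNIV. g t $ j *s axis j 1)" by (simp add: basis_expansion)
    also have "\<dots> = (\<Sum>j\<in>UNIV. g t $ j *s E t (axis j 1))"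
      by (simp add: vec.linear_sum[OF E[OF that]] vec.linear_scale[OF E[OF that]])
    finally show ?thesis .
  qed
  moreover have "continuous_on I (\<lambda>t. \<Sum>j\<in>UNIV. g t $ j *s E t (axis j 1))"
  proof (rule continuous_on_cart)
    fix i
    show "continuous_on I (\<lambda>t. (\<Sum>j\<in>UNIV. g t $ j *s E t (axis j 1)) $ i)"
      unfolding sum_component vector_smult_component by (intro continuous_intros g cont)
  qed
  ultimately show ?thesis by (simp cong: continuous_on_cong)
qed

text \<open>
  Fix a time \<open>a\<close>. The linear map \<open>E t\<close> that is the identity on \<open>\<rho>\<close> and carries \<open>\<iota> a z\<close> to \<open>\<iota> t z\<close> is
  invertible and maps the splitting at time \<open>a\<close> to the splitting at time \<open>t\<close>. The projection of \<open>v\<close> is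
  therefore read off from the solution \<open>w t\<close> of \<open>E t (w t) = v\<close>.
\<close>

lemma continuous_on_proj:
  fixes \<iota> :: "real \<Rightarrow> complex^'k \<Rightarrow> complex^'m"
  assumes lin: "\<And>t. t \<in> I \<Longrightarrow> lin (\<iota> t)" and inj: "\<And>t z. t \<in> I \<Longrightarrow> \<iota> t z = 0 \<Longrightarrow> z = 0"
    and cont: "\<And>z. continuous_on I (\<lambda>t. \<iota> t z)"
    and compl: "\<And>t. t \<in> I \<Longrightarrow> complementary (range (\<iota> t)) \<rho>"
  shows "continuous_on I (\<lambda>t. proj (range (\<iota> t)) \<rho> v)"
proof (cases "I = {}")
  case False
  then obtain a where a: "a \<in> I" by blast
  have "inj (\<iota> a)"
  proof (rule injI)
    fix x y assume "\<iota> a x = \<iota> a y"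
    then have "\<iota> a (x - y) = 0" by (simp add: lin_diff[OF lin[OF a]])
    then show "x = y" using inj[OF a] by fastforce
  qed
  then obtain g where g: "lin g" "g \<circ> \<iota> a = id"
    using vec.linear_injective_left_inverse lin[OF a] by blast
  define L where "L t = range (\<iota> t)" for t
  define E where "E t w = \<iota> t (g (proj (L a) \<rho> w)) + proj \<rho> (L a) w" for t w
  note ca = compl[OF a, folded L_def]
  have linE: "lin (E t)" if "t \<in> I" for t
    unfolding E_def
    by (rule lin_plus[OF lin_compose[OF lin_compose[OF proj_lin[OF ca] g(1)] lin[OF that]]
        proj_lin[OF complementary_sym[OF ca]]])
  have contE: "continuous_on I (\<lambda>t. E t w)" for w
    unfolding E_def by (intro continuous_intros cont)
  have injE: "w = 0" if t: "t \<in> I" and w: "E t w = 0" for t w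
  proof -
    note ct = compl[OF t, folded L_def]
    let ?z = "g (proj (L a) \<rho> w)"
    have in\<rho>: "proj \<rho> (L a) w \<in> \<rho>" by (rule proj_in[OF complementary_sym[OF ca]])
    have e: "\<iota> t ?z = - proj \<rho> (L a) w" using w unfolding E_def by (simp add: add_eq_0_iff2)
    then have "\<iota> t ?z \<in> \<rho>" using in\<rho> complementary_subspaces(2)[OF ca] vec.subspace_neg by fastforce
    moreover have "\<iota> t ?z \<in> L t" by (simp add: L_def)
    ultimately have 0: "\<iota> t ?z = 0" using ct unfolding complementary_def by blast
    then have "?z = 0" using inj t by blast
    moreover obtain u where u: "proj (L a) \<rho> w = \<iota> a u"
      using proj_in[OF ca, of w] by (auto simp: L_def)
    then have "?z = u" using g(2) by (metis comp_apply id_apply)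
    ultimately have "proj (L a) \<rho> w = 0" using u lin_0[OF lin[OF a]] by simp
    moreover have "proj \<rho> (L a) w = 0" using e 0 by simp
    ultimately show ?thesis using proj_decomp[OF ca, of w] by simp
  qed
  define w where "w t = (SOME w. E t w = v)" for t
  have Ew: "E t (w t) = v" if t: "t \<in> I" for t
  proof -
    have "inj (E t)"
    proof (rule injI)
      fix x y assume "E t x = E t y"
      then have "E t (x - y) = 0" by (simp add: lin_diff[OF linE[OF t]])
      then show "x = y" using injE[OF t] by fastforce
    qed
    then have "surj (E t)" using vec.linear_inj_imp_surj[OF linE[OF t]] by blast
    then have "\<exists>w. E t w = v" by (metis surjD)
    then show ?thesis unfolding w_def by (rule someI_ex)
  qed
  have "continuous_on I w"
    by (rule continuous_on_linear_solution[OF linE injE contE Ew])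
  then have "continuous_on I (\<lambda>t. \<iota> t (g (proj (L a) \<rho> (w t))))"
    by (intro continuous_on_lin_family[OF lin cont] continuous_on_lin[OF g(1)] continuous_on_lin[OF proj_lin[OF ca]])
  moreover have "proj (range (\<iota> t)) \<rho> v = \<iota> t (g (proj (L a) \<rho> (w t)))" if t: "t \<in> I" for t
  proof (rule proj_unique[OF compl[OF t]])
    have "v - \<iota> t (g (proj (L a) \<rho> (w t))) = proj \<rho> (L a) (w t)"
      unfolding Ew[OF t, symmetric] E_def by simp
    then show "v - \<iota> t (g (proj (L a) \<rho> (w t))) \<in> \<rho>"
      using proj_in[OF complementary_sym[OF ca]] by simp
  qed simp
  ultimately show ?thesis by (simp cong: continuous_on_cong)
qed simp

section \<open>Lagrangian subspaces\<close>

lemma symplectic_sesquilinear: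
  assumes "symplectic_form \<omega>" shows "sesquilinear \<omega>"
proof -
  have l: "\<omega> (c *s x + y) z = c * \<omega> x z + \<omega> y z" for c x y z
    using assms unfolding symplectic_form_def by blast
  have s: "\<omega> z x = - cnj (\<omega> x z)" for x z
    using assms unfolding symplectic_form_def by blast
  have "\<omega> z (c *s x + y) = cnj c * \<omega> z x + \<omega> z y" for c x y z
    by (subst (1 2 3) s) (simp add: l)
  with l show ?thesis unfolding sesquilinear_def by blast
qed

lemma symplectic_skew: "symplectic_form \<omega> \<Longrightarrow> \<omega> y x = - cnj (\<omega> x y)"
  unfolding symplectic_form_def by blast

lemma symplectic_nondegenerate: "symplectic_form \<omega> \<Longrightarrow> (\<And>y. \<omega> x y = 0) \<Longrightarrow> x = 0"
  unfolding symplectic_form_def by blast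

lemma lagrangian_isotropic: "lagrangian \<omega> L \<Longrightarrow> x \<in> L \<Longrightarrow> y \<in> L \<Longrightarrow> \<omega> x y = 0"
  and lagrangian_maximal: "lagrangian \<omega> L \<Longrightarrow> (\<And>y. y \<in> L \<Longrightarrow> \<omega> x y = 0) \<Longrightarrow> x \<in> L"
  unfolding lagrangian_def by blast+

lemma lagrangian_perp: "lagrangian \<omega> L \<Longrightarrow> form_perp \<omega> UNIV L = L"
  unfolding form_perp_def lagrangian_def by simp

lemma lagrangian_subspace:
  assumes "symplectic_form \<omega>" "lagrangian \<omega> L" shows "vec.subspace L"
  using subspace_form_perp[OF symplectic_sesquilinear[OF assms(1)] vec.subspace_UNIV, of L]
  unfolding lagrangian_perp[OF assms(2)] .

text \<open>
  Annihilators are at least as large as expected. For a complement \<open>C\<close> of \<open>U\<close>, the annihilators of \<open>U\<close> and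
  \<open>C\<close> meet only in zero by nondegeneracy, which leaves no room for either to be larger.
\<close>

lemma dim_perp_nondegenerate:
  fixes U :: "(complex^'m) set"
  assumes q: "sesquilinear q" and nondeg: "\<And>x. (\<And>y. q x y = 0) \<Longrightarrow> x = 0" and U: "vec.subspace U"
  shows "vec.dim U + vec.dim (form_perp q UNIV U) = CARD('m)"
proof -
  obtain C where C: "vec.subspace C" "U \<inter> C = {0}" "UNIV = {x + y |x y. x \<in> U \<and> y \<in> C}"
    by (rule subspace_complement[OF vec.subspace_UNIV U subset_UNIV])
  have card: "vec.dim U + vec.dim C = CARD('m)"
    using dim_direct_sum[OF U C(1)] C(2,3) vec_dim_card[where 'a=complex and 'n='m] by simp
  let ?U = "form_perp q UNIV U" and ?C = "form_perp q UNIV C"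
  have ge: "CARD('m) \<le> vec.dim U + vec.dim ?U" "CARD('m) \<le> vec.dim C + vec.dim ?C"
    using dim_form_perp_ge[OF q vec.subspace_UNIV] U C(1) by (simp_all only: vec_dim_card)
  have "?U \<inter> ?C \<subseteq> {0}"
  proof
    fix x assume x: "x \<in> ?U \<inter> ?C"
    have "q x v = 0" for v
    proof -
      obtain u c where "v = u + c" "u \<in> U" "c \<in> C" using C(3) by blast
      then show ?thesis using x unfolding form_perp_def by (auto simp: sesq_simps[OF q])
    qed
    then show "x \<in> {0}" using nondeg[of x] by blast
  qed
  then have "vec.dim ?U + vec.dim ?C \<le> vec.dim (UNIV :: (complex^'m) set)"
    using subspace_form_perp[OF q vec.subspace_UNIV] by (intro dim_disjoint_le) auto
  then have "vec.dim ?U + vec.dim ?C \<le> CARD('m)" by (simp only: vec_dim_card)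
  then show ?thesis using ge card by linarith
qed

lemma lagrangian_dim:
  fixes L :: "(complex^'m) set"
  assumes "symplectic_form \<omega>" "lagrangian \<omega> L"
  shows "2 * vec.dim L = CARD('m)"
  using dim_perp_nondegenerate[OF symplectic_sesquilinear[OF assms(1)] symplectic_nondegenerate[OF assms(1)]
      lagrangian_subspace[OF assms]] lagrangian_perp[OF assms(2)] by simp

lemma lagrangian_complementary:
  assumes "symplectic_form \<omega>" "lagrangian \<omega> L" "lagrangian \<omega> L'" "L \<inter> L' \<subseteq> {0}"
  shows "complementary L L'"
  using complementary_dim[OF lagrangian_subspace[OF assms(1,2)] lagrangian_subspace[OF assms(1,3)] assms(4)]
    lagrangian_dim[OF assms(1,2)] lagrangian_dim[OF assms(1,3)] by linarith

text \<open>
  A Lagrangian subspace \<open>L\<close> that is transversal to \<open>B\<close> is the graph of a linear map from \<open>A\<close> to \<open>B\<close>.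
  The restriction of \<open>pform \<omega> A B\<close> to \<open>L\<close> is the Hermitian form on \<open>A\<close> which that map corresponds to
  under \<open>\<omega>\<close>. The definition by projections makes sense on \<open>L\<close> without transversality.
\<close>

definition pform ::
    "(complex^'m \<Rightarrow> complex^'m \<Rightarrow> complex) \<Rightarrow> (complex^'m) set \<Rightarrow> (complex^'m) set \<Rightarrow>
     complex^'m \<Rightarrow> complex^'m \<Rightarrow> complex" where
  "pform \<omega> A B x y = \<omega> (proj A B x) (proj B A y)"

lemma sesquilinear_pform:
  assumes "symplectic_form \<omega>" "complementary A B" shows "sesquilinear (pform \<omega> A B)"
  unfolding pform_def
  by (rule sesquilinear_compose[OF symplectic_sesquilinear[OF assms(1)] proj_lin[OF assms(2)]
        proj_lin[OF complementary_sym[OF assms(2)]]])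

lemma pform_hermitian:
  assumes w: "symplectic_form \<omega>" and c: "complementary A B"
    and A: "lagrangian \<omega> A" and B: "lagrangian \<omega> B" and L: "lagrangian \<omega> L"
  shows "hermitian_on (pform \<omega> A B) L"
  unfolding hermitian_on_def pform_def
proof (intro ballI)
  note s = symplectic_sesquilinear[OF w] and c' = complementary_sym[OF c]
  fix x y assume xy: "x \<in> L" "y \<in> L"
  let ?xa = "proj A B x" and ?xb = "proj B A x" and ?ya = "proj A B y" and ?yb = "proj B A y"
  have "0 = \<omega> (?xa + ?xb) (?ya + ?yb)"
    using lagrangian_isotropic[OF L xy] by (simp add: proj_decomp[OF c])
  also have "\<dots> = \<omega> ?xa ?yb + \<omega> ?xb ?ya"
    using lagrangian_isotropic[OF A proj_in[OF c] proj_in[OF c]]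
      lagrangian_isotropic[OF B proj_in[OF c'] proj_in[OF c']] by (simp add: sesq_simps[OF s])
  finally have "\<omega> ?xa ?yb = - \<omega> ?xb ?ya" by (simp add: add_eq_0_iff2)
  then show "\<omega> ?ya ?xb = cnj (\<omega> ?xa ?yb)"
    using symplectic_skew[OF w, of ?ya ?xb] by simp
qed

text \<open>
  As \<open>A\<close> is isotropic, \<open>pform \<omega> A B x y = \<omega> x\<^sub>A y\<close>, so \<open>x\<close> is in the kernel exactly if \<open>x\<^sub>A\<close> annihilates \<open>L\<close>.
\<close>

lemma form_ker_pform:
  assumes w: "symplectic_form \<omega>" and c: "complementary A B"
    and A: "lagrangian \<omega> A" and L: "lagrangian \<omega> L"
  shows "form_ker (pform \<omega> A B) L = {x \<in> L. proj A B x \<in> L}"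
proof -
  note s = symplectic_sesquilinear[OF w]
  have *: "pform \<omega> A B x y = \<omega> (proj A B x) y" for x y
    unfolding pform_def proj_swap[OF c]
    using lagrangian_isotropic[OF A proj_in[OF c] proj_in[OF c]] by (simp add: sesq_simps[OF s])
  show ?thesis
    unfolding form_ker_def *
    using lagrangian_isotropic[OF L] lagrangian_maximal[OF L] by blast
qed

lemma form_ker_pform_transversal:
  assumes w: "symplectic_form \<omega>" and c: "complementary A B"
    and A: "lagrangian \<omega> A" and L: "lagrangian \<omega> L" and LB: "L \<inter> B \<subseteq> {0}"
  shows "form_ker (pform \<omega> A B) L = L \<inter> A"
  unfolding form_ker_pform[OF w c A L]
proof (intro set_eqI iffI)
  fix x assume x: "x \<in> {x \<in> L. proj A B x \<in> L}"
  then have "x - proj A B x \<in> L"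
    using vec.subspace_diff[OF lagrangian_subspace[OF w L]] by blast
  then have "x - proj A B x = 0"
    using proj_diff_in[OF c, of x] LB by blast
  then show "x \<in> L \<inter> A" using x proj_in[OF c, of x] by simp
next
  fix x assume "x \<in> L \<inter> A"
  then show "x \<in> {x \<in> L. proj A B x \<in> L}" using proj_id[OF c, of x] by simp
qed

subsection \<open>Exchanging the auxiliary Lagrangian\<close>

text \<open>
  Both sides complete the square of the same form in \<open>(x, z) \<in> \<Lambda> \<times> \<rho>'\<close>, namely of
  \<open>\<omega> x\<^sub>\<mu> x\<^sub>\<rho> + 2 Re (\<omega> z\<^sub>\<mu> x\<^sub>\<rho>) + \<omega> z\<^sub>\<mu> z\<^sub>\<rho>\<close> with components along \<open>\<mu>\<close> and \<open>\<rho>\<close>. On the left the square is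
  completed in \<open>x\<close>, by the element \<open>y\<close> of \<open>\<Lambda>\<close> with the same \<open>\<mu>\<close>-component as \<open>z\<close>. On the right it is
  completed in \<open>z\<close>, by the element \<open>u\<close> of \<open>\<rho>'\<close> with the same \<open>\<rho>\<close>-component as \<open>x\<close>.
\<close>

lemma four_lagrangians_identity:
  assumes w: "symplectic_form \<omega>"
    and l: "lagrangian \<omega> \<Lambda>" and m: "lagrangian \<omega> \<mu>" and r: "lagrangian \<omega> \<rho>" and r': "lagrangian \<omega> \<rho>'"
    and lr: "complementary \<Lambda> \<rho>" and mr: "complementary \<mu> \<rho>" and mr': "complementary \<mu> \<rho>'"
    and x: "x \<in> \<Lambda>" and z: "z \<in> \<rho>'"
  defines "y \<equiv> proj \<Lambda> \<rho> z" and "u \<equiv> proj \<rho>' \<mu> x"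
  shows "pform \<omega> \<mu> \<rho> (x + y) (x + y) + pform \<omega> \<Lambda> \<rho> z z =
    pform \<omega> \<mu> \<rho>' x x + pform \<omega> \<mu> \<rho> (z + u) (z + u)"
proof -
  note s = symplectic_sesquilinear[OF w]
  define a b c d where "a = proj \<mu> \<rho> x" and "b = proj \<rho> \<mu> x" and "c = proj \<mu> \<rho> z" and "d = proj \<rho> \<mu> z"
  define e a' where "e = y - c" and "a' = u - b"
  have mem: "a \<in> \<mu>" "b \<in> \<rho>" "c \<in> \<mu>" "d \<in> \<rho>"
    unfolding a_def b_def c_def d_def using proj_in[OF mr] proj_in[OF complementary_sym[OF mr]] by auto
  have dec: "x = a + b" "z = c + d" "y = c + e" "u = a' + b"
    unfolding a_def b_def c_def d_def e_def a'_def using proj_decomp[OF mr] by auto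
  have "z - y \<in> \<rho>" unfolding y_def by (rule proj_diff_in[OF lr])
  then have e: "e \<in> \<rho>"
    using vec.subspace_diff[OF lagrangian_subspace[OF w r] mem(4) \<open>z - y \<in> \<rho>\<close>] dec by (simp add: algebra_simps)
  have "x - u \<in> \<mu>" unfolding u_def by (rule proj_diff_in[OF complementary_sym[OF mr']])
  then have a': "a' \<in> \<mu>"
    using vec.subspace_diff[OF lagrangian_subspace[OF w m] mem(1) \<open>x - u \<in> \<mu>\<close>] dec by (simp add: algebra_simps)
  have yL: "y \<in> \<Lambda>" unfolding y_def by (rule proj_in[OF lr])
  have u\<rho>': "u \<in> \<rho>'" unfolding u_def by (rule proj_in[OF complementary_sym[OF mr']])
  note subs = vec.subspace_add[OF lagrangian_subspace[OF w m]] vec.subspace_add[OF lagrangian_subspace[OF w r]]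
    vec.subspace_diff[OF lagrangian_subspace[OF w m]] vec.subspace_diff[OF lagrangian_subspace[OF w r]]
  have P: "proj \<mu> \<rho> (v + v') = v \<and> proj \<rho> \<mu> (v + v') = v'" if "v \<in> \<mu>" "v' \<in> \<rho>" for v v'
  proof -
    have "proj \<mu> \<rho> (v + v') = v" by (rule proj_unique[OF mr]) (use that in auto)
    then show ?thesis by (simp add: proj_swap[OF mr])
  qed
  have q1: "pform \<omega> \<mu> \<rho> (x + y) (x + y) = \<omega> (a + c) (b + e)"
    using P[of "a + c" "b + e"] subs mem e unfolding pform_def dec by (simp add: add_ac)
  have q2: "pform \<omega> \<Lambda> \<rho> z z = \<omega> (c + e) (d - e)"
    using dec unfolding pform_def proj_swap[OF lr] y_def[symmetric] by (simp add: algebra_simps)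
  have "proj \<mu> \<rho>' x = a - a'"
    using proj_swap[OF complementary_sym[OF mr'], of x] dec unfolding u_def[symmetric] by simp
  then have q3: "pform \<omega> \<mu> \<rho>' x x = \<omega> (a - a') (a' + b)"
    unfolding pform_def u_def[symmetric] using dec by simp
  have q4: "pform \<omega> \<mu> \<rho> (z + u) (z + u) = \<omega> (c + a') (d + b)"
    using P[of "c + a'" "d + b"] subs mem a' unfolding pform_def dec by (simp add: add_ac)
  note iso = lagrangian_isotropic[OF m] lagrangian_isotropic[OF r]
  have z1: "\<omega> e d = 0" "\<omega> e e = 0" "\<omega> a a' = 0" "\<omega> a' a' = 0" "\<omega> c a' = 0"
    using iso mem e a' by auto
  have "\<omega> (a + b) (c + e) = 0"
    using lagrangian_isotropic[OF l x yL] by (simp only: dec)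
  then have k1: "\<omega> a e = - \<omega> b c"
    using iso(1)[OF mem(1,3)] iso(2)[OF mem(2) e] by (simp add: sesq_simps[OF s] add_eq_0_iff2)
  have "\<omega> (a' + b) (c + d) = 0"
    using lagrangian_isotropic[OF r' u\<rho>' z] by (simp only: dec)
  then have k2: "\<omega> a' d = - \<omega> b c"
    using iso(1)[OF a' mem(3)] iso(2)[OF mem(2,4)] by (simp add: sesq_simps[OF s] add_eq_0_iff2)
  show ?thesis
    unfolding q1 q2 q3 q4 by (simp add: sesq_simps[OF s] z1 k1 k2)
qed

text \<open>
  Since \<open>\<Lambda>\<close> and \<open>\<rho>'\<close> are complementary, a form on \<open>\<Lambda> \<times> \<rho>'\<close> is a form on the whole space. The identity
  above says that two orthogonal sums become equal after the invertible substitutions \<open>G1\<close> and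
  \<open>G2\<close>, so their Morse indices agree.
\<close>

lemma morse_exchange:
  assumes w: "symplectic_form \<omega>"
    and l: "lagrangian \<omega> \<Lambda>" and m: "lagrangian \<omega> \<mu>" and r: "lagrangian \<omega> \<rho>" and r': "lagrangian \<omega> \<rho>'"
    and lr: "complementary \<Lambda> \<rho>" and lr': "complementary \<Lambda> \<rho>'"
    and mr: "complementary \<mu> \<rho>" and mr': "complementary \<mu> \<rho>'"
  shows "morse_pos (pform \<omega> \<mu> \<rho>) \<Lambda> + morse_pos (pform \<omega> \<Lambda> \<rho>) \<rho>' =
    morse_pos (pform \<omega> \<mu> \<rho>') \<Lambda> + morse_pos (pform \<omega> \<mu> \<rho>) \<rho>'"
proof -
  note s = symplectic_sesquilinear[OF w]
  define pL pR where "pL = proj \<Lambda> \<rho>'" and "pR = proj \<rho>' \<Lambda>"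
  have lin: "lin pL" "lin pR"
    unfolding pL_def pR_def using proj_lin lr' complementary_sym by blast+
  have pin: "pL v \<in> \<Lambda>" "pR v \<in> \<rho>'" "pL v + pR v = v" for v
    unfolding pL_def pR_def
    using proj_in[OF lr'] proj_in[OF complementary_sym[OF lr']] proj_decomp[OF lr'] by auto
  have pid: "pL x = x \<and> pR x = 0" if "x \<in> \<Lambda>" for x
    unfolding pL_def pR_def using proj_id[OF lr' that] proj_zero[OF complementary_sym[OF lr'] that] by simp
  have pid': "pR x = x \<and> pL x = 0" if "x \<in> \<rho>'" for x
    unfolding pL_def pR_def using proj_id[OF complementary_sym[OF lr'] that] proj_zero[OF lr' that] by simp
  have sum: "{a + b |a b. a \<in> \<Lambda> \<and> b \<in> \<rho>'} = UNIV"
  proof (intro set_eqI iffI UNIV_I CollectI)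
    fix v
    show "\<exists>a b. v = a + b \<and> a \<in> \<Lambda> \<and> b \<in> \<rho>'"
      using pin[of v] by (intro exI[of _ "pL v"] exI[of _ "pR v"]) auto
  qed
  have split: "morse_pos (\<lambda>v v'. q (pL v) (pL v') + q' (pR v) (pR v')) UNIV = morse_pos q \<Lambda> + morse_pos q' \<rho>'"
    if q: "sesquilinear q" "hermitian_on q \<Lambda>" and q': "sesquilinear q'" "hermitian_on q' \<rho>'" for q q'
  proof -
    let ?f = "\<lambda>v v'. q (pL v) (pL v') + q' (pR v) (pR v')"
    have "sesquilinear ?f"
      using sesquilinear_compose[OF q(1) lin(1) lin(1)] sesquilinear_compose[OF q'(1) lin(2) lin(2)]
      by (simp add: sesquilinear_def distrib_left)
    moreover have "hermitian_on ?f UNIV"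
      unfolding hermitian_on_def
    proof (intro ballI)
      fix v v'
      show "?f v' v = cnj (?f v v')"
        unfolding complex_cnj_add hermitianD[OF q(2) pin(1)[of v] pin(1)[of v'], symmetric]
          hermitianD[OF q'(2) pin(2)[of v] pin(2)[of v'], symmetric] ..
    qed
    moreover have "\<Lambda> \<inter> \<rho>' \<subseteq> {0}" using lr' unfolding complementary_def by blast
    moreover have "?f a b = 0" if "a \<in> \<Lambda>" "b \<in> \<rho>'" for a b
      using pid[OF that(1)] pid'[OF that(2)] by (simp add: sesq_simps[OF q(1)] sesq_simps[OF q'(1)])
    ultimately have "morse_pos ?f UNIV = morse_pos ?f \<Lambda> + morse_pos ?f \<rho>'"
      by (intro morse_pos_orthogonal_sum[OF _ _ sum[symmetric] lagrangian_subspace[OF w l] lagrangian_subspace[OF w r']])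
    also have "morse_pos ?f \<Lambda> = morse_pos q \<Lambda>"
      by (rule morse_pos_cong) (simp add: pid sesq_simps[OF q'(1)])
    also have "morse_pos ?f \<rho>' = morse_pos q' \<rho>'"
      by (rule morse_pos_cong) (simp add: pid' sesq_simps[OF q(1)])
    finally show ?thesis .
  qed
  define f1 where "f1 v v' = pform \<omega> \<mu> \<rho> (pL v) (pL v') + pform \<omega> \<Lambda> \<rho> (pR v) (pR v')" for v v'
  define f2 where "f2 v v' = pform \<omega> \<mu> \<rho>' (pL v) (pL v') + pform \<omega> \<mu> \<rho> (pR v) (pR v')" for v v'
  define G1 where "G1 v = v + proj \<Lambda> \<rho> (pR v)" for v
  define G2 where "G2 v = v + proj \<rho>' \<mu> (pL v)" for v
  have yL: "proj \<Lambda> \<rho> v \<in> \<Lambda>" and ur: "proj \<rho>' \<mu> v \<in> \<rho>'" for v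
    using proj_in[OF lr] proj_in[OF complementary_sym[OF mr']] by auto
  have G1: "pL (G1 v) = pL v + proj \<Lambda> \<rho> (pR v)" "pR (G1 v) = pR v" for v
    using pid[OF yL] by (simp_all add: G1_def lin_add[OF lin(1)] lin_add[OF lin(2)])
  have G2: "pL (G2 v) = pL v" "pR (G2 v) = pR v + proj \<rho>' \<mu> (pL v)" for v
    using pid'[OF ur] by (simp_all add: G2_def lin_add[OF lin(1)] lin_add[OF lin(2)])
  have linG: "lin G1" "lin G2"
    unfolding G1_def G2_def
    by (rule lin_plus[OF lin_id lin_compose[OF lin(2) proj_lin[OF lr]]],
        rule lin_plus[OF lin_id lin_compose[OF lin(1) proj_lin[OF complementary_sym[OF mr']]]])
  have injG: "v = 0" if "G1 v = 0" for v
  proof -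
    have "pR v = 0" using G1(2)[of v] that lin_0[OF lin(2)] by simp
    then show ?thesis using that lin_0[OF proj_lin[OF lr]] by (simp add: G1_def)
  qed
  have injG': "v = 0" if "G2 v = 0" for v
  proof -
    have "pL v = 0" using G2(1)[of v] that lin_0[OF lin(1)] by simp
    then show ?thesis using that lin_0[OF proj_lin[OF complementary_sym[OF mr']]] by (simp add: G2_def)
  qed
  have surjG: "range G = UNIV" if "lin G" "\<And>v. G v = 0 \<Longrightarrow> v = 0" for G :: "complex^'a \<Rightarrow> complex^'a"
  proof -
    have "inj G"
    proof (rule injI)
      fix x y assume "G x = G y"
      then have "G (x - y) = 0" by (simp add: lin_diff[OF that(1)])
      then show "x = y" using that(2)[of "x - y"] by simp
    qed
    then show ?thesis by (rule vec.linear_inj_imp_surj[OF that(1)])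
  qed
  have eq: "f1 (G1 v) (G1 v) = f2 (G2 v) (G2 v)" for v
    unfolding f1_def f2_def G1 G2
    by (rule four_lagrangians_identity[OF w l m r r' lr mr mr' pin(1,2)])
  have "morse_pos f1 UNIV = morse_pos (\<lambda>v v'. f1 (G1 v) (G1 v')) UNIV"
    using morse_pos_pullback[OF linG(1) vec.subspace_UNIV injG, of f1 "\<lambda>v v'. f1 (G1 v) (G1 v')"]
      surjG[OF linG(1) injG] by simp
  also have "\<dots> = morse_pos f2 UNIV"
    using morse_pos_pullback[OF linG(2) vec.subspace_UNIV injG', of f2 "\<lambda>v v'. f1 (G1 v) (G1 v')"]
      surjG[OF linG(2) injG'] eq by simp
  finally show ?thesis
    unfolding f1_def f2_def
    using split sesquilinear_pform[OF w] pform_hermitian[OF w] l m r r' lr mr mr' by simp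
qed

lemma continuous_on_sesq2:
  assumes "sesquilinear q" "continuous_on I f" "continuous_on I g"
  shows "continuous_on I (\<lambda>t. q (f t) (g t))"
proof -
  have "continuous_on I (\<lambda>t. \<Sum>i\<in>UNIV. \<Sum>j\<in>UNIV. f t $ i * cnj (g t $ j) * q (axis i 1) (axis j 1))"
    by (intro continuous_intros assms)
  then show ?thesis by (simp only: sesq_expand[OF assms(1), symmetric])
qed

text \<open>
  The only term of the exchange formula that depends on \<open>t\<close>, apart from the two indices on the moving
  subspace, is the index of \<open>pform \<omega> (range (\<iota> t)) \<rho>\<close> on \<open>\<rho>'\<close>. Its kernel is \<open>\<rho>' \<inter> \<rho>\<close> at all
  times.
\<close>

lemma morse_exchange_constant:
  fixes \<iota> :: "real \<Rightarrow> complex^'k \<Rightarrow> complex^'m"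
  assumes w: "symplectic_form \<omega>"
    and lin: "\<And>t. t \<in> I \<Longrightarrow> lin (\<iota> t)" and inj: "\<And>t z. t \<in> I \<Longrightarrow> \<iota> t z = 0 \<Longrightarrow> z = 0"
    and cont: "\<And>z. continuous_on I (\<lambda>t. \<iota> t z)"
    and l: "\<And>t. t \<in> I \<Longrightarrow> lagrangian \<omega> (range (\<iota> t))"
    and m: "lagrangian \<omega> \<mu>" and r: "lagrangian \<omega> \<rho>" and r': "lagrangian \<omega> \<rho>'"
    and lr: "\<And>t. t \<in> I \<Longrightarrow> complementary (range (\<iota> t)) \<rho>"
    and lr': "\<And>t. t \<in> I \<Longrightarrow> complementary (range (\<iota> t)) \<rho>'"
    and mr: "complementary \<mu> \<rho>" and mr': "complementary \<mu> \<rho>'"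
    and I: "connected I" "a \<in> I" "b \<in> I"
  shows "int (morse_pos (pform \<omega> \<mu> \<rho>) (range (\<iota> a))) - int (morse_pos (pform \<omega> \<mu> \<rho>') (range (\<iota> a))) =
    int (morse_pos (pform \<omega> \<mu> \<rho>) (range (\<iota> b))) - int (morse_pos (pform \<omega> \<mu> \<rho>') (range (\<iota> b)))"
proof -
  let ?q = "\<lambda>t. pform \<omega> (range (\<iota> t)) \<rho>"
  have "morse_pos (?q a) \<rho>' = morse_pos (?q b) \<rho>'"
  proof (rule morse_pos_constant[OF _ _ lagrangian_subspace[OF w r'] _ _ I])
    fix t assume t: "t \<in> I"
    show "sesquilinear (?q t)" by (rule sesquilinear_pform[OF w lr[OF t]])
    show "hermitian_on (?q t) \<rho>'" by (rule pform_hermitian[OF w lr[OF t] l[OF t] r r'])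
    have "form_ker (?q t) \<rho>' = \<rho>' \<inter> \<rho>"
      unfolding form_ker_pform[OF w lr[OF t] l[OF t] r']
    proof (intro set_eqI iffI)
      fix z assume z: "z \<in> {x \<in> \<rho>'. proj (range (\<iota> t)) \<rho> x \<in> \<rho>'}"
      then have "proj (range (\<iota> t)) \<rho> z = 0"
        using proj_in[OF lr[OF t], of z] lr'[OF t] unfolding complementary_def by blast
      then show "z \<in> \<rho>' \<inter> \<rho>" using z proj_diff_in[OF lr[OF t], of z] by simp
    next
      fix z assume "z \<in> \<rho>' \<inter> \<rho>"
      then show "z \<in> {x \<in> \<rho>'. proj (range (\<iota> t)) \<rho> x \<in> \<rho>'}"
        using proj_zero[OF lr[OF t], of z] vec.subspace_0[OF lagrangian_subspace[OF w r']] by simp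
    qed
    then show "vec.dim (form_ker (?q t) \<rho>') = vec.dim (\<rho>' \<inter> \<rho>)" by simp
  next
    fix x y
    have c: "continuous_on I (\<lambda>t. proj (range (\<iota> t)) \<rho> v)" for v
      by (rule continuous_on_proj[OF lin inj cont lr])
    have "continuous_on I (\<lambda>t. \<omega> (proj (range (\<iota> t)) \<rho> x) (y - proj (range (\<iota> t)) \<rho> y))"
      by (intro continuous_on_sesq2[OF symplectic_sesquilinear[OF w]] continuous_intros c)
    then show "continuous_on I (\<lambda>t. ?q t x y)"
      unfolding pform_def by (simp add: proj_swap[OF lr] cong: continuous_on_cong)
  qed
  then show ?thesis
    using morse_exchange[OF w l[OF I(2)] m r r' lr[OF I(2)] lr'[OF I(2)] mr mr']
      morse_exchange[OF w l[OF I(3)] m r r' lr[OF I(3)] lr'[OF I(3)] mr mr'] by linarith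
qed

section \<open>Spectral theorem for isometries of a definite form\<close>

text \<open>
  The vector \<open>p(F) v\<close>, evaluated by Horner's scheme.
\<close>

definition poly_apply :: "(complex^'m \<Rightarrow> complex^'m) \<Rightarrow> complex^'m \<Rightarrow> complex poly \<Rightarrow> complex^'m" where
  "poly_apply F v p = fold_coeffs (\<lambda>a w. a *s v + F w) p 0"

lemma poly_apply_0 [simp]: "poly_apply F v 0 = 0"
  by (simp add: poly_apply_def)

lemma poly_apply_pCons [simp]:
  assumes "lin F" shows "poly_apply F v (pCons a p) = a *s v + F (poly_apply F v p)"
  by (cases "a = 0 \<and> p = 0") (auto simp: poly_apply_def lin_0[OF assms])

lemma poly_apply_add:
  assumes "lin F" shows "poly_apply F v (p + q) = poly_apply F v p + poly_apply F v q"
  by (induction p q rule: poly_induct2)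
    (simp_all add: assms lin_add[OF assms] vec.scale_left_distrib)

lemma poly_apply_smult:
  assumes "lin F" shows "poly_apply F v (smult c p) = c *s poly_apply F v p"
  by (induction p) (simp_all add: assms lin_scale[OF assms] vec.scale_right_distrib)

lemma poly_apply_root:
  assumes "lin F" shows "poly_apply F v ([:- z, 1:] * q) = F (poly_apply F v q) - z *s poly_apply F v q"
proof -
  have "[:- z, 1:] * q = smult (- z) q + pCons 0 q" by simp
  then show ?thesis
    using poly_apply_add[OF assms, of v "smult (- z) q" "pCons 0 q"]
      poly_apply_smult[OF assms, of v "- z" q] poly_apply_pCons[OF assms, of v 0 q] by simp
qed

lemma poly_apply_in:
  assumes "lin F" "vec.subspace V" "\<And>x. x \<in> V \<Longrightarrow> F x \<in> V" "v \<in> V"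
  shows "poly_apply F v p \<in> V"
proof (induction p)
  case 0
  show ?case by (simp add: vec.subspace_0[OF assms(2)])
next
  case (pCons a p)
  show ?case
    unfolding poly_apply_pCons[OF assms(1)]
    by (intro vec.subspace_add[OF assms(2)] vec.subspace_scale[OF assms(2)] assms(3,4) pCons.IH)
qed

text \<open>
  Otherwise \<open>v, F v, F (F v), \<dots>\<close> would be linearly independent, and there would be too many of them.
\<close>

lemma annihilating_poly:
  fixes F :: "complex^'m \<Rightarrow> complex^'m"
  assumes F: "lin F"
  obtains p where "p \<noteq> 0" "poly_apply F v p = 0"
proof (rule ccontr)
  note obt = that
  assume "\<not> thesis"
  then have inj: "p = 0" if "poly_apply F v p = 0" for p using obt that by blast
  define B where "B n = poly_apply F v ` (\<lambda>k. monom 1 k) ` {..<n}" for n :: nat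
  have "vec.independent (B n) \<and> card (B n) = n" for n
  proof (induction n)
    case 0
    show ?case by (simp add: B_def vec.independent_empty)
  next
    case (Suc n)
    let ?D = "poly_apply F v ` {p. \<forall>k\<ge>n. coeff p k = 0}"
    have "vec.subspace ?D"
    proof (rule vec.subspaceI)
      show "0 \<in> ?D" by (rule image_eqI[of _ _ 0]) auto
      fix x y assume "x \<in> ?D" "y \<in> ?D"
      then obtain p q where "x = poly_apply F v p" "y = poly_apply F v q"
        "\<forall>k\<ge>n. coeff p k = 0" "\<forall>k\<ge>n. coeff q k = 0" by blast
      then show "x + y \<in> ?D"
        by (intro image_eqI[of _ _ "p + q"]) (auto simp: poly_apply_add[OF F])
    next
      fix c x assume "x \<in> ?D"
      then obtain p where "x = poly_apply F v p" "\<forall>k\<ge>n. coeff p k = 0" by blast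
      then show "c *s x \<in> ?D"
        by (intro image_eqI[of _ _ "smult c p"]) (auto simp: poly_apply_smult[OF F])
    qed
    moreover have "B n \<subseteq> ?D" unfolding B_def by auto
    ultimately have "vec.span (B n) \<subseteq> ?D" using vec.span_minimal by blast
    moreover have "poly_apply F v (monom 1 n) \<notin> ?D"
    proof
      assume "poly_apply F v (monom 1 n) \<in> ?D"
      then obtain p where p: "poly_apply F v (monom 1 n) = poly_apply F v p" "coeff p n = 0" by blast
      have "poly_apply F v (monom 1 n + smult (- 1) p) = 0"
        unfolding poly_apply_add[OF F] poly_apply_smult[OF F] p(1) by simp
      then have "coeff (monom 1 n + smult (- 1) p) n = 0" using inj by (metis coeff_0)
      then show False using p(2) by simp
    qed
    ultimately have notin: "poly_apply F v (monom 1 n) \<notin> vec.span (B n)" by blast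
    then have "poly_apply F v (monom 1 n) \<notin> B n" using vec.span_base by blast
    moreover have "B (Suc n) = insert (poly_apply F v (monom 1 n)) (B n)"
      unfolding B_def lessThan_Suc by simp
    moreover have "finite (B n)" by (simp add: B_def)
    ultimately show ?case using Suc vec.independent_insertI[OF notin] by simp
  qed
  then have "Suc CARD('m) \<le> vec.dim (UNIV :: (complex^'m) set)"
    using vec.independent_card_le_dim[OF subset_UNIV, of "B (Suc CARD('m))"] by metis
  then show False by (simp only: vec_dim_card)
qed

text \<open>
  Take an annihilating polynomial of least degree and a root \<open>z\<close> of it. The cofactor of \<open>X - z\<close> does
  not annihilate \<open>v\<close>, and it maps \<open>v\<close> to an eigenvector for \<open>z\<close>.
\<close>

lemma exists_eigenvector:
  fixes F :: "complex^'m \<Rightarrow> complex^'m"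
  assumes F: "lin F" and V: "vec.subspace V" "\<And>x. x \<in> V \<Longrightarrow> F x \<in> V" and v: "v \<in> V" "v \<noteq> 0"
  obtains z x where "x \<in> V" "x \<noteq> 0" "F x = z *s x"
proof -
  have ex: "\<exists>n p. p \<noteq> 0 \<and> poly_apply F v p = 0 \<and> degree p = n"
    using annihilating_poly[OF F, of v] by metis
  define n where "n = (LEAST n. \<exists>p. p \<noteq> 0 \<and> poly_apply F v p = 0 \<and> degree p = n)"
  obtain p where p: "p \<noteq> 0" "poly_apply F v p = 0" "degree p = n"
    using LeastI_ex[OF ex] unfolding n_def by blast
  have least: "n \<le> degree q" if "q \<noteq> 0" "poly_apply F v q = 0" for q
    unfolding n_def by (rule Least_le) (use that in blast)
  have "\<not> constant (poly p)"
  proof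
    assume "constant (poly p)"
    then obtain a where a: "p = [:a:]" using constant_degree degree_eq_zeroE by metis
    then have "a *s v = 0" using p(2) F by (simp add: lin_0)
    then show False using a p(1) v(2) by simp
  qed
  then obtain z where "poly p z = 0" using fundamental_theorem_of_algebra by blast
  then obtain q where q: "p = [:- z, 1:] * q" using poly_eq_0_iff_dvd by blast
  then have q0: "q \<noteq> 0" using p(1) by auto
  have "degree p = Suc (degree q)"
    unfolding q using q0 by (subst degree_mult_eq) auto
  then have "poly_apply F v q \<noteq> 0" using least[OF q0] p(3) by linarith
  moreover have "F (poly_apply F v q) = z *s poly_apply F v q"
    using p(2) unfolding q poly_apply_root[OF F] by simp
  ultimately show thesis using that poly_apply_in[OF F V v(1)] by blast
qed

locale definite_isometry =
  fixes V :: "(complex^'m) set" and h :: "complex^'m \<Rightarrow> complex^'m \<Rightarrow> complex"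
    and F :: "complex^'m \<Rightarrow> complex^'m"
  assumes V: "vec.subspace V" and h: "sesquilinear h" "hermitian_on h V" "pos_def_on h V"
    and F: "lin F" "\<And>x. x \<in> V \<Longrightarrow> F x \<in> V"
    and iso: "\<And>x y. x \<in> V \<Longrightarrow> y \<in> V \<Longrightarrow> h (F x) (F y) = h x y"
begin

definition eigenspace :: "complex \<Rightarrow> (complex^'m) set" where
  "eigenspace z = {x \<in> V. F x = z *s x}"

definition eigen_sum :: "complex set \<Rightarrow> (complex^'m) set" where
  "eigen_sum A = vec.span (\<Union>z\<in>A. eigenspace z)"

lemma eigenspace_subspace: "vec.subspace (eigenspace z)"
  unfolding eigenspace_def using V
  by (auto intro!: vec.subspaceI simp: lin_simps[OF F(1)] vec.subspace_0 vec.subspace_add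
      vec.subspace_scale vec.scale_right_distrib mult.commute)

lemma eigenspace_sub: "eigenspace z \<subseteq> V"
  by (auto simp: eigenspace_def)

lemma eigen_sum_sub: "eigen_sum A \<subseteq> V"
  unfolding eigen_sum_def using eigenspace_sub V by (intro vec.span_minimal) auto

lemma eigen_sum_subspace: "vec.subspace (eigen_sum A)"
  by (simp add: eigen_sum_def)

lemma h_zero: "x \<in> V \<Longrightarrow> h x x = 0 \<Longrightarrow> x = 0"
  using h(3) unfolding pos_def_on_def by force

lemma unit_eigenvalue:
  assumes "x \<in> eigenspace z" "x \<noteq> 0" shows "z * cnj z = 1"
proof -
  have x: "x \<in> V" "F x = z *s x" using assms(1) by (auto simp: eigenspace_def)
  have "z * cnj z * h x x = h x x"
    using iso[OF x(1) x(1)] x(2) by (simp add: sesq_simps[OF h(1)] mult_ac)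
  then show ?thesis using h_zero[OF x(1)] assms(2) by auto
qed

lemma eigenspace_orthogonal:
  assumes "x \<in> eigenspace z" "y \<in> eigenspace w" "z \<noteq> w" shows "h x y = 0"
proof (rule ccontr)
  assume ne: "h x y \<noteq> 0"
  then have nz: "x \<noteq> 0" "y \<noteq> 0" using sesq_simps(5,6)[OF h(1)] by auto
  have "z * cnj w * h x y = h x y"
    using iso[of x y] assms by (simp add: eigenspace_def sesq_simps[OF h(1)] mult_ac)
  then have "z * cnj w = 1" using ne by simp
  moreover have "w * cnj w = 1" using unit_eigenvalue assms(2) nz(2) by blast
  ultimately have "z * cnj w = w * cnj w" "cnj w \<noteq> 0" by auto
  then show False using assms(3) by simp
qed

text \<open>
  An isometry has no nontrivial Jordan blocks: if \<open>u = F x - z *s x\<close> is an eigenvector for \<open>z\<close>, the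
  isometry property gives \<open>h (F x) u = z * h x u\<close>, hence \<open>h u u = 0\<close>.
\<close>

lemma generalized_eigenspace: "multiplicity_on V F z = vec.dim (eigenspace z)"
proof -
  let ?g = "\<lambda>v. F v - z *s v"
  have gV: "?g x \<in> V" if "x \<in> V" for x
    by (intro vec.subspace_diff[OF V] F(2) vec.subspace_scale[OF V] that)
  have sq: "?g x = 0" if x: "x \<in> V" and "?g (?g x) = 0" for x
  proof (rule ccontr)
    define u where "u = ?g x"
    assume "?g x \<noteq> 0"
    then have u: "u \<noteq> 0" "u \<in> eigenspace z"
      using that gV[OF x] by (simp_all add: u_def eigenspace_def)
    then have uV: "u \<in> V" "F u = z *s u" by (simp_all add: eigenspace_def)
    have z1: "z * cnj z = 1" using unit_eigenvalue u by blast
    have "cnj z * h (F x) u = h (F x) (F u)" by (simp add: uV(2) sesq_simps[OF h(1)])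
    also have "\<dots> = h x u" using iso[OF x uV(1)] .
    finally have "z * (cnj z * h (F x) u) = z * h x u" by simp
    then have "h (F x) u = z * h x u" using z1 by (simp flip: mult.assoc)
    moreover have "h u u = h (F x - z *s x) u" unfolding u_def ..
    ultimately have "h u u = 0" by (simp add: sesq_simps[OF h(1)])
    then show False using h_zero uV(1) u(1) by blast
  qed
  have "?g x = 0" if "x \<in> V" "(?g ^^ j) x = 0" for j x
    using that
  proof (induction j arbitrary: x)
    case 0
    then show ?case by (simp add: lin_0[OF F(1)])
  next
    case (Suc j)
    then have "(?g ^^ j) (?g x) = 0" unfolding funpow_Suc_right comp_apply by blast
    then have "?g (?g x) = 0" by (rule Suc.IH[OF gV[OF Suc.prems(1)]])
    then show ?case by (rule sq[OF Suc.prems(1)])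
  qed
  then have "{x \<in> V. \<exists>j. (?g ^^ j) x = 0} = eigenspace z"
    unfolding eigenspace_def by (auto intro: exI[of _ "1::nat"])
  then show ?thesis unfolding multiplicity_on_def by simp
qed

lemma eigen_sum_finite:
  assumes "finite A"
  shows "vec.dim (eigen_sum A) = (\<Sum>z\<in>A. vec.dim (eigenspace z)) \<and>
    (\<forall>x\<in>eigen_sum A. \<exists>y. (\<forall>z\<in>A. y z \<in> eigenspace z) \<and> x = (\<Sum>z\<in>A. y z))"
  using assms
proof (induction A)
  case empty
  show ?case by (simp add: eigen_sum_def)
next
  case (insert z A)
  have eigen_sum: "eigen_sum (insert z A) = {a + b |a b. a \<in> eigenspace z \<and> b \<in> eigen_sum A}"
    unfolding eigen_sum_def UN_insert vec.span_Un vec.span_eq_iff[THEN iffD2, OF eigenspace_subspace] ..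
  have "eigenspace z \<inter> eigen_sum A \<subseteq> {0}"
  proof
    fix x assume x: "x \<in> eigenspace z \<inter> eigen_sum A"
    then obtain y where y: "\<forall>w\<in>A. y w \<in> eigenspace w" "x = (\<Sum>w\<in>A. y w)" using insert.IH by blast
    have "h x (\<Sum>w\<in>A. y w) = 0"
      unfolding sesq_sum_right[OF h(1)]
      using x y(1) insert.hyps(2) by (intro sum.neutral ballI eigenspace_orthogonal[where z=z]) auto
    then have "h x x = 0" using y(2) by simp
    then show "x \<in> {0}" using h_zero[of x] x eigenspace_sub by blast
  qed
  then have dim: "vec.dim (eigen_sum (insert z A)) = vec.dim (eigenspace z) + vec.dim (eigen_sum A)"
    unfolding eigen_sum by (rule dim_direct_sum[OF eigenspace_subspace eigen_sum_subspace])
  have "\<exists>y. (\<forall>w\<in>insert z A. y w \<in> eigenspace w) \<and> x = (\<Sum>w\<in>insert z A. y w)" if xD: "x \<in> eigen_sum (insert z A)" for x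
  proof -
    obtain a b where ab: "x = a + b" "a \<in> eigenspace z" "b \<in> eigen_sum A" using xD eigen_sum by blast
    obtain y where y: "\<forall>w\<in>A. y w \<in> eigenspace w" "b = (\<Sum>w\<in>A. y w)" using insert.IH ab(3) by blast
    have "(\<Sum>w\<in>insert z A. (y(z := a)) w) = a + (\<Sum>w\<in>A. (y(z := a)) w)"
      using insert.hyps by simp
    also have "(\<Sum>w\<in>A. (y(z := a)) w) = b"
      unfolding y(2) using insert.hyps(2) by (intro sum.cong) auto
    finally show ?thesis
      using ab y(1) by (intro exI[of _ "y(z := a)"]) auto
  qed
  then show ?case using dim insert.IH insert.hyps by simp
qed

lemma spectrum_iff: "z \<in> spectrum_on V F \<longleftrightarrow> \<not> eigenspace z \<subseteq> {0}"
  unfolding spectrum_on_def eigenspace_def by auto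

lemma finite_spectrum: "finite (spectrum_on V F)"
proof -
  have "card A \<le> vec.dim V" if A: "A \<subseteq> spectrum_on V F" "finite A" for A
  proof -
    have "1 \<le> vec.dim (eigenspace z)" if "z \<in> A" for z
      using that A(1) spectrum_iff[of z] vec.dim_eq_0[of "eigenspace z"] by (metis less_one not_le subset_iff)
    then have "(\<Sum>z\<in>A. 1) \<le> (\<Sum>z\<in>A. vec.dim (eigenspace z))" by (intro sum_mono)
    then have "card A \<le> vec.dim (eigen_sum A)" using eigen_sum_finite[OF A(2)] by simp
    also have "\<dots> \<le> vec.dim V" by (rule vec.dim_subset[OF eigen_sum_sub])
    finally show ?thesis .
  qed
  then show ?thesis using finite_if_finite_subsets_card_bdd by blast
qed

text \<open>
  The orthogonal complement of all eigenvectors is invariant under the isometry. If it were nonzero it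
  would contain a further eigenvector.
\<close>

lemma spectral_decomposition: "(\<Sum>z\<in>spectrum_on V F. vec.dim (eigenspace z)) = vec.dim V"
proof -
  let ?D = "eigen_sum (spectrum_on V F)"
  let ?U = "form_perp h V ?D"
  have U: "vec.subspace ?U" by (rule subspace_form_perp[OF h(1) V])
  have FU: "F x \<in> ?U" if x: "x \<in> ?U" for x
  proof -
    have xV: "x \<in> V" and xD: "\<And>y. y \<in> ?D \<Longrightarrow> h x y = 0" using x by (auto simp: form_perp_def)
    have 1: "h (F x) y = 0" if "y \<in> eigenspace z" for y z
    proof (cases "y = 0")
      case False
      have y: "y \<in> V" "F y = z *s y" using that by (auto simp: eigenspace_def)
      have z1: "z * cnj z = 1" using unit_eigenvalue[OF that False] .
      have "z \<in> spectrum_on V F" unfolding spectrum_iff using that False by blast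
      then have "y \<in> ?D" unfolding eigen_sum_def using that by (intro vec.span_base) blast
      then have "h (F x) (F y) = 0" using iso[OF xV y(1)] xD by simp
      then have "cnj z * h (F x) y = 0" by (simp add: y(2) sesq_simps[OF h(1)])
      then show ?thesis using z1 by auto
    qed (simp add: sesq_simps[OF h(1)])
    have "h (F x) y = 0" if "y \<in> ?D" for y
      using that unfolding eigen_sum_def
      by (induction rule: vec.span_induct_alt) (auto simp: sesq_simps[OF h(1)] 1)
    then show ?thesis using F(2)[OF xV] unfolding form_perp_def by blast
  qed
  have "?U \<subseteq> {0}"
  proof (rule ccontr)
    assume "\<not> ?U \<subseteq> {0}"
    then obtain v where v: "v \<in> ?U" "v \<noteq> 0" by blast
    obtain z x where x: "x \<in> ?U" "x \<noteq> 0" "F x = z *s x"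
      by (rule exists_eigenvector[OF F(1) U FU v])
    have "x \<in> eigenspace z" using x(1,3) by (simp add: eigenspace_def form_perp_def)
    then have "x \<in> ?D" unfolding eigen_sum_def using x(2) spectrum_iff by (intro vec.span_base) blast
    then have "h x x = 0" using x(1) by (simp add: form_perp_def)
    then show False using h_zero x(1,2) by (simp add: form_perp_def)
  qed
  then have "vec.dim ?U = 0" by simp
  then have "vec.dim V \<le> vec.dim ?D"
    using dim_form_perp_ge[OF h(1) V eigen_sum_subspace, of "spectrum_on V F"] by linarith
  moreover have "vec.dim ?D \<le> vec.dim V" by (rule vec.dim_subset[OF eigen_sum_sub])
  ultimately show ?thesis using eigen_sum_finite[OF finite_spectrum] by simp
qed

text \<open>
  If the eigenspaces are orthogonal for \<open>Q\<close> and \<open>Q\<close> is the multiple \<open>k z\<close> of \<open>h\<close> on each of them, then the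
  eigenspaces with \<open>k z > 0\<close>, \<open>k z < 0\<close> and \<open>k z = 0\<close> bound the positive index, the negative index
  and the kernel from below. Together they exhaust the dimension.
\<close>

lemma morse_pos_spectral:
  assumes Q: "sesquilinear Q" "hermitian_on Q V"
    and orth: "\<And>x y z w. x \<in> eigenspace z \<Longrightarrow> y \<in> eigenspace w \<Longrightarrow> z \<noteq> w \<Longrightarrow> Q x y = 0"
    and diag: "\<And>x z. z \<in> spectrum_on V F \<Longrightarrow> x \<in> eigenspace z \<Longrightarrow> Q x x = complex_of_real (k z) * h x x"
  shows "morse_pos Q V = (\<Sum>z | z \<in> spectrum_on V F \<and> 0 < k z. vec.dim (eigenspace z))"
proof -
  let ?S = "spectrum_on V F"
  have pos: "vec.dim (eigen_sum A) \<le> morse_pos Q' V"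
    if Q': "sesquilinear Q'" "hermitian_on Q' V" and A: "A \<subseteq> ?S" "\<And>z. z \<in> A \<Longrightarrow> 0 < k' z"
      and orth': "\<And>x y z w. x \<in> eigenspace z \<Longrightarrow> y \<in> eigenspace w \<Longrightarrow> z \<noteq> w \<Longrightarrow> Q' x y = 0"
      and diag': "\<And>x z. z \<in> ?S \<Longrightarrow> x \<in> eigenspace z \<Longrightarrow> Q' x x = complex_of_real (k' z) * h x x"
    for Q' A k'
  proof -
    have fin: "finite A" using A(1) finite_spectrum finite_subset by blast
    have "pos_def_on Q' (eigen_sum A)"
    proof (rule hermitian_pos_def[OF Q'(2) eigen_sum_sub])
      fix x assume x: "x \<in> eigen_sum A" "x \<noteq> 0"
      obtain y where y: "\<forall>z\<in>A. y z \<in> eigenspace z" "x = (\<Sum>z\<in>A. y z)" using eigen_sum_finite[OF fin] x(1) by blast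
      have "Q' x x = (\<Sum>z\<in>A. \<Sum>w\<in>A. Q' (y z) (y w))"
        unfolding y(2) unfolding sesq_sum_left[OF Q'(1)] unfolding sesq_sum_right[OF Q'(1)] ..
      also have "\<dots> = (\<Sum>z\<in>A. \<Sum>w\<in>A. if w = z then Q' (y z) (y z) else 0)"
      proof (intro sum.cong refl)
        fix z w assume "z \<in> A" "w \<in> A"
        then show "Q' (y z) (y w) = (if w = z then Q' (y z) (y z) else 0)"
          using orth'[of "y z" z "y w" w] y(1) by (cases "w = z") auto
      qed
      also have "\<dots> = (\<Sum>z\<in>A. Q' (y z) (y z))" using fin by simp
      also have "\<dots> = (\<Sum>z\<in>A. complex_of_real (k' z) * h (y z) (y z))"
        using diag' y(1) A(1) by (intro sum.cong refl) auto
      finally have e: "Re (Q' x x) = (\<Sum>z\<in>A. k' z * Re (h (y z) (y z)))" by simp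
      have nn: "0 < k' z * Re (h (y z) (y z))" if "z \<in> A" "y z \<noteq> 0" for z
        using A(2)[OF that(1)] h(3) y(1) that eigenspace_sub[of z] unfolding pos_def_on_def by auto
      have nn0: "0 \<le> k' z * Re (h (y z) (y z))" if "z \<in> A" for z
        using nn[OF that] sesq_simps(5)[OF h(1)] by (cases "y z = 0") auto
      obtain z where z: "z \<in> A" "y z \<noteq> 0" using x(2) y(2) sum.neutral by metis
      show "0 < Re (Q' x x)"
        unfolding e by (rule sum_pos2[OF fin z(1)]) (use nn[OF z] nn0 in auto)
    qed
    then show ?thesis by (rule morse_pos_ge[OF eigen_sum_subspace eigen_sum_sub])
  qed
  let ?P = "{z \<in> ?S. 0 < k z}" and ?N = "{z \<in> ?S. k z < 0}" and ?Z = "{z \<in> ?S. k z = 0}"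
  have fin: "finite ?P" "finite ?N" "finite ?Z" using finite_spectrum by auto
  have 1: "vec.dim (eigen_sum ?P) \<le> morse_pos Q V"
    by (rule pos[where k'=k, OF Q]) (use orth diag in auto)
  have 2: "vec.dim (eigen_sum ?N) \<le> morse_pos (\<lambda>x y. - Q x y) V"
    by (rule pos[where k'="\<lambda>z. - k z", OF sesquilinear_minus[OF Q(1)] hermitian_on_minus[OF Q(2)]])
      (use orth diag in auto)
  have zero: "Q x y = 0" if x: "x \<in> eigenspace z" and z: "z \<in> ?Z" and y: "y \<in> V" for x y z
  proof -
    have k0: "Q u u = 0" if "u \<in> eigenspace z" for u using diag[of z u] z that by simp
    have same: "Q x u = 0" if u: "u \<in> eigenspace z" for u
    proof -
      have "Re (Q w w) \<le> 0" if "w \<in> eigenspace z" for w using k0[OF that] by simp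
      then show ?thesis
        by (rule semidefinite_null[OF Q(1) hermitian_on_subset[OF Q(2) eigenspace_sub] eigenspace_subspace _ x k0[OF x] u])
    qed
    have "V = eigen_sum ?S"
    proof -
      have "vec.dim V \<le> vec.dim (eigen_sum ?S)" using eigen_sum_finite[OF finite_spectrum] spectral_decomposition by simp
      then show ?thesis by (rule vec.subspace_dim_equal[OF eigen_sum_subspace V eigen_sum_sub, symmetric])
    qed
    then obtain u where u: "\<forall>w\<in>?S. u w \<in> eigenspace w" "y = (\<Sum>w\<in>?S. u w)"
      using eigen_sum_finite[OF finite_spectrum] y by blast
    have "Q x (u w) = 0" if "w \<in> ?S" for w
      using same orth[OF x, of "u w" w] u(1) that by (cases "w = z") auto
    then show ?thesis unfolding u(2) sesq_sum_right[OF Q(1)] by simp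
  qed
  have 3: "vec.dim (eigen_sum ?Z) \<le> vec.dim (form_ker Q V)"
  proof (rule vec.dim_subset, rule)
    fix x assume x: "x \<in> eigen_sum ?Z"
    obtain y where y: "\<forall>z\<in>?Z. y z \<in> eigenspace z" "x = (\<Sum>z\<in>?Z. y z)" using eigen_sum_finite[OF fin(3)] x by blast
    have "Q x v = 0" if "v \<in> V" for v
      unfolding y(2) sesq_sum_left[OF Q(1)] using zero y(1) that by (intro sum.neutral) blast
    then show "x \<in> form_ker Q V" using x eigen_sum_sub unfolding form_ker_def by blast
  qed
  have "?S = ?P \<union> ?N \<union> ?Z" by auto
  then have "(\<Sum>z\<in>?S. vec.dim (eigenspace z)) = (\<Sum>z\<in>?P \<union> ?N \<union> ?Z. vec.dim (eigenspace z))" by simp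
  also have "\<dots> = (\<Sum>z\<in>?P. vec.dim (eigenspace z)) + (\<Sum>z\<in>?N. vec.dim (eigenspace z)) + (\<Sum>z\<in>?Z. vec.dim (eigenspace z))"
    using fin by (subst sum.union_disjoint, auto)+
  finally have "vec.dim (eigen_sum ?P) + vec.dim (eigen_sum ?N) + vec.dim (eigen_sum ?Z) = vec.dim V"
    using spectral_decomposition eigen_sum_finite fin by simp
  then have "morse_pos Q V = vec.dim (eigen_sum ?P)"
    using 1 2 3 sylvester_inertia[OF Q V] by linarith
  then show ?thesis using eigen_sum_finite[OF fin(1)] by simp
qed

end

section \<open>Eigenvalue counts as Morse indices\<close>

text \<open>
  The annihilator contains the subspace and has the same dimension.
\<close>

lemma isotropic_lagrangian:
  fixes L :: "(complex^'m) set"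
  assumes w: "symplectic_form \<omega>" and L: "vec.subspace L" "\<And>x y. x \<in> L \<Longrightarrow> y \<in> L \<Longrightarrow> \<omega> x y = 0"
    and dim: "2 * vec.dim L = CARD('m)"
  shows "lagrangian \<omega> L"
proof -
  note s = symplectic_sesquilinear[OF w]
  let ?P = "form_perp \<omega> UNIV L"
  have "L \<subseteq> ?P" using L(2) by (auto simp: form_perp_def)
  moreover have "vec.dim L + vec.dim ?P = CARD('m)"
    by (rule dim_perp_nondegenerate[OF s _ L(1)]) (use symplectic_nondegenerate[OF w] in blast)
  then have "vec.dim ?P \<le> vec.dim L" using dim by linarith
  ultimately have "L = ?P"
    using vec.subspace_dim_equal[OF L(1) subspace_form_perp[OF s vec.subspace_UNIV]] by blast
  then show ?thesis unfolding lagrangian_def form_perp_def by simp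
qed

lemma splitting_complementary:
  assumes sp: "symplectic_splitting \<omega> Vp Vm"
  shows "complementary Vp Vm"
  unfolding complementary_def
proof (intro conjI allI)
  show "vec.subspace Vp" "vec.subspace Vm" "Vp \<inter> Vm \<subseteq> {0}"
    using sp by (auto simp: symplectic_splitting_def)
  fix v
  have "v \<in> {x + y |x y. x \<in> Vp \<and> y \<in> Vm}" using sp by (simp add: symplectic_splitting_def)
  then show "\<exists>a\<in>Vp. v - a \<in> Vm" by force
qed

lemma splitting_orthogonal:
  assumes w: "symplectic_form \<omega>" and sp: "symplectic_splitting \<omega> Vp Vm" and "x \<in> Vp" "y \<in> Vm"
  shows "\<omega> x y = 0" "\<omega> y x = 0"
proof -
  show "\<omega> x y = 0" using sp assms(3,4) by (simp add: symplectic_splitting_def)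
  then show "\<omega> y x = 0" using symplectic_skew[OF w, of y x] by simp
qed

lemma splitting_null:
  assumes sp: "symplectic_splitting \<omega> Vp Vm" and "\<omega> x x = 0"
  shows "x \<in> Vp \<Longrightarrow> x = 0" "x \<in> Vm \<Longrightarrow> x = 0"
  using assms unfolding symplectic_splitting_def pos_def_on_def by force+

text \<open>
  A Lagrangian subspace meets \<open>Vp\<close> and \<open>Vm\<close> only in zero, which bounds the dimension of both by half of the
  total; as they add up to the total, both are exactly half.
\<close>

lemma splitting_dim:
  fixes L :: "(complex^'m) set"
  assumes w: "symplectic_form \<omega>" and sp: "symplectic_splitting \<omega> Vp Vm" and L: "lagrangian \<omega> L"
  shows "complementary Vp L" "complementary Vm L" "2 * vec.dim Vm = CARD('m)"
proof -
  note c = splitting_complementary[OF sp]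
  have disj: "Vp \<inter> L \<subseteq> {0}" "Vm \<inter> L \<subseteq> {0}"
    using splitting_null[OF sp] lagrangian_isotropic[OF L] by blast+
  note sub = complementary_subspaces[OF c] lagrangian_subspace[OF w L]
  have "vec.dim Vp + vec.dim L \<le> vec.dim (UNIV :: (complex^'m) set)"
    "vec.dim Vm + vec.dim L \<le> vec.dim (UNIV :: (complex^'m) set)"
    using disj sub by (intro dim_disjoint_le; simp)+
  then have "vec.dim Vp + vec.dim L \<le> CARD('m)" "vec.dim Vm + vec.dim L \<le> CARD('m)"
    by (simp_all only: vec_dim_card)
  then have "2 * vec.dim Vp = CARD('m)" "2 * vec.dim Vm = CARD('m)"
    using complementary_dims[OF c] lagrangian_dim[OF w L] by linarith+
  then show "complementary Vp L" "complementary Vm L" "2 * vec.dim Vm = CARD('m)"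
    using complementary_dim[OF sub(1,3) disj(1)] complementary_dim[OF sub(2,3) disj(2)]
      lagrangian_dim[OF w L] by linarith+
qed

lemma graph_map_eq:
  assumes w: "symplectic_form \<omega>" and sp: "symplectic_splitting \<omega> Vp Vm" and L: "lagrangian \<omega> L"
  shows "graph_map Vp Vm L x = - proj Vm L x"
  unfolding graph_map_def
proof (rule the_equality)
  note c = splitting_dim(2)[OF w sp L]
  note sub = complementary_subspaces[OF c]
  show "- proj Vm L x \<in> Vm \<and> x + - proj Vm L x \<in> L"
    using vec.subspace_neg[OF sub(1) proj_in[OF c]] proj_diff_in[OF c, of x] by simp
  fix y assume y: "y \<in> Vm \<and> x + y \<in> L"
  have "proj Vm L x = - y"
    by (rule proj_unique[OF c]) (use y vec.subspace_neg[OF sub(1)] in auto)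
  then show "y = - proj Vm L x" by simp
qed

text \<open>
  If \<open>L\<close> is the graph of \<open>U\<close>, then \<open>x + U x \<in> L\<close> says that \<open>- U x\<close> is the component of \<open>x\<close> in \<open>Vm\<close> along
  \<open>L\<close>. Likewise the inverse of the map with graph \<open>\<mu>\<close> is \<open>- proj Vp \<mu>\<close>, and the signs cancel.
\<close>

lemma relative_unitary_eq:
  assumes w: "symplectic_form \<omega>" and sp: "symplectic_splitting \<omega> Vp Vm"
    and l: "lagrangian \<omega> \<Lambda>" and m: "lagrangian \<omega> \<mu>" and y: "y \<in> Vm"
  shows "relative_unitary Vp Vm \<Lambda> \<mu> y = proj Vm \<Lambda> (proj Vp \<mu> y)"
proof -
  note cp = splitting_dim(1)[OF w sp m] and cm = splitting_dim(2)[OF w sp m]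
  note sub = complementary_subspaces[OF cp] complementary_subspaces[OF cm]
  let ?V = "graph_map Vp Vm \<mu>"
  have inV: "x + ?V x \<in> \<mu>" for x
    using proj_diff_in[OF cm, of x] unfolding graph_map_eq[OF w sp m] by simp
  have inj: "inj_on ?V Vp"
  proof (rule inj_onI)
    fix x x' assume x: "x \<in> Vp" "x' \<in> Vp" "?V x = ?V x'"
    have "x - x' \<in> \<mu>" using vec.subspace_diff[OF sub(2) inV[of x] inV[of x']] x(3) by simp
    moreover have "x - x' \<in> Vp" using vec.subspace_diff[OF sub(1)] x by blast
    ultimately have "x - x' = 0" using cp unfolding complementary_def by blast
    then show "x = x'" by simp
  qed
  let ?x = "- proj Vp \<mu> y"
  have x: "?x \<in> Vp" by (rule vec.subspace_neg[OF sub(1) proj_in[OF cp]])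
  have "?V ?x = y"
  proof -
    have "proj Vm \<mu> ?x = - y"
      by (rule proj_unique[OF cm])
        (use y vec.subspace_neg[OF sub(3)] proj_diff_in[OF cp, of y] in \<open>simp_all add: algebra_simps\<close>)
    then show ?thesis unfolding graph_map_eq[OF w sp m] by simp
  qed
  then have "inv_into Vp ?V y = ?x" using inv_into_f_f[OF inj x] by simp
  then show ?thesis
    unfolding relative_unitary_def comp_apply
    by (simp add: graph_map_eq[OF w sp l] lin_neg[OF proj_lin[OF splitting_dim(2)[OF w sp l]]])
qed

lemma multiplicity_on_cong:
  assumes V: "vec.subspace V" and eq: "\<And>x. x \<in> V \<Longrightarrow> F x = G x" and G: "\<And>x. x \<in> V \<Longrightarrow> G x \<in> V"
  shows "multiplicity_on V F z = multiplicity_on V G z"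
proof -
  let ?f = "\<lambda>v. F v - z *s v" and ?g = "\<lambda>v. G v - z *s v"
  have "(?f ^^ j) x = (?g ^^ j) x \<and> (?g ^^ j) x \<in> V" if "x \<in> V" for j x
  proof (induction j)
    case (Suc j)
    then show ?case
      using eq[of "(?g ^^ j) x"] vec.subspace_diff[OF V G vec.subspace_scale[OF V]] by simp
  qed (use that in simp)
  then have "{x \<in> V. \<exists>j. (?f ^^ j) x = 0} = {x \<in> V. \<exists>j. (?g ^^ j) x = 0}" by auto
  then show ?thesis unfolding multiplicity_on_def by simp
qed

lemma spectrum_on_cong: "(\<And>x. x \<in> V \<Longrightarrow> F x = G x) \<Longrightarrow> spectrum_on V F = spectrum_on V G"
  unfolding spectrum_on_def by (metis (no_types, lifting))

text \<open>
  For \<open>y \<in> Vm\<close>, the vector \<open>- proj Vp \<mu> y\<close> is the preimage of \<open>y\<close> under the map \<open>Vp \<rightarrow> Vm\<close> whose graph is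
  \<open>\<mu>\<close>. So this is the graph of \<open>\<eta>\<close> times that map.
\<close>

definition rotated_lagrangian ::
    "(complex^'m) set \<Rightarrow> (complex^'m) set \<Rightarrow> (complex^'m) set \<Rightarrow> complex \<Rightarrow> (complex^'m) set" where
  "rotated_lagrangian Vp Vm \<mu> \<eta> = (\<lambda>y. \<eta> *s y - proj Vp \<mu> y) ` Vm"

lemma proj_isometry:
  assumes w: "symplectic_form \<omega>" and sp: "symplectic_splitting \<omega> Vp Vm" and m: "lagrangian \<omega> \<mu>"
    and y: "y \<in> Vm" "y' \<in> Vm"
  shows "\<omega> (proj Vp \<mu> y) (proj Vp \<mu> y') = - \<omega> y y'"
proof -
  note cp = splitting_dim(1)[OF w sp m]
  have "\<omega> (y - proj Vp \<mu> y) (y' - proj Vp \<mu> y') = 0"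
    by (rule lagrangian_isotropic[OF m proj_diff_in[OF cp] proj_diff_in[OF cp]])
  then have "\<omega> y y' + \<omega> (proj Vp \<mu> y) (proj Vp \<mu> y') = 0"
    using splitting_orthogonal[OF w sp proj_in[OF cp] y(1)] splitting_orthogonal[OF w sp proj_in[OF cp] y(2)]
    by (simp add: sesq_simps[OF symplectic_sesquilinear[OF w]])
  then show ?thesis by (simp add: add_eq_0_iff)
qed

lemma splitting_decomposition_unique:
  assumes sp: "symplectic_splitting \<omega> Vp Vm" and "x \<in> Vp" "x' \<in> Vp" "y \<in> Vm" "y' \<in> Vm" "y - x = y' - x'"
  shows "y = y'" "x = x'"
proof -
  note c = splitting_complementary[OF sp]
  have "y - y' = x - x'" using assms(6) by (simp add: algebra_simps)
  moreover have "y - y' \<in> Vm" "x - x' \<in> Vp"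
    using vec.subspace_diff complementary_subspaces[OF c] assms by blast+
  ultimately have "y - y' = 0" "x - x' = 0" using c unfolding complementary_def by auto
  then show "y = y'" "x = x'" by simp_all
qed

lemma rotated_lagrangian:
  fixes \<mu> :: "(complex^'m) set"
  assumes w: "symplectic_form \<omega>" and sp: "symplectic_splitting \<omega> Vp Vm" and m: "lagrangian \<omega> \<mu>"
    and \<eta>: "\<eta> * cnj \<eta> = 1"
  shows "lagrangian \<omega> (rotated_lagrangian Vp Vm \<mu> \<eta>)"
proof (rule isotropic_lagrangian[OF w])
  note cp = splitting_dim(1)[OF w sp m] and c = splitting_complementary[OF sp]
  let ?f = "\<lambda>y. \<eta> *s y - proj Vp \<mu> y"
  have lf: "lin ?f" by (rule lin_minus[OF lin_cmult[OF lin_id] proj_lin[OF cp]])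
  have Vm: "vec.subspace Vm" using complementary_subspaces[OF c] by blast
  show "vec.subspace (rotated_lagrangian Vp Vm \<mu> \<eta>)"
    unfolding rotated_lagrangian_def by (rule subspace_image[OF lf Vm])
  have inj: "y = 0" if y: "y \<in> Vm" "?f y = 0" for y
  proof -
    have "\<eta> *s y - proj Vp \<mu> y = 0 - 0" using y(2) by simp
    then have "\<eta> *s y = 0"
      by (rule splitting_decomposition_unique(1)[OF sp proj_in[OF cp]
            vec.subspace_0[OF complementary_subspaces(1)[OF c]] vec.subspace_scale[OF Vm y(1)] vec.subspace_0[OF Vm]])
    then show ?thesis using \<eta> by auto
  qed
  show "2 * vec.dim (rotated_lagrangian Vp Vm \<mu> \<eta>) = CARD('m)"
    unfolding rotated_lagrangian_def using dim_injective_image[OF lf Vm inj] splitting_dim(3)[OF w sp m]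
    by simp
  fix u v assume "u \<in> rotated_lagrangian Vp Vm \<mu> \<eta>" "v \<in> rotated_lagrangian Vp Vm \<mu> \<eta>"
  then obtain y y' where y: "y \<in> Vm" "y' \<in> Vm" and uv: "u = ?f y" "v = ?f y'"
    unfolding rotated_lagrangian_def by blast
  have "\<omega> u v = \<eta> * cnj \<eta> * \<omega> y y' + \<omega> (proj Vp \<mu> y) (proj Vp \<mu> y')"
    unfolding uv
    using splitting_orthogonal[OF w sp proj_in[OF cp] y(1)] splitting_orthogonal[OF w sp proj_in[OF cp] y(2)]
    by (simp add: sesq_simps[OF symplectic_sesquilinear[OF w]])
  then show "\<omega> u v = 0" using proj_isometry[OF w sp m y] \<eta> by simp
qed

lemma lagrangian_as_graph:
  assumes w: "symplectic_form \<omega>" and sp: "symplectic_splitting \<omega> Vp Vm"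
    and l: "lagrangian \<omega> \<Lambda>" and m: "lagrangian \<omega> \<mu>"
  shows "\<Lambda> = (\<lambda>y. proj Vm \<Lambda> (proj Vp \<mu> y) - proj Vp \<mu> y) ` Vm" (is "_ = ?f ` _")
proof (rule sym, rule vec.subspace_dim_equal)
  note cp = splitting_dim(1)[OF w sp m] and c = splitting_complementary[OF sp]
    and cl = splitting_dim(2)[OF w sp l]
  have Vm: "vec.subspace Vm" "vec.subspace Vp" using complementary_subspaces[OF c] by blast+
  have lf: "lin ?f" by (rule lin_minus[OF lin_compose[OF proj_lin[OF cp] proj_lin[OF cl]] proj_lin[OF cp]])
  show "vec.subspace (?f ` Vm)" by (rule subspace_image[OF lf Vm(1)])
  show "vec.subspace \<Lambda>" by (rule lagrangian_subspace[OF w l])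
  have "?f y \<in> \<Lambda>" for y
    using vec.subspace_neg[OF lagrangian_subspace[OF w l] proj_diff_in[OF cl, of "proj Vp \<mu> y"]] by simp
  then show "?f ` Vm \<subseteq> \<Lambda>" by blast
  have inj: "y = 0" if y: "y \<in> Vm" "?f y = 0" for y
  proof -
    have "proj Vp \<mu> y = 0"
      using splitting_decomposition_unique(2)[OF sp proj_in[OF cp] vec.subspace_0[OF Vm(2)] proj_in[OF cl] vec.subspace_0[OF Vm(1)]]
        y(2) by simp
    then have "\<omega> y y = 0"
      using proj_isometry[OF w sp m y(1) y(1)] sesq_simps(5)[OF symplectic_sesquilinear[OF w]] by simp
    then show ?thesis using splitting_null(2)[OF sp] y(1) by blast
  qed
  show "vec.dim \<Lambda> \<le> vec.dim (?f ` Vm)"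
    using dim_injective_image[OF lf Vm(1) inj] splitting_dim(3)[OF w sp m] lagrangian_dim[OF w l] by simp
qed

lemma relative_unitary_isometry:
  assumes w: "symplectic_form \<omega>" and sp: "symplectic_splitting \<omega> Vp Vm"
    and l: "lagrangian \<omega> \<Lambda>" and m: "lagrangian \<omega> \<mu>"
  shows "definite_isometry Vm (\<lambda>x y. \<i> * \<omega> x y) (\<lambda>y. proj Vm \<Lambda> (proj Vp \<mu> y))"
proof (rule definite_isometry.intro)
  note s = symplectic_sesquilinear[OF w]
  note cp = splitting_dim(1)[OF w sp m] and c = splitting_complementary[OF sp]
    and cl = splitting_dim(2)[OF w sp l]
  show "vec.subspace Vm" using complementary_subspaces[OF c] by blast
  show "sesquilinear (\<lambda>x y. \<i> * \<omega> x y)" using s by (simp add: sesquilinear_def algebra_simps)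
  show "hermitian_on (\<lambda>x y. \<i> * \<omega> x y) Vm"
    unfolding hermitian_on_def by (intro ballI) (subst symplectic_skew[OF w], simp)
  show "pos_def_on (\<lambda>x y. \<i> * \<omega> x y) Vm" using sp unfolding symplectic_splitting_def by blast
  show "lin (\<lambda>y. proj Vm \<Lambda> (proj Vp \<mu> y))" by (rule lin_compose[OF proj_lin[OF cp] proj_lin[OF cl]])
  show "proj Vm \<Lambda> (proj Vp \<mu> x) \<in> Vm" for x by (rule proj_in[OF cl])
  fix x y assume xy: "x \<in> Vm" "y \<in> Vm"
  let ?F = "\<lambda>y. proj Vm \<Lambda> (proj Vp \<mu> y)" and ?W = "proj Vp \<mu>"
  have "\<omega> (?F x - ?W x) (?F y - ?W y) = 0"
    using lagrangian_isotropic[OF l] lagrangian_as_graph[OF w sp l m] xy by blast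
  then have "\<omega> (?F x) (?F y) + \<omega> (?W x) (?W y) = 0"
    using splitting_orthogonal[OF w sp proj_in[OF cp] proj_in[OF cl]] by (simp add: sesq_simps[OF s])
  then show "\<i> * \<omega> (?F x) (?F y) = \<i> * \<omega> x y"
    using proj_isometry[OF w sp m xy] by simp
qed

text \<open>
  A common vector of \<open>\<Lambda>\<close> and the rotated subspace is an eigenvector of the relative unitary for \<open>\<eta>\<close>.
\<close>

lemma rotated_complementary:
  assumes w: "symplectic_form \<omega>" and sp: "symplectic_splitting \<omega> Vp Vm"
    and l: "lagrangian \<omega> \<Lambda>" and m: "lagrangian \<omega> \<mu>" and \<eta>: "\<eta> * cnj \<eta> = 1"
    and ns: "\<eta> \<notin> spectrum_on Vm (relative_unitary Vp Vm \<Lambda> \<mu>)"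
  shows "complementary \<Lambda> (rotated_lagrangian Vp Vm \<mu> \<eta>)"
proof (rule lagrangian_complementary[OF w l rotated_lagrangian[OF w sp m \<eta>]], rule)
  note cp = splitting_dim(1)[OF w sp m] and c = splitting_complementary[OF sp]
    and cl = splitting_dim(2)[OF w sp l]
  have Vm: "vec.subspace Vm" using complementary_subspaces[OF c] by blast
  fix x assume "x \<in> \<Lambda> \<inter> rotated_lagrangian Vp Vm \<mu> \<eta>"
  then have "x \<in> (\<lambda>y. proj Vm \<Lambda> (proj Vp \<mu> y) - proj Vp \<mu> y) ` Vm" "x \<in> (\<lambda>y. \<eta> *s y - proj Vp \<mu> y) ` Vm"
    using lagrangian_as_graph[OF w sp l m] unfolding rotated_lagrangian_def by blast+
  then obtain y y' where y: "y \<in> Vm" "x = proj Vm \<Lambda> (proj Vp \<mu> y) - proj Vp \<mu> y"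
    and y': "y' \<in> Vm" "x = \<eta> *s y' - proj Vp \<mu> y'" by blast
  have e: "proj Vm \<Lambda> (proj Vp \<mu> y) = \<eta> *s y'" "proj Vp \<mu> y = proj Vp \<mu> y'"
    using splitting_decomposition_unique[OF sp proj_in[OF cp] proj_in[OF cp] proj_in[OF cl] vec.subspace_scale[OF Vm y'(1)]]
      y(2) y'(2) by metis+
  have d: "y - y' \<in> Vm" by (rule vec.subspace_diff[OF Vm y(1) y'(1)])
  have "proj Vp \<mu> (y - y') = 0" using e(2) by (simp add: lin_diff[OF proj_lin[OF cp]])
  then have "\<omega> (y - y') (y - y') = 0"
    using proj_isometry[OF w sp m d d] sesq_simps(5)[OF symplectic_sesquilinear[OF w]] by simp
  then have "y = y'" using splitting_null(2)[OF sp _ d] by simp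
  then have "relative_unitary Vp Vm \<Lambda> \<mu> y = \<eta> *s y"
    using e(1) relative_unitary_eq[OF w sp l m y(1)] by simp
  then have "y = 0" using ns y(1) unfolding spectrum_on_def by blast
  then show "x \<in> {0}" using y(2) lin_0[OF proj_lin[OF cp]] lin_0[OF proj_lin[OF cl]] by simp
qed

lemma rotated_complementary_self:
  assumes w: "symplectic_form \<omega>" and sp: "symplectic_splitting \<omega> Vp Vm"
    and m: "lagrangian \<omega> \<mu>" and \<eta>: "\<eta> * cnj \<eta> = 1" "\<eta> \<noteq> 1"
  shows "complementary \<mu> (rotated_lagrangian Vp Vm \<mu> \<eta>)"
proof (rule rotated_complementary[OF w sp m m \<eta>(1)])
  note cp = splitting_dim(1)[OF w sp m] and cm = splitting_dim(2)[OF w sp m]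
  show "\<eta> \<notin> spectrum_on Vm (relative_unitary Vp Vm \<mu> \<mu>)"
  proof
    assume "\<eta> \<in> spectrum_on Vm (relative_unitary Vp Vm \<mu> \<mu>)"
    then obtain y where y: "y \<in> Vm" "y \<noteq> 0" "relative_unitary Vp Vm \<mu> \<mu> y = \<eta> *s y"
      unfolding spectrum_on_def by blast
    have "proj Vm \<mu> (proj Vp \<mu> y) = y"
    proof (rule proj_unique[OF cm y(1)])
      show "proj Vp \<mu> y - y \<in> \<mu>"
        using vec.subspace_neg[OF lagrangian_subspace[OF w m] proj_diff_in[OF cp, of y]] by simp
    qed
    then have "y = \<eta> *s y" using y(3) relative_unitary_eq[OF w sp m m y(1)] by simp
    then have "(\<eta> - 1) *s y = 0" by (simp add: vec.scale_left_diff_distrib)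
    then have "\<eta> - 1 = 0 \<or> y = 0" by (simp only: vec.scale_eq_0_iff)
    then show False using y(2) \<eta>(2) by simp
  qed
qed

subsection \<open>The sign of the form on an eigenvector\<close>

lemma cis_diff: "cis a - cis b = 2 * \<i> * complex_of_real (sin ((a - b) / 2)) * cis ((a + b) / 2)"
proof -
  have "cis (s + d) - cis (s - d) = 2 * \<i> * complex_of_real (sin d) * cis s" for s d
    by (simp add: complex_eq_iff cos_add sin_add cos_diff sin_diff)
  moreover have "(a + b) / 2 + (a - b) / 2 = a" "(a + b) / 2 - (a - b) / 2 = b"
    by (simp_all add: field_simps)
  ultimately show ?thesis by metis
qed

text \<open>
  The left-hand side is the factor by which \<open>pform\<close> differs from the definite form on an
  eigenvector for \<open>cis \<theta>\<close>. Each difference of two unit numbers is a half-angle sine times a phase, and the phases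
  cancel.
\<close>

lemma eigenvector_weight:
  assumes e: "0 < \<epsilon>" "\<epsilon> < pi"
  shows "- \<i> * (cis (- \<epsilon>) - cis \<theta>) * (cnj (cis \<theta>) - 1) / (cis (- \<epsilon>) - 1) =
    complex_of_real (- 2 * sin ((\<epsilon> + \<theta>) / 2) * sin (\<theta> / 2) / sin (\<epsilon> / 2))"
proof -
  have s: "sin (\<epsilon> / 2) > 0" using e by (intro sin_gt_zero) auto
  have 1: "cis (- \<epsilon>) - cis \<theta> = - (2 * \<i> * complex_of_real (sin ((\<epsilon> + \<theta>) / 2)) * cis ((\<theta> - \<epsilon>) / 2))"
  proof -
    have "sin ((- \<epsilon> - \<theta>) / 2) = - sin ((\<epsilon> + \<theta>) / 2)"
    proof -
      have "(- \<epsilon> - \<theta>) / 2 = - ((\<epsilon> + \<theta>) / 2)" by (simp add: field_simps)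
      then show ?thesis by (simp only: sin_minus)
    qed
    then show ?thesis using cis_diff[of "- \<epsilon>" \<theta>] by simp
  qed
  have 2: "cnj (cis \<theta>) - 1 = - (2 * \<i> * complex_of_real (sin (\<theta> / 2)) * cis (- \<theta> / 2))"
    using cis_diff[of "- \<theta>" 0] by (simp add: cis_cnj)
  have 3: "cis (- \<epsilon>) - 1 = - (2 * \<i> * complex_of_real (sin (\<epsilon> / 2)) * cis (- \<epsilon> / 2))"
    using cis_diff[of "- \<epsilon>" 0] by simp
  have m: "cis ((\<theta> - \<epsilon>) / 2) * cis (- \<theta> / 2) = cis (- \<epsilon> / 2)"
    unfolding cis_mult by (simp add: diff_divide_distrib)
  have "- \<i> * (cis (- \<epsilon>) - cis \<theta>) * (cnj (cis \<theta>) - 1) / (cis (- \<epsilon>) - 1) =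
      - 2 * complex_of_real (sin ((\<epsilon> + \<theta>) / 2)) * complex_of_real (sin (\<theta> / 2)) *
      (cis ((\<theta> - \<epsilon>) / 2) * cis (- \<theta> / 2)) / (complex_of_real (sin (\<epsilon> / 2)) * cis (- \<epsilon> / 2))"
    unfolding 1 2 3 using s by (simp add: field_simps)
  also have "\<dots> = complex_of_real (- 2 * sin ((\<epsilon> + \<theta>) / 2) * sin (\<theta> / 2) / sin (\<epsilon> / 2))"
    unfolding m using s by (simp add: field_simps)
  finally show ?thesis .
qed

text \<open>
  An angle in \<open>(-\<epsilon>, 0)\<close> makes the two sines have opposite signs. Any other eigenvalue has an angle in
  \<open>[0, 2 * pi - \<epsilon>)\<close>, for which both sines are nonnegative.
\<close>

lemma unit_weight:
  assumes e: "0 < \<epsilon>" "\<epsilon> < pi" and z: "z * cnj z = 1" "z \<noteq> cis (- \<epsilon>)"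
  obtains k where "- \<i> * (cis (- \<epsilon>) - z) * (cnj z - 1) / (cis (- \<epsilon>) - 1) = complex_of_real k"
    "0 < k \<longleftrightarrow> z \<in> {cis \<theta> | \<theta>. - \<epsilon> \<le> \<theta> \<and> \<theta> < 0}"
proof -
  have s: "sin (\<epsilon> / 2) > 0" using e by (intro sin_gt_zero) auto
  define K where "K \<theta> = - 2 * sin ((\<epsilon> + \<theta>) / 2) * sin (\<theta> / 2) / sin (\<epsilon> / 2)" for \<theta>
  have K: "- \<i> * (cis (- \<epsilon>) - z) * (cnj z - 1) / (cis (- \<epsilon>) - 1) = complex_of_real (K \<theta>)" if "z = cis \<theta>" for \<theta>
    unfolding K_def that by (rule eigenvector_weight[OF e])
  have "complex_of_real ((cmod z)\<^sup>2) = 1" by (simp only: complex_norm_square z(1))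
  then have "(cmod z)\<^sup>2 = 1" by (simp only: of_real_eq_1_iff)
  then have "cmod z = 1" by (simp only: abs_square_eq_1 abs_norm_cancel)
  then have zt: "z = cis (Arg2pi z)" using Arg2pi_eq[of z] by (simp add: cis_conv_exp)
  show thesis
  proof (cases "z \<in> {cis \<theta> | \<theta>. - \<epsilon> \<le> \<theta> \<and> \<theta> < 0}")
    case True
    then obtain \<theta> where t: "z = cis \<theta>" "- \<epsilon> \<le> \<theta>" "\<theta> < 0" by blast
    then have "- \<epsilon> < \<theta>" using z(2) by (cases "\<theta> = - \<epsilon>") auto
    then have "0 < sin ((\<epsilon> + \<theta>) / 2)" using t e by (intro sin_gt_zero) auto
    moreover have "0 < sin (- (\<theta> / 2))" using t e by (intro sin_gt_zero) auto
    then have "sin (\<theta> / 2) < 0" by simp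
    ultimately have "0 < K \<theta>" unfolding K_def using s by (simp add: mult_pos_neg divide_neg_pos)
    then show thesis using that[OF K[OF t(1)]] True by blast
  next
    case False
    define \<theta> where "\<theta> = Arg2pi z"
    have t: "0 \<le> \<theta>" "\<theta> < 2 * pi" "z = cis \<theta>"
      using zt Arg2pi_ge_0[of z] Arg2pi_lt_2pi[of z] unfolding \<theta>_def by auto
    have "\<theta> < 2 * pi - \<epsilon>"
    proof (rule ccontr)
      assume "\<not> \<theta> < 2 * pi - \<epsilon>"
      moreover have "z = cis (\<theta> - 2 * pi)" using t(3) by (simp flip: cis_divide)
      ultimately show False using False t(2) by fastforce
    qed
    then have "0 \<le> sin ((\<epsilon> + \<theta>) / 2)" "0 \<le> sin (\<theta> / 2)"
      using t e by (auto intro!: sin_ge_zero)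
    then have "\<not> 0 < K \<theta>" unfolding K_def using s by (simp add: not_less)
    then show thesis using that[OF K[OF t(3)]] False by blast
  qed
qed

text \<open>
  The subspace \<open>\<Lambda>\<close> is parametrized by \<open>y \<mapsto> F y + W y\<close> over \<open>Vm\<close>, where \<open>F\<close> is the relative unitary and
  \<open>W\<close> the inverse of the map with graph \<open>\<mu>\<close>. In this parametrization the form of \<open>\<Lambda>\<close> relative to \<open>\<mu>\<close> and
  the rotated subspace is diagonal in the eigenvectors of \<open>F\<close>, with the weights computed above.
\<close>

theorem eig_count_eq_morse_pos:
  assumes w: "symplectic_form \<omega>" and sp: "symplectic_splitting \<omega> Vp Vm"
    and l: "lagrangian \<omega> \<Lambda>" and m: "lagrangian \<omega> \<mu>" and e: "0 < \<epsilon>" "\<epsilon> < pi"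
    and ns: "cis (- \<epsilon>) \<notin> spectrum_on Vm (relative_unitary Vp Vm \<Lambda> \<mu>)"
  shows "eig_count Vm (relative_unitary Vp Vm \<Lambda> \<mu>) \<epsilon> =
    morse_pos (pform \<omega> \<mu> (rotated_lagrangian Vp Vm \<mu> (cis (- \<epsilon>)))) \<Lambda>"
proof -
  note s = symplectic_sesquilinear[OF w]
  note cp = splitting_dim(1)[OF w sp m] and c = splitting_complementary[OF sp]
    and cl = splitting_dim(2)[OF w sp l]
  have Vm: "vec.subspace Vm" using complementary_subspaces[OF c] by blast
  define \<eta> where "\<eta> = cis (- \<epsilon>)"
  have \<eta>: "\<eta> * cnj \<eta> = 1" "\<eta> \<noteq> 1"
  proof -
    show "\<eta> * cnj \<eta> = 1" by (simp add: \<eta>_def cis_cnj cis_mult)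
    have "sin \<epsilon> > 0" using e by (rule sin_gt_zero)
    then show "\<eta> \<noteq> 1" by (auto simp: \<eta>_def complex_eq_iff)
  qed
  define \<rho> where "\<rho> = rotated_lagrangian Vp Vm \<mu> \<eta>"
  have r: "lagrangian \<omega> \<rho>" unfolding \<rho>_def by (rule rotated_lagrangian[OF w sp m \<eta>(1)])
  have mr: "complementary \<mu> \<rho>" unfolding \<rho>_def by (rule rotated_complementary_self[OF w sp m \<eta>])
  define W where "W y = - proj Vp \<mu> y" for y
  define F where "F y = proj Vm \<Lambda> (proj Vp \<mu> y)" for y
  have linF: "lin F" unfolding F_def by (rule lin_compose[OF proj_lin[OF cp] proj_lin[OF cl]])
  have linW: "lin W" unfolding W_def
    by (rule linI) (simp add: lin_simps[OF proj_lin[OF cp]])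
  have FV: "F y \<in> Vm" for y unfolding F_def by (rule proj_in[OF cl])
  have WV: "W y \<in> Vp" for y
    unfolding W_def by (rule vec.subspace_neg[OF complementary_subspaces(1)[OF c] proj_in[OF cp]])
  have WW: "\<omega> (W y) (W y') = - \<omega> y y'" if "y \<in> Vm" "y' \<in> Vm" for y y'
    unfolding W_def using proj_isometry[OF w sp m that] by (simp add: sesq_simps[OF s])
  have \<Lambda>: "\<Lambda> = (\<lambda>y. F y + W y) ` Vm"
    using lagrangian_as_graph[OF w sp l m] by (simp add: F_def W_def)
  have orth: "\<omega> (W y) y' = 0" "\<omega> y' (W y) = 0" if "y' \<in> Vm" for y y'
    using splitting_orthogonal[OF w sp WV that] by auto
  define h where "h x y = \<i> * \<omega> x y" for x y
  interpret definite_isometry Vm h F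
    unfolding h_def[abs_def] F_def[abs_def] by (rule relative_unitary_isometry[OF w sp l m])
  have RU: "relative_unitary Vp Vm \<Lambda> \<mu> y = F y" if "y \<in> Vm" for y
    unfolding F_def by (rule relative_unitary_eq[OF w sp l m that])
  have spec: "spectrum_on Vm (relative_unitary Vp Vm \<Lambda> \<mu>) = spectrum_on Vm F"
    by (rule spectrum_on_cong[OF RU])
  have mult: "multiplicity_on Vm (relative_unitary Vp Vm \<Lambda> \<mu>) z = vec.dim (eigenspace z)" for z
    using multiplicity_on_cong[OF Vm RU FV] generalized_eigenspace by simp
  define Q where "Q y y' = pform \<omega> \<mu> \<rho> (F y + W y) (F y' + W y')" for y y'
  have linG: "lin (\<lambda>y. F y + W y)" by (rule lin_plus[OF linF linW])
  have Qs: "sesquilinear Q"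
    unfolding Q_def by (rule sesquilinear_compose[OF sesquilinear_pform[OF w mr] linG linG])
  have Qh: "hermitian_on Q Vm"
    unfolding hermitian_on_def Q_def
    using hermitianD[OF pform_hermitian[OF w mr m r l]] unfolding \<Lambda> by blast
  have Qval: "Q y y' = - \<i> * ((\<eta> - z) * (cnj z' - 1) / (\<eta> - 1)) * h y y'"
    if y: "y \<in> eigenspace z" and y': "y' \<in> eigenspace z'" for y y' z z'
  proof -
    have V: "y \<in> Vm" "y' \<in> Vm" "F y = z *s y" "F y' = z' *s y'" using y y' by (auto simp: eigenspace_def)
    have P: "proj \<mu> \<rho> (F u + W u) = ((\<eta> - a) / (\<eta> - 1)) *s (u + W u) \<and>
        proj \<rho> \<mu> (F u + W u) = ((a - 1) / (\<eta> - 1)) *s (\<eta> *s u + W u)" if u: "u \<in> Vm" "F u = a *s u" for u a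
    proof -
      have 1: "(\<eta> - a) / (\<eta> - 1) + (a - 1) / (\<eta> - 1) = 1" "(\<eta> - a) / (\<eta> - 1) + (a - 1) / (\<eta> - 1) * \<eta> = a"
      proof -
        have n: "(\<eta> - a) + (a - 1) * \<eta> = a * (\<eta> - 1)" by (simp add: algebra_simps)
        have "(\<eta> - a) / (\<eta> - 1) + (a - 1) / (\<eta> - 1) = ((\<eta> - a) + (a - 1)) / (\<eta> - 1)"
          by (simp only: add_divide_distrib)
        then show "(\<eta> - a) / (\<eta> - 1) + (a - 1) / (\<eta> - 1) = 1" using \<eta>(2) by simp
        have "(\<eta> - a) / (\<eta> - 1) + (a - 1) / (\<eta> - 1) * \<eta> = ((\<eta> - a) + (a - 1) * \<eta>) / (\<eta> - 1)"
          by (simp add: add_divide_distrib)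
        then show "(\<eta> - a) / (\<eta> - 1) + (a - 1) / (\<eta> - 1) * \<eta> = a" unfolding n using \<eta>(2) by simp
      qed
      let ?m = "((\<eta> - a) / (\<eta> - 1)) *s (u + W u)" and ?r = "((a - 1) / (\<eta> - 1)) *s (\<eta> *s u + W u)"
      have "?m + ?r = ((\<eta> - a) / (\<eta> - 1) + (a - 1) / (\<eta> - 1) * \<eta>) *s u + ((\<eta> - a) / (\<eta> - 1) + (a - 1) / (\<eta> - 1)) *s W u"
        by (simp only: vec.scale_right_distrib vec.scale_left_distrib vec.scale_scale add_ac)
      then have sum: "F u + W u = ?m + ?r" unfolding 1 u(2) by simp
      have "u + W u \<in> \<mu>" using proj_diff_in[OF cp, of u] by (simp add: W_def)
      then have "?m \<in> \<mu>" by (rule vec.subspace_scale[OF lagrangian_subspace[OF w m]])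
      moreover have "\<eta> *s u + W u \<in> \<rho>"
        unfolding \<rho>_def rotated_lagrangian_def W_def using u(1) by (intro image_eqI[of _ _ u]) auto
      then have "?r \<in> \<rho>" by (rule vec.subspace_scale[OF lagrangian_subspace[OF w r]])
      ultimately have "proj \<mu> \<rho> (F u + W u) = ?m" by (intro proj_unique[OF mr]) (simp_all add: sum)
      then show ?thesis by (simp add: proj_swap[OF mr] sum)
    qed
    let ?b = "(z' - 1) / (\<eta> - 1)"
    have "Q y y' = ((\<eta> - z) / (\<eta> - 1)) * cnj ?b * \<omega> (y + W y) (\<eta> *s y' + W y')"
      unfolding Q_def pform_def P[OF V(1,3), THEN conjunct1] P[OF V(2,4), THEN conjunct2]
        sesq_simps(2)[OF s] sesq_simps(4)[OF s] by (simp only: mult_ac)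
    also have "\<omega> (y + W y) (\<eta> *s y' + W y') = (cnj \<eta> - 1) * \<omega> y y'"
      using orth[OF V(1)] orth[OF V(2)] WW[OF V(1,2)] by (simp add: sesq_simps[OF s] algebra_simps)
    also have "cnj ?b = (cnj z' - 1) / (cnj \<eta> - 1)" by simp
    finally have "Q y y' = (\<eta> - z) / (\<eta> - 1) * ((cnj z' - 1) / (cnj \<eta> - 1)) * ((cnj \<eta> - 1) * \<omega> y y')" .
    moreover have "cnj \<eta> - 1 \<noteq> 0" using \<eta>(2) complex_cnj_cancel_iff[of \<eta> 1] by simp
    ultimately have Qe: "Q y y' = (\<eta> - z) * (cnj z' - 1) / (\<eta> - 1) * \<omega> y y'" by simp
    have ii: "- \<i> * a * (\<i> * b) = a * b" for a b by (simp add: complex_eq_iff)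
    show ?thesis unfolding h_def ii by (rule Qe)
  qed
  have wt: "\<exists>k. - \<i> * (\<eta> - z) * (cnj z - 1) / (\<eta> - 1) = complex_of_real k \<and>
      (0 < k \<longleftrightarrow> z \<in> {cis \<theta> | \<theta>. - \<epsilon> \<le> \<theta> \<and> \<theta> < 0})" if z: "z \<in> spectrum_on Vm F" for z
  proof -
    obtain x where "x \<in> eigenspace z" "x \<noteq> 0" using z unfolding spectrum_on_def eigenspace_def by blast
    then have "z * cnj z = 1" by (rule unit_eigenvalue)
    moreover have "z \<noteq> cis (- \<epsilon>)" using ns z unfolding spec by blast
    ultimately obtain k where "- \<i> * (cis (- \<epsilon>) - z) * (cnj z - 1) / (cis (- \<epsilon>) - 1) = complex_of_real k"
        "0 < k \<longleftrightarrow> z \<in> {cis \<theta> | \<theta>. - \<epsilon> \<le> \<theta> \<and> \<theta> < 0}"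
      using unit_weight[OF e, of z] by blast
    then show ?thesis unfolding \<eta>_def by blast
  qed
  have "\<exists>k. \<forall>z\<in>spectrum_on Vm F. - \<i> * (\<eta> - z) * (cnj z - 1) / (\<eta> - 1) = complex_of_real (k z) \<and>
      (0 < k z \<longleftrightarrow> z \<in> {cis \<theta> | \<theta>. - \<epsilon> \<le> \<theta> \<and> \<theta> < 0})"
    by (rule bchoice, rule ballI, rule wt)
  then obtain k where k: "\<And>z. z \<in> spectrum_on Vm F \<Longrightarrow>
      - \<i> * (\<eta> - z) * (cnj z - 1) / (\<eta> - 1) = complex_of_real (k z) \<and>
      (0 < k z \<longleftrightarrow> z \<in> {cis \<theta> | \<theta>. - \<epsilon> \<le> \<theta> \<and> \<theta> < 0})" by blast
  have "morse_pos Q Vm = (\<Sum>z | z \<in> spectrum_on Vm F \<and> 0 < k z. vec.dim (eigenspace z))"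
  proof (rule morse_pos_spectral[OF Qs Qh])
    show "Q x y = 0" if "x \<in> eigenspace z" "y \<in> eigenspace z'" "z \<noteq> z'" for x y z z'
      using Qval[OF that(1,2)] eigenspace_orthogonal[OF that] by simp
    show "Q x x = complex_of_real (k z) * h x x" if "z \<in> spectrum_on Vm F" "x \<in> eigenspace z" for x z
      unfolding k[OF that(1), THEN conjunct1, symmetric] Qval[OF that(2,2)]
      by (simp only: times_divide_eq_right mult.assoc)
  qed
  also have "{z. z \<in> spectrum_on Vm F \<and> 0 < k z} = spectrum_on Vm F \<inter> {cis \<theta> | \<theta>. - \<epsilon> \<le> \<theta> \<and> \<theta> < 0}"
    using k by blast
  also have "(\<Sum>z \<in> spectrum_on Vm F \<inter> {cis \<theta> | \<theta>. - \<epsilon> \<le> \<theta> \<and> \<theta> < 0}. vec.dim (eigenspace z)) =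
      eig_count Vm (relative_unitary Vp Vm \<Lambda> \<mu>) \<epsilon>"
    unfolding eig_count_def spec mult ..
  finally have "eig_count Vm (relative_unitary Vp Vm \<Lambda> \<mu>) \<epsilon> = morse_pos Q Vm" ..
  moreover have "morse_pos (pform \<omega> \<mu> \<rho>) ((\<lambda>y. F y + W y) ` Vm) = morse_pos Q Vm"
  proof (rule morse_pos_pullback[OF linG Vm])
    fix y assume y: "y \<in> Vm" "F y + W y = 0"
    have "F y - - W y = 0 - 0" using y(2) by simp
    moreover have "- W y \<in> Vp" "0 \<in> Vp" "0 \<in> Vm"
      using WV vec.subspace_neg vec.subspace_0 complementary_subspaces[OF c] by blast+
    ultimately have "W y = 0"
      using splitting_decomposition_unique(2)[OF sp _ _ FV, of "- W y" 0 0 y] by simp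
    then have "\<omega> y y = 0" using WW[OF y(1,1)] sesq_simps(5)[OF s] by simp
    then show "y = 0" using splitting_null(2)[OF sp _ y(1)] by blast
  qed (simp add: Q_def)
  ultimately show ?thesis unfolding \<Lambda>[symmetric] \<rho>_def \<eta>_def by simp
qed

section \<open>The symplectic space of the boundary problem\<close>

subsection \<open>Pairs, inner products and block matrices\<close>

lemma vfst_vpair [simp]: "vfst (vpair x y) = x" and vsnd_vpair [simp]: "vsnd (vpair x y) = y"
  by (simp_all add: vfst_def vsnd_def vpair_def vec_eq_iff)

lemma vpair_eta [simp]: "vpair (vfst z) (vsnd z) = z"
  by (simp add: vfst_def vsnd_def vpair_def vec_eq_iff split: sum.splits)

lemma vpair_eqI: "vfst z = vfst w \<Longrightarrow> vsnd z = vsnd w \<Longrightarrow> z = w"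
  by (metis vpair_eta)

lemma vfst_simps [simp]:
  "vfst (x + y) = vfst x + vfst (y :: complex^('m::finite + 'k::finite))" "vfst (x - y) = vfst x - vfst y"
  "vfst (c *s x) = c *s vfst x" "vfst (- x) = - vfst x" "vfst (0 :: complex^('m + 'k)) = 0"
  by (simp_all add: vfst_def vec_eq_iff)

lemma vsnd_simps [simp]:
  "vsnd (x + y) = vsnd x + vsnd (y :: complex^('m::finite + 'k::finite))" "vsnd (x - y) = vsnd x - vsnd y"
  "vsnd (c *s x) = c *s vsnd x" "vsnd (- x) = - vsnd x" "vsnd (0 :: complex^('m + 'k)) = 0"
  by (simp_all add: vsnd_def vec_eq_iff)

lemma lin_vfst: "lin vfst" and lin_vsnd: "lin vsnd"
  by (rule linI; simp)+

lemma lin_vpair: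
  assumes "lin f" "lin g" shows "lin (\<lambda>x. vpair (f x) (g x))"
  by (rule linI) (intro vpair_eqI; simp add: lin_add[OF assms(1)] lin_add[OF assms(2)] lin_scale[OF assms(1)] lin_scale[OF assms(2)])

lemma lin_mult: "lin ((*v) A)"
  by (rule linI) (simp add: matrix_vector_right_distrib vec.linear_scale[OF matrix_vector_mul_linear_gen])

lemma vpair_0 [simp]: "vpair 0 0 = (0 :: complex^('m::finite + 'k::finite))"
  by (rule vpair_eqI) simp_all

lemma sesquilinear_cinner: "sesquilinear cinner"
  unfolding sesquilinear_def cinner_def
  by (simp add: sum.distrib sum_distrib_left algebra_simps)

lemmas cinner_simps = sesq_simps[OF sesquilinear_cinner]

lemma cnj_cinner: "cnj (cinner x y) = cinner y x"
  by (simp add: cinner_def mult.commute)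

lemma cinner_self: "cinner x x = complex_of_real ((norm x)\<^sup>2)"
proof -
  have "(norm x)\<^sup>2 = (\<Sum>i\<in>UNIV. (cmod (x $ i))\<^sup>2)"
    by (simp add: norm_vec_def L2_set_def sum_nonneg)
  then show ?thesis
    unfolding cinner_def by (simp only: of_real_sum complex_norm_square)
qed

lemma cinner_eq_0: "cinner x x = 0 \<longleftrightarrow> x = 0"
  by (simp add: cinner_self)

lemma cinner_adjoint: "cinner (A *v x) y = cinner x (cadj A *v y)"
proof -
  have "cinner (A *v x) y = (\<Sum>i\<in>UNIV. \<Sum>j\<in>UNIV. A $ i $ j * x $ j * cnj (y $ i))"
    by (simp add: cinner_def matrix_vector_mult_def sum_distrib_right)
  also have "\<dots> = (\<Sum>j\<in>UNIV. \<Sum>i\<in>UNIV. A $ i $ j * x $ j * cnj (y $ i))"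
    by (rule sum.swap)
  also have "\<dots> = cinner x (cadj A *v y)"
    by (simp add: cinner_def matrix_vector_mult_def cadj_def sum_distrib_left mult_ac)
  finally show ?thesis .
qed

lemma cadj_cadj [simp]: "cadj (cadj A) = A"
  by (simp add: cadj_def vec_eq_iff)

lemma cadj_mult: "cadj (A ** B) = cadj B ** cadj A"
  by (simp add: cadj_def matrix_matrix_mult_def vec_eq_iff mult.commute)

lemma sum_UNIV_Plus:
  fixes f :: "'m::finite + 'k::finite \<Rightarrow> 'a::comm_monoid_add"
  shows "(\<Sum>i\<in>UNIV. f i) = (\<Sum>i\<in>UNIV. f (Inl i)) + (\<Sum>i\<in>UNIV. f (Inr i))"
  using sum.Plus[of UNIV UNIV f] by (simp add: UNIV_Plus_UNIV)

lemma cinner_vpair: "cinner x y = cinner (vfst x) (vfst y) + cinner (vsnd x) (vsnd y)"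
  by (simp add: cinner_def sum_UNIV_Plus vfst_def vsnd_def)

lemma norm_vfst_le: "norm (vfst x) \<le> norm x"
  for x :: "complex^('m::finite + 'k::finite)"
proof -
  have "complex_of_real ((norm x)\<^sup>2) = complex_of_real ((norm (vfst x))\<^sup>2 + (norm (vsnd x))\<^sup>2)"
    unfolding of_real_add cinner_self[symmetric] by (rule cinner_vpair)
  then have "(norm x)\<^sup>2 = (norm (vfst x))\<^sup>2 + (norm (vsnd x))\<^sup>2" by (simp only: of_real_eq_iff)
  then have "(norm (vfst x))\<^sup>2 \<le> (norm x)\<^sup>2" by simp
  then show ?thesis by (rule power2_le_imp_le) simp
qed

lemma block_mult:
  "block A B C D *v z = vpair (A *v vfst z + B *v vsnd z) (C *v vfst z + D *v vsnd z)"
proof (rule vpair_eqI)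
  show "vfst (block A B C D *v z) = vfst (vpair (A *v vfst z + B *v vsnd z) (C *v vfst z + D *v vsnd z))"
    "vsnd (block A B C D *v z) = vsnd (vpair (A *v vfst z + B *v vsnd z) (C *v vfst z + D *v vsnd z))"
    by (simp_all add: vec_eq_iff vfst_def vsnd_def block_def vpair_def matrix_vector_mult_def sum_UNIV_Plus)
qed

lemma CARD_plus: "CARD('m::finite + 'k::finite) = CARD('m) + CARD('k)"
  by (subst UNIV_Plus_UNIV[symmetric]) (simp add: card_Plus)

lemma invertible_kernel:
  fixes A :: "complex^'n^'n"
  assumes "invertible A" "A *v x = 0" shows "x = 0"
proof -
  obtain B where "B ** A = mat 1" using assms(1) unfolding invertible_def by blast
  then have "x = B *v (A *v x)" by (simp add: matrix_vector_mul_assoc)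
  then show ?thesis using assms(2) by simp
qed

lemma cadj_mat_1 [simp]: "cadj (mat 1) = mat 1"
  by (auto simp: cadj_def mat_def vec_eq_iff)

lemma invertible_cadj:
  fixes A :: "complex^'n^'n"
  assumes "invertible A" shows "invertible (cadj A)"
proof -
  obtain B where "A ** B = mat 1" "B ** A = mat 1" using assms unfolding invertible_def by blast
  then have "cadj B ** cadj A = mat 1" "cadj A ** cadj B = mat 1" by (simp_all flip: cadj_mult)
  then show ?thesis unfolding invertible_def by blast
qed

lemma dim_Gr: "vec.dim (Gr M) = CARD('n)" and subspace_Gr: "vec.subspace (Gr M)"
  for M :: "complex^'n^'n"
proof -
  have Gr: "Gr M = range (\<lambda>x. vpair x (M *v x))" by (auto simp: Gr_def)
  have l: "lin (\<lambda>x. vpair x (M *v x))" by (rule lin_vpair[OF lin_id lin_mult])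
  show "vec.subspace (Gr M)" unfolding Gr by (rule subspace_image[OF l vec.subspace_UNIV])
  have "x = 0" if "vpair x (M *v x) = 0" for x
    using arg_cong[OF that, of vfst] by simp
  then show "vec.dim (Gr M) = CARD('n)"
    unfolding Gr using dim_injective_image[OF l vec.subspace_UNIV] vec_dim_card[where 'a=complex and 'n='n] by simp
qed

subsection \<open>The boundary pairing\<close>

text \<open>
  The form \<open>(-\<omega>) \<oplus> \<omega>\<close> pairs the positions \<open>(x\<^sub>1, x\<^sub>3)\<close> with the momenta \<open>(x\<^sub>2, x\<^sub>4)\<close> through the
  pairing \<open>bpair\<close>, and \<open>R\<^sup>K\<close> is the annihilator of \<open>R\<close> for this pairing.
\<close>

definition bpair :: "complex^'n^'n \<Rightarrow> complex^('n + 'n) \<Rightarrow> complex^('n + 'n) \<Rightarrow> complex" where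
  "bpair K x y = cinner (K *v vfst x) (vfst y) - cinner (K *v vsnd x) (vsnd y)"

definition pos :: "complex^(('n + 'n) + ('n + 'n)) \<Rightarrow> complex^('n::finite + 'n)" where
  "pos z = vpair (vfst (vfst z)) (vfst (vsnd z))"

definition mom :: "complex^(('n + 'n) + ('n + 'n)) \<Rightarrow> complex^('n::finite + 'n)" where
  "mom z = vpair (vsnd (vfst z)) (vsnd (vsnd z))"

definition phase :: "complex^('n + 'n) \<Rightarrow> complex^('n + 'n) \<Rightarrow> complex^(('n::finite + 'n) + ('n + 'n))" where
  "phase x y = vpair (vpair (vfst x) (vfst y)) (vpair (vsnd x) (vsnd y))"

lemma pos_phase [simp]: "pos (phase x y) = x" and mom_phase [simp]: "mom (phase x y) = y"
  and phase_eta [simp]: "phase (pos z) (mom z) = z"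
  by (simp_all add: pos_def mom_def phase_def)

lemma phase_eqI: "pos z = pos w \<Longrightarrow> mom z = mom w \<Longrightarrow> z = w"
  by (metis phase_eta)

lemma lin_pos: "lin pos" and lin_mom: "lin mom"
  unfolding pos_def[abs_def] mom_def[abs_def]
  by (rule lin_vpair; rule linI; simp)+

lemmas pos_simps = lin_simps[OF lin_pos] and mom_simps = lin_simps[OF lin_mom]

lemma lin_phase:
  assumes "lin f" "lin g" shows "lin (\<lambda>x. phase (f x) (g x))"
  by (rule linI) (intro phase_eqI; simp add: pos_simps mom_simps lin_add[OF assms(1)] lin_add[OF assms(2)]
      lin_scale[OF assms(1)] lin_scale[OF assms(2)])

lemma phase_0 [simp]: "phase 0 0 = 0"
  by (rule phase_eqI) (simp_all add: pos_simps mom_simps)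

lemma sesquilinear_bpair: "sesquilinear (bpair K)"
  unfolding sesquilinear_def bpair_def
  by (simp add: cinner_simps lin_simps[OF lin_mult] algebra_simps)

lemmas bpair_simps = sesq_simps[OF sesquilinear_bpair]

lemma sesquilinear_bpair_flip: "sesquilinear (\<lambda>y x. cnj (bpair K x y))"
  unfolding sesquilinear_def by (simp add: bpair_simps)

lemma bpair_nondegenerate_left:
  assumes "invertible K" "\<And>y. bpair K x y = 0" shows "x = 0"
proof -
  have "bpair K x (vpair (K *v vfst x) 0) = 0" "bpair K x (vpair 0 (K *v vsnd x)) = 0"
    using assms(2) by blast+
  then have "K *v vfst x = 0" "K *v vsnd x = 0" by (simp_all add: bpair_def cinner_simps cinner_eq_0)
  then have "vfst x = 0" "vsnd x = 0" using invertible_kernel[OF assms(1)] by blast+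
  then show ?thesis by (intro vpair_eqI) simp_all
qed

lemma bpair_nondegenerate_right:
  assumes "invertible K" "\<And>x. bpair K x y = 0" shows "y = 0"
proof -
  have "bpair K (vpair (cadj K *v vfst y) 0) y = 0" "bpair K (vpair 0 (cadj K *v vsnd y)) y = 0"
    using assms(2) by blast+
  then have "cadj K *v vfst y = 0" "cadj K *v vsnd y = 0"
    by (simp_all add: bpair_def cinner_adjoint[of K] cinner_simps cinner_eq_0 lin_0[OF lin_mult])
  then have "vfst y = 0" "vsnd y = 0" using invertible_kernel[OF invertible_cadj[OF assms(1)]] by blast+
  then show ?thesis by (intro vpair_eqI) simp_all
qed

abbreviation omegaW :: "complex^'n^'n \<Rightarrow> complex^(('n + 'n) + ('n + 'n)) \<Rightarrow> complex^(('n + 'n) + ('n + 'n)) \<Rightarrow> complex" where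
  "omegaW K \<equiv> double_form (omegaK K)"

text \<open>
  Positions and momenta each span an isotropic subspace, and the form only sees their pairing.
\<close>

lemma omegaW_eq: "omegaW K z w = cnj (bpair K (pos w) (mom z)) - bpair K (pos z) (mom w)"
proof -
  have J: "JK K *v x = vpair (- (cadj K *v vsnd x)) (K *v vfst x)" for x
  proof -
    have "(- cadj K) *v y = - (cadj K *v y)" for y
      by (simp add: matrix_vector_mult_def vec_eq_iff sum_negf)
    then show ?thesis unfolding JK_def block_mult by simp
  qed
  have o: "omegaK K x y = cinner (K *v vfst x) (vsnd y) - cinner (vsnd x) (K *v vfst y)" for x y
    unfolding omegaK_def J cinner_vpair[of "vpair _ _"] by (simp add: cinner_simps cinner_adjoint)
  show ?thesis
    unfolding double_form_def o bpair_def pos_def mom_def by (simp add: cnj_cinner)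
qed

lemma symplectic_omegaW:
  assumes K: "invertible K" shows "symplectic_form (omegaW K)"
  unfolding symplectic_form_def
proof (intro conjI allI impI)
  show "omegaW K (c *s x + y) z = c * omegaW K x z + omegaW K y z" for c x y z
    by (simp add: omegaW_eq pos_simps mom_simps bpair_simps algebra_simps)
  show "omegaW K y x = - cnj (omegaW K x y)" for x y
    by (simp add: omegaW_eq)
  fix z assume z: "\<forall>w. omegaW K z w = 0"
  have "bpair K (pos z) y = 0" for y
    using spec[OF z, of "phase 0 y"] by (simp add: omegaW_eq bpair_simps)
  then have 1: "pos z = 0" by (rule bpair_nondegenerate_left[OF K])
  have "bpair K x (mom z) = 0" for x
    using spec[OF z, of "phase x 0"] by (simp add: omegaW_eq bpair_simps)
  then have "mom z = 0" by (rule bpair_nondegenerate_right[OF K])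
  with 1 show "z = 0" by (intro phase_eqI) (simp_all add: pos_simps mom_simps)
qed

lemma dim_left_annihilator:
  fixes U :: "(complex^('n::finite + 'n)) set"
  assumes "invertible K" "vec.subspace U"
  shows "vec.dim U + vec.dim (form_perp (bpair K) UNIV U) = 2 * CARD('n)"
proof -
  have "vec.dim U + vec.dim (form_perp (bpair K) UNIV U) = CARD('n + 'n)"
    by (rule dim_perp_nondegenerate[OF sesquilinear_bpair _ assms(2)])
      (use bpair_nondegenerate_left[OF assms(1)] in blast)
  then show ?thesis by (simp add: CARD_plus)
qed

definition rperp :: "complex^'n^'n \<Rightarrow> (complex^('n + 'n)) set \<Rightarrow> (complex^('n::finite + 'n)) set" where
  "rperp K = form_perp (\<lambda>y x. cnj (bpair K x y)) UNIV"

lemma rperp_iff: "y \<in> rperp K U \<longleftrightarrow> (\<forall>x\<in>U. bpair K x y = 0)"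
  by (simp add: rperp_def form_perp_def)

lemma subspace_rperp: "vec.subspace (rperp K U)"
  unfolding rperp_def by (rule subspace_form_perp[OF sesquilinear_bpair_flip vec.subspace_UNIV])

lemma dim_right_annihilator:
  fixes U :: "(complex^('n::finite + 'n)) set"
  assumes "invertible K" "vec.subspace U"
  shows "vec.dim U + vec.dim (rperp K U) = 2 * CARD('n)"
proof -
  have "vec.dim U + vec.dim (rperp K U) = CARD('n + 'n)"
    unfolding rperp_def
    by (rule dim_perp_nondegenerate[OF sesquilinear_bpair_flip _ assms(2)])
      (use bpair_nondegenerate_right[OF assms(1)] in auto)
  then show ?thesis by (simp add: CARD_plus)
qed

lemma RK_eq: "RK K R = form_perp (bpair K) UNIV R"
proof (intro set_eqI iffI)
  fix x assume "x \<in> RK K R"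
  then obtain x1 x2 where x: "x = vpair x1 x2"
    "\<forall>y1 y2. vpair y1 y2 \<in> R \<longrightarrow> cinner (K *v x1) y1 - cinner (K *v x2) y2 = 0"
    unfolding RK_def by blast
  have "bpair K x y = 0" if "y \<in> R" for y
    using x(2)[rule_format, of "vfst y" "vsnd y"] that by (simp add: bpair_def x(1))
  then show "x \<in> form_perp (bpair K) UNIV R" by (simp add: form_perp_def)
next
  fix x assume "x \<in> form_perp (bpair K) UNIV R"
  then have x: "\<forall>y\<in>R. bpair K x y = 0" by (simp add: form_perp_def)
  show "x \<in> RK K R"
    unfolding RK_def
  proof (intro CollectI exI conjI allI impI)
    show "x = vpair (vfst x) (vsnd x)" by simp
    fix y1 y2 assume "vpair y1 y2 \<in> R"
    then show "cinner (K *v vfst x) y1 - cinner (K *v vsnd x) y2 = 0"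
      using x by (force simp: bpair_def)
  qed
qed

lemma RK_annihilates: "x \<in> RK K R \<Longrightarrow> y \<in> R \<Longrightarrow> bpair K x y = 0"
  by (simp add: RK_eq form_perp_def)

lemma subspace_RK: "vec.subspace (RK K R)"
  unfolding RK_eq by (rule subspace_form_perp[OF sesquilinear_bpair vec.subspace_UNIV])

lemma dim_RK:
  fixes K :: "complex^'n^'n"
  shows "invertible K \<Longrightarrow> vec.subspace R \<Longrightarrow> vec.dim R + vec.dim (RK K R) = 2 * CARD('n)"
  unfolding RK_eq by (rule dim_left_annihilator)

lemma WK_iff: "z \<in> WK K R \<longleftrightarrow> pos z \<in> RK K R \<and> mom z \<in> R"
proof
  assume "z \<in> WK K R"
  then show "pos z \<in> RK K R \<and> mom z \<in> R" by (auto simp: WK_def pos_def mom_def)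
next
  assume "pos z \<in> RK K R \<and> mom z \<in> R"
  then show "z \<in> WK K R"
    unfolding WK_def pos_def mom_def
    by (intro CollectI exI[of _ "vfst (vfst z)"] exI[of _ "vsnd (vfst z)"]
        exI[of _ "vfst (vsnd z)"] exI[of _ "vsnd (vsnd z)"]) simp
qed

lemma CARD_phase: "CARD(('n + 'n) + ('n + 'n)) = 4 * CARD('n::finite)"
  by (simp add: CARD_plus)

lemma WK_lagrangian:
  fixes K :: "complex^'n^'n"
  assumes K: "invertible K" and R: "vec.subspace R"
  shows "lagrangian (omegaW K) (WK K R)"
proof (rule isotropic_lagrangian[OF symplectic_omegaW[OF K]])
  show sub: "vec.subspace (WK K R)"
    using subspace_RK[of K R] R
    by (auto intro!: vec.subspaceI simp: WK_iff pos_simps mom_simps vec.subspace_0 vec.subspace_add vec.subspace_scale)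
  show "omegaW K x y = 0" if "x \<in> WK K R" "y \<in> WK K R" for x y
    using that RK_annihilates[of _ K R] by (simp add: omegaW_eq WK_iff)
  let ?f = "\<lambda>x. phase x 0" and ?g = "phase 0"
  have lin: "lin ?f" "lin ?g"
    using lin_phase[OF lin_id linI[of "\<lambda>x. 0"]] lin_phase[OF linI[of "\<lambda>x. 0"] lin_id] by simp_all
  have inj: "x = 0" if "phase x 0 = 0 \<or> phase 0 x = 0" for x :: "complex^('n::finite + 'n)"
    using that pos_phase mom_phase lin_0[OF lin_pos] lin_0[OF lin_mom] by metis
  have dims: "vec.dim (?f ` RK K R) = vec.dim (RK K R)" "vec.dim (?g ` R) = vec.dim R"
    using dim_injective_image[OF lin(1) subspace_RK] dim_injective_image[OF lin(2) R] inj by blast+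
  have "WK K R = {x + y |x y. x \<in> ?f ` RK K R \<and> y \<in> ?g ` R}"
  proof (intro set_eqI iffI)
    fix z assume z: "z \<in> WK K R"
    have "z = phase (pos z) 0 + phase 0 (mom z)"
      by (rule phase_eqI) (simp_all add: pos_simps mom_simps)
    then show "z \<in> {x + y |x y. x \<in> ?f ` RK K R \<and> y \<in> ?g ` R}" using z unfolding WK_iff by blast
  next
    fix z assume "z \<in> {x + y |x y. x \<in> ?f ` RK K R \<and> y \<in> ?g ` R}"
    then show "z \<in> WK K R" unfolding WK_iff by (auto simp: pos_simps mom_simps)
  qed
  moreover have "?f ` RK K R \<inter> ?g ` R \<subseteq> {0}"
  proof
    fix z assume "z \<in> ?f ` RK K R \<inter> ?g ` R"
    then obtain x y where "z = phase x 0" "z = phase 0 y" by blast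
    then have "pos z = 0" "mom z = 0" by (metis pos_phase, metis mom_phase)
    then show "z \<in> {0}" using phase_eta[of z] by simp
  qed
  ultimately have "vec.dim (WK K R) = vec.dim (RK K R) + vec.dim R"
    using dim_direct_sum[OF subspace_image[OF lin(1) subspace_RK] subspace_image[OF lin(2) R]] dims by simp
  then show "2 * vec.dim (WK K R) = CARD(('n + 'n) + ('n + 'n))"
    using dim_RK[OF K R] by (simp add: CARD_phase)
qed

subsection \<open>The Lagrangian transversal to the whole path\<close>

text \<open>
  Under the identification of momenta with positions by \<open>bpair\<close> and the inner product, these are the
  points whose momentum is \<open>\<kappa>\<close> times their position.
\<close>

definition rho_kappa :: "complex^'n^'n \<Rightarrow> real \<Rightarrow> (complex^(('n + 'n) + ('n::finite + 'n))) set" where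
  "rho_kappa K \<kappa> = {z. \<forall>x. bpair K x (mom z) = complex_of_real \<kappa> * cinner x (pos z)}"

lemma rho_kappaD: "z \<in> rho_kappa K \<kappa> \<Longrightarrow> bpair K x (mom z) = complex_of_real \<kappa> * cinner x (pos z)"
  by (simp add: rho_kappa_def)

lemma rho_kappa_lagrangian:
  fixes K :: "complex^'n^'n"
  assumes K: "invertible K"
  shows "lagrangian (omegaW K) (rho_kappa K \<kappa>)"
proof (rule isotropic_lagrangian[OF symplectic_omegaW[OF K]])
  show "vec.subspace (rho_kappa K \<kappa>)"
    by (auto intro!: vec.subspaceI simp: rho_kappa_def pos_simps mom_simps bpair_simps cinner_simps algebra_simps)
  show "omegaW K z w = 0" if "z \<in> rho_kappa K \<kappa>" "w \<in> rho_kappa K \<kappa>" for z w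
    using that by (simp add: omegaW_eq rho_kappaD cnj_cinner)
  obtain B where B: "cadj K ** B = mat 1"
    using invertible_cadj[OF K] unfolding invertible_def by blast
  let ?J = "\<lambda>x. complex_of_real \<kappa> *s vpair (B *v vfst x) (- (B *v vsnd x))"
  have linJ: "lin ?J"
    by (rule linI, rule vpair_eqI)
      (simp_all add: lin_simps[OF lin_mult] vec.scale_right_distrib mult.commute algebra_simps)
  have J: "bpair K x (?J y) = complex_of_real \<kappa> * cinner x y" for x y
  proof -
    have "cadj K *v (B *v u) = u" for u using B by (simp add: matrix_vector_mul_assoc)
    then show ?thesis
      by (simp add: bpair_def cinner_adjoint cinner_simps cinner_vpair[of x y] lin_simps[OF lin_mult] algebra_simps)
  qed
  have "rho_kappa K \<kappa> = range (\<lambda>x. phase x (?J x))"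
  proof (intro set_eqI iffI)
    fix z assume z: "z \<in> rho_kappa K \<kappa>"
    have "bpair K x (mom z - ?J (pos z)) = 0" for x
      using J[of x "pos z"] rho_kappaD[OF z, of x] by (simp only: bpair_simps) simp
    then have "mom z - ?J (pos z) = 0" by (rule bpair_nondegenerate_right[OF K])
    then have "z = phase (pos z) (?J (pos z))" by (intro phase_eqI) simp_all
    then show "z \<in> range (\<lambda>x. phase x (?J x))" by blast
  next
    fix z assume "z \<in> range (\<lambda>x. phase x (?J x))"
    then show "z \<in> rho_kappa K \<kappa>" unfolding rho_kappa_def using J by auto
  qed
  moreover have "x = 0" if "phase x (?J x) = 0" for x
    using arg_cong[OF that, of pos] by (simp add: pos_simps)
  ultimately have "vec.dim (rho_kappa K \<kappa>) = vec.dim (UNIV :: (complex^('n + 'n)) set)"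
    using dim_injective_image[OF lin_phase[OF lin_id linJ] vec.subspace_UNIV] by simp
  then show "2 * vec.dim (rho_kappa K \<kappa>) = CARD(('n + 'n) + ('n + 'n))"
    by (simp only: vec_dim_card) (simp add: CARD_plus)
qed

lemma WK_rho_kappa:
  assumes K: "invertible K" and R: "vec.subspace R" and k: "\<kappa> \<noteq> 0"
  shows "complementary (WK K R) (rho_kappa K \<kappa>)"
proof (rule lagrangian_complementary[OF symplectic_omegaW[OF K] WK_lagrangian[OF K R] rho_kappa_lagrangian[OF K]], rule)
  fix z assume z: "z \<in> WK K R \<inter> rho_kappa K \<kappa>"
  then have "bpair K (pos z) (mom z) = 0" using RK_annihilates by (auto simp: WK_iff)
  moreover have m: "bpair K x (mom z) = complex_of_real \<kappa> * cinner x (pos z)" for x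
    using z rho_kappaD by blast
  ultimately have p: "pos z = 0" using k by (simp add: cinner_eq_0)
  then have "bpair K x (mom z) = 0" for x using m by (simp add: cinner_simps)
  then have "mom z = 0" by (rule bpair_nondegenerate_right[OF K])
  then show "z \<in> {0}" using p phase_eta[of z] by simp
qed

subsection \<open>The graph of a lower triangular symplectic matrix\<close>

lemma cinner_adjoint': "cinner x (A *v y) = cinner (cadj A *v x) y"
  using cinner_adjoint[of "cadj A" x y] by simp

lemma sesquilinear_hform: "sesquilinear (hform A)"
  unfolding hform_def[abs_def] by (rule sesquilinear_compose[OF sesquilinear_cinner lin_mult lin_id])

lemma hermitian_hform:
  assumes "cadj A = A" shows "hermitian_on (hform A) S"
  unfolding hermitian_on_def hform_def
proof (intro ballI)
  fix x y
  show "cinner (A *v y) x = cnj (cinner (A *v x) y)"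
    by (simp only: cnj_cinner cinner_adjoint[of A y x] assms)
qed

lemma SK_iff: "x \<in> SK K R M \<longleftrightarrow> vpair x (M *v x) \<in> RK K R"
  by (simp add: SK_def)

lemma subspace_SK: "vec.subspace (SK K R M)"
  using subspace_restrict_preimage[OF lin_vpair[OF lin_id lin_mult] vec.subspace_UNIV subspace_RK, of M K R]
  by (simp add: SK_def)

lemma Gr_iff: "z \<in> Gr M \<longleftrightarrow> vsnd z = M *v vfst z"
  unfolding Gr_def
proof (intro iffI CollectI exI[of _ "vfst z"] conjI TrueI)
  assume "vsnd z = M *v vfst z"
  then show "z = vpair (vfst z) (M *v vfst z)" by (intro vpair_eqI) simp_all
qed auto

text \<open>
  Under \<open>x \<mapsto> (x, M x)\<close> the subspace \<open>S\<close> is the set of common positions of the boundary condition and the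
  graph.
\<close>

lemma dim_SK: "vec.dim (RK K R \<inter> Gr M) = vec.dim (SK K R M)"
proof -
  let ?f = "\<lambda>x. vpair x (M *v x)"
  have "RK K R \<inter> Gr M = ?f ` SK K R M"
  proof (intro set_eqI iffI)
    fix z assume z: "z \<in> RK K R \<inter> Gr M"
    then have "z = ?f (vfst z)" by (auto simp: Gr_iff intro: vpair_eqI)
    then show "z \<in> ?f ` SK K R M" using z by (metis IntD1 SK_iff image_eqI)
  qed (auto simp: SK_iff Gr_iff)
  moreover have "x = 0" if "?f x = 0" for x using arg_cong[OF that, of vfst] by simp
  then have "vec.dim (?f ` SK K R M) = vec.dim (SK K R M)"
    by (intro dim_injective_image lin_vpair[OF lin_id lin_mult] subspace_SK) blast
  ultimately show ?thesis by simp
qed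

text \<open>
  The situation at one fixed time, with the path replaced by a single lower triangular matrix.
\<close>

locale boundary_data =
  fixes K M11 M21 M22 :: "complex^'n^'n" and R :: "(complex^('n + 'n)) set"
  assumes K: "invertible K" and R: "vec.subspace R"
    and rel: "cadj M22 ** K ** M11 = K"
    and sa: "cadj (cadj M11 ** cadj K ** M21) = cadj M11 ** cadj K ** M21"
begin

definition A where "A = cadj M11 ** cadj K ** M21"

abbreviation L where "L \<equiv> Gr (block M11 0 M21 M22)"

abbreviation S where "S \<equiv> SK K R M11"

lemma herm: "hermitian_on (hform A) T"
  unfolding A_def by (rule hermitian_hform[OF sa])

text \<open>
  The two terms containing \<open>y\<close> cancel by \<open>M\<^sub>2\<^sub>2\<^sup>* K M\<^sub>1\<^sub>1 = K\<close>. So the pairing of position and momentum on the graph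
  of \<open>\<gamma>\<close> is, up to sign, the Hermitian form of \<open>A\<close> in the first coordinates of the positions.
\<close>

lemma pairing_on_graph:
  "bpair K (vpair x (M11 *v x)) (vpair y (M21 *v x' + M22 *v y)) = - hform A x x'"
proof -
  have "cinner (K *v (M11 *v x)) (M22 *v y) = cinner (K *v x) y"
    unfolding cinner_adjoint' by (simp add: matrix_vector_mul_assoc matrix_mul_assoc rel)
  moreover have "cinner (K *v (M11 *v x)) (M21 *v x') = hform A x x'"
  proof -
    have "cinner (K *v (M11 *v x)) (M21 *v x') = cinner x (A *v x')"
      by (simp add: cinner_adjoint A_def flip: matrix_vector_mul_assoc)
    also have "\<dots> = cinner (A *v x) x'" unfolding cinner_adjoint' using sa by (simp add: A_def)
    finally show ?thesis by (simp add: hform_def)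
  qed
  ultimately show ?thesis by (simp add: bpair_def cinner_simps)
qed

lemma L_iff: "z \<in> L \<longleftrightarrow> vsnd (pos z) = M11 *v vfst (pos z) \<and>
    vsnd (mom z) = M21 *v vfst (pos z) + M22 *v vfst (mom z)"
  unfolding Gr_iff block_mult pos_def mom_def by (auto intro: vpair_eqI)

lemma pairing_on_L:
  assumes "z \<in> L" "w \<in> L"
  shows "bpair K (pos z) (mom w) = - hform A (vfst (pos z)) (vfst (pos w))"
proof -
  have "pos z = vpair (vfst (pos z)) (M11 *v vfst (pos z))"
    "mom w = vpair (vfst (mom w)) (M21 *v vfst (pos w) + M22 *v vfst (mom w))"
    using assms unfolding L_iff by (auto intro: vpair_eqI)
  then show ?thesis using pairing_on_graph by metis
qed

lemma L_lagrangian: "lagrangian (omegaW K) L"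
proof (rule isotropic_lagrangian[OF symplectic_omegaW[OF K] subspace_Gr])
  show "omegaW K z w = 0" if "z \<in> L" "w \<in> L" for z w
    unfolding omegaW_eq pairing_on_L[OF that] pairing_on_L[OF that(2,1)]
    using hermitianD[OF herm[of UNIV], of "vfst (pos z)" "vfst (pos w)"] by simp
  show "2 * vec.dim L = CARD(('n + 'n) + ('n + 'n))"
    unfolding dim_Gr by (simp add: CARD_plus)
qed

lemma rperp_RK: "rperp K (RK K R) = R"
proof -
  have "R \<subseteq> rperp K (RK K R)" using RK_annihilates by (auto simp: rperp_iff)
  moreover have "vec.dim (rperp K (RK K R)) \<le> vec.dim R"
    using dim_right_annihilator[OF K subspace_RK[of K R]] dim_RK[OF K R] by linarith
  ultimately show ?thesis
    using vec.subspace_dim_equal[OF R subspace_rperp] by blast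
qed

lemma rperp_Gr: "rperp K (Gr M11) = Gr M22"
proof -
  have "Gr M22 \<subseteq> rperp K (Gr M11)"
  proof
    fix y assume "y \<in> Gr M22"
    then have y: "y = vpair (vfst y) (M21 *v 0 + M22 *v vfst y)"
      by (auto simp: Gr_iff lin_0[OF lin_mult] intro: vpair_eqI)
    have "bpair K x y = 0" if "x \<in> Gr M11" for x
    proof -
      have "x = vpair (vfst x) (M11 *v vfst x)" using that by (auto simp: Gr_iff intro: vpair_eqI)
      then have "bpair K x y = - hform A (vfst x) 0" using y pairing_on_graph by metis
      then show ?thesis by (simp add: hform_def cinner_simps)
    qed
    then show "y \<in> rperp K (Gr M11)" by (simp add: rperp_iff)
  qed
  moreover have "vec.dim (rperp K (Gr M11)) \<le> vec.dim (Gr M22)"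
    using dim_right_annihilator[OF K subspace_Gr[of M11]] by (simp add: dim_Gr)
  ultimately show ?thesis
    using vec.subspace_dim_equal[OF subspace_Gr subspace_rperp] by blast
qed

text \<open>
  \<open>R\<close> and \<open>Gr M22\<close> are the annihilators of \<open>R\<^sup>K\<close> and \<open>Gr M11\<close>, so their intersection is the annihilator of
  a sum.
\<close>

lemma dim_R_Gr: "vec.dim (R \<inter> Gr M22) + vec.dim (RK K R) = CARD('n) + vec.dim S"
proof -
  let ?U = "{a + b |a b. a \<in> RK K R \<and> b \<in> Gr M11}"
  have sub: "vec.subspace ?U" by (rule vec.subspace_sums[OF subspace_RK subspace_Gr])
  have "rperp K (RK K R) \<inter> rperp K (Gr M11) = rperp K ?U"
  proof (intro set_eqI iffI)
    fix y assume y: "y \<in> rperp K (RK K R) \<inter> rperp K (Gr M11)"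
    then show "y \<in> rperp K ?U" unfolding rperp_iff by (auto simp: rperp_iff bpair_simps)
  next
    fix y assume y: "y \<in> rperp K ?U"
    have "a \<in> ?U" if "a \<in> RK K R" for a
      using that vec.subspace_0[OF subspace_Gr, of M11] by force
    moreover have "b \<in> ?U" if "b \<in> Gr M11" for b
      using that vec.subspace_0[OF subspace_RK, of K R] by force
    ultimately show "y \<in> rperp K (RK K R) \<inter> rperp K (Gr M11)"
      using y unfolding rperp_iff Int_iff by blast
  qed
  then have "vec.dim (R \<inter> Gr M22) = vec.dim (rperp K ?U)" by (simp only: rperp_RK rperp_Gr)
  moreover have "vec.dim ?U + vec.dim S = vec.dim (RK K R) + CARD('n)"
    using vec.dim_sums_Int[OF subspace_RK[of K R] subspace_Gr[of M11]] by (simp add: dim_SK dim_Gr)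
  ultimately show ?thesis
    using dim_right_annihilator[OF K sub] by linarith
qed

lemma rperp_inter: "rperp K (RK K R \<inter> Gr M11) = {a + b |a b. a \<in> R \<and> b \<in> Gr M22}"
proof -
  let ?U = "{a + b |a b. a \<in> R \<and> b \<in> Gr M22}"
  have sub: "vec.subspace ?U" by (rule vec.subspace_sums[OF R subspace_Gr])
  have "?U \<subseteq> rperp K (RK K R \<inter> Gr M11)"
  proof
    fix y assume "y \<in> ?U"
    then obtain a b where y: "y = a + b" "a \<in> rperp K (RK K R)" "b \<in> rperp K (Gr M11)"
      unfolding rperp_RK rperp_Gr by blast
    then show "y \<in> rperp K (RK K R \<inter> Gr M11)" by (simp add: rperp_iff bpair_simps)
  qed
  moreover have "vec.dim (rperp K (RK K R \<inter> Gr M11)) \<le> vec.dim ?U"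
    using dim_right_annihilator[OF K vec.subspace_inter[OF subspace_RK[of K R] subspace_Gr[of M11]]]
      dim_R_Gr vec.dim_sums_Int[OF R subspace_Gr[of M22]] dim_RK[OF K R]
    by (simp add: dim_SK dim_Gr)
  ultimately show ?thesis
    using vec.subspace_dim_equal[OF sub subspace_rperp] by blast
qed

lemma pos_in_RK_iff: "z \<in> L \<Longrightarrow> pos z \<in> RK K R \<longleftrightarrow> vfst (pos z) \<in> S"
  unfolding SK_iff L_iff by (metis vpair_eta)

text \<open>
  Send a point of the intersection to the first coordinate \<open>x\<close> of its position. Pairing with the positions of \<open>S\<close> shows
  that \<open>x\<close> is in the kernel of \<open>A\<close> on \<open>S\<close>. Conversely such an \<open>x\<close> makes \<open>(0, M\<^sub>2\<^sub>1 x)\<close> an annihilator of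
  \<open>R\<^sup>K \<inter> Gr M11\<close>, hence a sum of elements of \<open>R\<close> and \<open>Gr M22\<close>, which yields an admissible momentum. The
  fibre over \<open>0\<close> consists of the pure momenta in \<open>R \<inter> Gr M22\<close>.
\<close>

theorem dim_intersection:
  "vec.dim (L \<inter> WK K R) + vec.dim (RK K R) = vec.dim (form_ker (hform A) S) + vec.dim S + CARD('n)"
proof -
  let ?I = "L \<inter> WK K R" and ?f = "\<lambda>z. vfst (pos z)"
  have lf: "lin ?f" by (rule lin_compose[OF lin_pos lin_vfst])
  have I: "vec.subspace ?I"
    by (rule vec.subspace_inter[OF subspace_Gr lagrangian_subspace[OF symplectic_omegaW[OF K] WK_lagrangian[OF K R]]])
  have "?f ` ?I = form_ker (hform A) S"
  proof (intro set_eqI iffI)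
    fix x assume "x \<in> ?f ` ?I"
    then obtain z where z: "x = ?f z" "z \<in> L" "pos z \<in> RK K R" "mom z \<in> R" by (auto simp: WK_iff)
    have "hform A x s = 0" if "s \<in> S" for s
    proof -
      have "bpair K (vpair s (M11 *v s)) (mom z) = 0"
        using RK_annihilates that z(4) by (simp add: SK_iff)
      moreover have "mom z = vpair (vfst (mom z)) (M21 *v x + M22 *v vfst (mom z))"
        using z(1,2) unfolding L_iff by (auto intro: vpair_eqI)
      ultimately have "hform A s x = 0" using pairing_on_graph by (metis neg_equal_0_iff_equal)
      then show ?thesis using hermitianD[OF herm[of UNIV], of s x] by simp
    qed
    then show "x \<in> form_ker (hform A) S" using z pos_in_RK_iff by (simp add: form_ker_def)
  next
    fix x assume "x \<in> form_ker (hform A) S"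
    then have x: "x \<in> S" "\<And>s. s \<in> S \<Longrightarrow> hform A x s = 0" by (auto simp: form_ker_def)
    have "vpair 0 (M21 *v x) \<in> rperp K (RK K R \<inter> Gr M11)"
      unfolding rperp_iff
    proof
      fix s assume s: "s \<in> RK K R \<inter> Gr M11"
      then have e: "s = vpair (vfst s) (M11 *v vfst s)" by (auto simp: Gr_iff intro: vpair_eqI)
      then have "vfst s \<in> S" using s SK_iff by (metis IntD1)
      then have "hform A (vfst s) x = 0"
        using x(2) hermitianD[OF herm[of UNIV], of x "vfst s"] by simp
      then show "bpair K s (vpair 0 (M21 *v x)) = 0"
        using pairing_on_graph[of "vfst s" 0 x] e by (simp add: lin_0[OF lin_mult])
    qed
    then obtain a b where ab: "vpair 0 (M21 *v x) = a + b" "a \<in> R" "b \<in> Gr M22"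
      unfolding rperp_inter by blast
    have "vfst a = - vfst b" "vsnd a = M21 *v x - vsnd b"
      using arg_cong[OF ab(1), of vfst] arg_cong[OF ab(1), of vsnd] by (simp_all add: eq_neg_iff_add_eq_0 algebra_simps)
    then have a: "vsnd a = M21 *v x + M22 *v vfst a"
      using ab(3) by (simp add: Gr_iff lin_neg[OF lin_mult])
    let ?z = "phase (vpair x (M11 *v x)) a"
    have "?z \<in> ?I" using a x(1) ab(2) by (simp add: L_iff WK_iff SK_iff)
    moreover have "?f ?z = x" by simp
    ultimately show "x \<in> ?f ` ?I" by (metis image_eqI)
  qed
  moreover have "{z \<in> ?I. ?f z = 0} = phase 0 ` (R \<inter> Gr M22)"
  proof (intro set_eqI iffI)
    fix z assume z: "z \<in> {z \<in> ?I. ?f z = 0}"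
    then have "pos z = 0" by (auto simp: L_iff lin_0[OF lin_mult] intro: vpair_eqI)
    then have "z = phase 0 (mom z)" using phase_eta[of z] by simp
    moreover have "mom z \<in> R \<inter> Gr M22"
      using z L_iff[of z] by (simp add: WK_iff Gr_iff[where M=M22] lin_0[OF lin_mult])
    ultimately show "z \<in> phase 0 ` (R \<inter> Gr M22)" by blast
  next
    fix z assume "z \<in> phase 0 ` (R \<inter> Gr M22)"
    then show "z \<in> {z \<in> ?I. ?f z = 0}"
      using vec.subspace_0[OF subspace_RK, of K R] by (auto simp: L_iff WK_iff Gr_iff[where M=M22] lin_0[OF lin_mult])
  qed
  moreover have "vec.dim (phase 0 ` (R \<inter> Gr M22)) = vec.dim (R \<inter> Gr M22)"
  proof (rule dim_injective_image)
    show "lin (phase 0)" using lin_phase[OF linI[of "\<lambda>x. 0"] lin_id] by simp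
    show "vec.subspace (R \<inter> Gr M22)" by (rule vec.subspace_inter[OF R subspace_Gr])
    show "y = 0" if "phase 0 y = 0" for y :: "complex^('n + 'n)"
      using arg_cong[OF that, of mom] by (simp add: mom_simps)
  qed
  ultimately show ?thesis
    using rank_nullity[OF lf I] dim_R_Gr by simp
qed

subsection \<open>The Morse index of the reference form\<close>

context
  fixes \<kappa> :: real
  assumes \<kappa>: "0 < \<kappa>" and large: "\<And>x. x \<noteq> 0 \<Longrightarrow> 0 < \<kappa> * (norm x)\<^sup>2 + Re (hform A x x)"
begin

abbreviation \<rho> where "\<rho> \<equiv> rho_kappa K \<kappa>"

lemma hform_real: "hform A x x \<in> \<real>"
  using hermitian_real[OF herm[of UNIV]] by simp

lemma large_nonneg:
  assumes "z \<in> L"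
  shows "0 \<le> Re (hform A (vfst (pos z)) (vfst (pos z))) + \<kappa> * (norm (pos z))\<^sup>2"
proof -
  have "\<kappa> * (norm (vfst (pos z)))\<^sup>2 \<le> \<kappa> * (norm (pos z))\<^sup>2"
    using \<kappa> by (simp add: power_mono norm_vfst_le)
  moreover have "0 \<le> \<kappa> * (norm (vfst (pos z)))\<^sup>2 + Re (hform A (vfst (pos z)) (vfst (pos z)))"
    using large[of "vfst (pos z)"] by (cases "vfst (pos z) = 0") (auto simp: hform_def cinner_simps)
  ultimately show ?thesis by linarith
qed

lemma L_rho: "complementary L \<rho>"
proof (rule lagrangian_complementary[OF symplectic_omegaW[OF K] L_lagrangian rho_kappa_lagrangian[OF K]], rule)
  fix z assume z: "z \<in> L \<inter> \<rho>"
  let ?x = "vfst (pos z)"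
  have m: "bpair K x (mom z) = complex_of_real \<kappa> * cinner x (pos z)" for x
    using z rho_kappaD by blast
  have "- hform A ?x ?x = complex_of_real (\<kappa> * (norm (pos z))\<^sup>2)"
    using pairing_on_L[of z z] z m[of "pos z"] by (simp add: cinner_self)
  then have e: "Re (hform A ?x ?x) = - \<kappa> * (norm (pos z))\<^sup>2"
    by (metis Re_complex_of_real minus_mult_left minus_complex.sel(1) uminus_complex.sel(1) add.inverse_inverse)
  have "?x = 0"
  proof (rule ccontr)
    assume "?x \<noteq> 0"
    then have "0 < \<kappa> * (norm ?x)\<^sup>2 + Re (hform A ?x ?x)" by (rule large)
    moreover have "\<kappa> * (norm ?x)\<^sup>2 \<le> \<kappa> * (norm (pos z))\<^sup>2"
      using \<kappa> by (simp add: power_mono norm_vfst_le)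
    ultimately show False using e by simp
  qed
  then have p: "pos z = 0" using z by (auto simp: L_iff lin_0[OF lin_mult] intro: vpair_eqI)
  then have "bpair K x (mom z) = 0" for x using m by (simp add: cinner_simps)
  then have "mom z = 0" by (rule bpair_nondegenerate_right[OF K])
  then show "z \<in> {0}" using p phase_eta[of z] by simp
qed

lemma W_rho: "complementary (WK K R) \<rho>"
  by (rule WK_rho_kappa[OF K R]) (use \<kappa> in simp)

abbreviation q where "q \<equiv> pform (omegaW K) (WK K R) \<rho>"

lemma q_value:
  fixes l
  defines "m \<equiv> proj (WK K R) \<rho> l" and "r \<equiv> l - proj (WK K R) \<rho> l"
  shows "q l l = cnj (bpair K (pos r) (mom m)) - bpair K (pos m) (mom r)"
    "pos m \<in> RK K R" "mom m \<in> R" "pos m + pos r = pos l" "mom m + mom r = mom l"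
    "bpair K x (mom r) = complex_of_real \<kappa> * cinner x (pos r)"
proof -
  show "q l l = cnj (bpair K (pos r) (mom m)) - bpair K (pos m) (mom r)"
    unfolding pform_def proj_swap[OF W_rho] omegaW_eq m_def r_def ..
  show "pos m \<in> RK K R" "mom m \<in> R" using proj_in[OF W_rho, of l] by (simp_all add: m_def WK_iff)
  show "pos m + pos r = pos l" "mom m + mom r = mom l"
    unfolding m_def r_def by (simp_all add: pos_simps mom_simps)
  show "bpair K x (mom r) = complex_of_real \<kappa> * cinner x (pos r)"
    unfolding r_def by (rule rho_kappaD[OF proj_diff_in[OF W_rho]])
qed

text \<open>
  Write \<open>l = m + r\<close> along \<open>W\<^sub>K(R)\<close> and \<open>\<rho>\<close>. If the position of \<open>l\<close> is in \<open>R\<^sup>K\<close>, so is that of \<open>r\<close>, and the pairings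
  of both with the momentum of \<open>m\<close> vanish. What is left of the form is \<open>A\<close> plus \<open>\<kappa>\<close> times the squared norm of the position of
  \<open>r\<close>.
\<close>

lemma q_lower:
  assumes l: "l \<in> L" and S: "vfst (pos l) \<in> S"
  shows "Re (hform A (vfst (pos l)) (vfst (pos l))) \<le> Re (q l l)"
proof -
  define m r where "m = proj (WK K R) \<rho> l" and "r = l - proj (WK K R) \<rho> l"
  note Q = q_value[where l=l, folded m_def r_def]
  have pl: "pos l \<in> RK K R" using S pos_in_RK_iff[OF l] by simp
  then have "pos r \<in> RK K R"
    using vec.subspace_diff[OF subspace_RK pl Q(2)] Q(4) by (metis add_diff_cancel_left')
  then have "bpair K (pos r) (mom m) = 0" "bpair K (pos l) (mom m) = 0" using RK_annihilates Q(3) pl by blast+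
  then have "q l l = - bpair K (pos m) (mom r)"
    "hform A (vfst (pos l)) (vfst (pos l)) = - bpair K (pos l) (mom r)"
    using Q(1) pairing_on_L[OF l l] Q(5)[symmetric] by (simp_all add: bpair_simps)
  then have "q l l = hform A (vfst (pos l)) (vfst (pos l)) + bpair K (pos r) (mom r)"
    using Q(4)[symmetric] by (simp add: bpair_simps)
  then have "Re (q l l) = Re (hform A (vfst (pos l)) (vfst (pos l))) + \<kappa> * (norm (pos r))\<^sup>2"
    unfolding Q(6) cinner_self by simp
  then show ?thesis using \<kappa> by simp
qed

text \<open>
  Here the position of the component \<open>m\<close> of \<open>l\<close> is that of some \<open>l'\<close> in the graph. Then \<open>d = l - l'\<close> has the same
  position as \<open>r\<close>, and the form at \<open>l\<close> equals \<open>A\<close> at \<open>l'\<close> minus the value of \<open>A + \<kappa>\<close> at \<open>d\<close>, which is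
  nonnegative.
\<close>

lemma q_upper:
  assumes l: "l \<in> L" and m: "pos (proj (WK K R) \<rho> l) \<in> Gr M11"
  defines "s \<equiv> vfst (pos (proj (WK K R) \<rho> l))"
  shows "Re (q l l) \<le> Re (hform A s s)"
proof -
  define m r where "m = proj (WK K R) \<rho> l" and "r = l - proj (WK K R) \<rho> l"
  note Q = q_value[where l=l, folded m_def r_def]
  define l' where "l' = phase (pos m) (vpair 0 (M21 *v s))"
  have l': "l' \<in> L" "pos l' = pos m" "vfst (pos l') = s"
    using m unfolding l'_def s_def m_def[symmetric] by (simp_all add: L_iff Gr_iff[where M=M11] lin_0[OF lin_mult])
  define d where "d = l - l'"
  have d: "d \<in> L" "pos d = pos r"
    using vec.subspace_diff[OF subspace_Gr l l'(1)] Q(4)[symmetric] l'(2) by (simp_all add: d_def pos_simps)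
  let ?H = "\<lambda>u v. hform A (vfst (pos u)) (vfst (pos v))"
  have pl: "vfst (pos l) = vfst (pos l') + vfst (pos d)" by (simp add: d_def pos_simps)
  have "bpair K (pos r) (mom m) = bpair K (pos d) (mom l) - bpair K (pos r) (mom r)"
    unfolding d(2) Q(5)[symmetric] by (simp add: bpair_simps)
  then have 1: "bpair K (pos r) (mom m) = - ?H d l - complex_of_real (\<kappa> * (norm (pos r))\<^sup>2)"
    unfolding pairing_on_L[OF d(1) l] Q(6) cinner_self by simp
  have "bpair K (pos m) (mom r) = bpair K (pos l') (mom l) - bpair K (pos m) (mom m)"
    unfolding l'(2) Q(5)[symmetric] by (simp add: bpair_simps)
  then have 2: "bpair K (pos m) (mom r) = - ?H l' l"
    unfolding pairing_on_L[OF l'(1) l] using RK_annihilates[OF Q(2,3)] by simp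
  have cn: "cnj (?H d l) = ?H l d"
    by (rule hermitianD[OF herm[of UNIV], symmetric]) auto
  have "q l l = ?H l' l - ?H l d - complex_of_real (\<kappa> * (norm (pos r))\<^sup>2)"
    unfolding Q(1) 1 2 using cn by simp
  also have "\<dots> = ?H l' l' - ?H d d - complex_of_real (\<kappa> * (norm (pos r))\<^sup>2)"
    unfolding pl by (simp add: sesq_simps[OF sesquilinear_hform])
  finally have "Re (q l l) = Re (?H l' l') - (Re (?H d d) + \<kappa> * (norm (pos d))\<^sup>2)"
    unfolding d(2) by simp
  then show ?thesis using large_nonneg[OF d(1)] l'(3) by simp
qed

lemma q_herm: "hermitian_on q L"
  by (rule pform_hermitian[OF symplectic_omegaW[OF K] W_rho WK_lagrangian[OF K R] rho_kappa_lagrangian[OF K] L_lagrangian])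

lemma q_sesq: "sesquilinear q"
  by (rule sesquilinear_pform[OF symplectic_omegaW[OF K] W_rho])

text \<open>
  In a positive definite subspace for the reference form, the vectors whose \<open>W\<^sub>K(R)\<close>-component lies over
  \<open>Gr M11\<close> map injectively to a subspace of \<open>S\<close> on which \<open>A\<close> is positive.
\<close>

lemma morse_pos_q_le: "morse_pos q L + vec.dim S \<le> morse_pos (hform A) S + vec.dim (RK K R)"
proof -
  obtain P where P: "vec.subspace P" "P \<subseteq> L" "pos_def_on q P" "vec.dim P = morse_pos q L"
    using morse_pos_attained[OF subspace_Gr] by blast
  let ?f = "\<lambda>l. pos (proj (WK K R) \<rho> l)"
  have lf: "lin ?f" by (rule lin_compose[OF proj_lin[OF W_rho] lin_pos])
  let ?T = "RK K R \<inter> Gr M11"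
  let ?P = "{l \<in> P. ?f l \<in> ?T}"
  have "vec.dim P + vec.dim ?T \<le> vec.dim ?P + vec.dim (RK K R)"
    by (rule dim_preimage_ge[OF lf P(1) subspace_RK vec.subspace_inter[OF subspace_RK subspace_Gr]])
      (use q_value(2) in auto)
  moreover have "vec.dim ?P \<le> morse_pos (hform A) S"
  proof -
    let ?g = "\<lambda>l. vfst (?f l)"
    have lg: "lin ?g" by (rule lin_compose[OF lf lin_vfst])
    have sub: "vec.subspace ?P"
      by (rule subspace_restrict_preimage[OF lf P(1) vec.subspace_inter[OF subspace_RK subspace_Gr]])
    have p: "0 < Re (hform A (?g l) (?g l))" if "l \<in> ?P" "l \<noteq> 0" for l
    proof -
      have "0 < Re (q l l)" using that P(3) unfolding pos_def_on_def by blast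
      also have "\<dots> \<le> Re (hform A (?g l) (?g l))" by (rule q_upper) (use that P(2) in auto)
      finally show ?thesis .
    qed
    have inj: "l = 0" if "l \<in> ?P" "?g l = 0" for l
      using p[OF that(1)] that(2) by (auto simp: sesq_simps[OF sesquilinear_hform])
    have gS: "?g ` ?P \<subseteq> S"
    proof
      fix x assume "x \<in> ?g ` ?P"
      then obtain l where l: "x = ?g l" "?f l \<in> RK K R" "?f l \<in> Gr M11" by blast
      then have "?f l = vpair x (M11 *v x)" by (auto simp: Gr_iff intro: vpair_eqI)
      then show "x \<in> S" using l(2) by (simp add: SK_iff)
    qed
    have "pos_def_on (hform A) (?g ` ?P)"
      unfolding pos_def_on_def using p hform_real lin_0[OF lg] by blast
    then have "vec.dim (?g ` ?P) \<le> morse_pos (hform A) S"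
      by (rule morse_pos_ge[OF subspace_image[OF lg sub] gS])
    then show ?thesis using dim_injective_image[OF lg sub inj] by simp
  qed
  ultimately show ?thesis using P(4) dim_SK[of K R M11] by linarith
qed

text \<open>
  In a negative definite subspace, the vectors with position in \<open>R\<^sup>K\<close> map injectively to a subspace of
  \<open>S\<close> on which \<open>A\<close> is negative.
\<close>

lemma morse_neg_q_le:
  "morse_pos (\<lambda>x y. - q x y) L + vec.dim S \<le> morse_pos (\<lambda>x y. - hform A x y) S + CARD('n)"
proof -
  obtain P where P: "vec.subspace P" "P \<subseteq> L" "pos_def_on (\<lambda>x y. - q x y) P"
      "vec.dim P = morse_pos (\<lambda>x y. - q x y) L"
    using morse_pos_attained[OF subspace_Gr] by blast
  let ?f = "\<lambda>l. vfst (pos l)"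
  have lf: "lin ?f" by (rule lin_compose[OF lin_pos lin_vfst])
  let ?P = "{l \<in> P. ?f l \<in> S}"
  have "vec.dim P + vec.dim S \<le> vec.dim ?P + vec.dim (UNIV :: (complex^'n) set)"
    by (rule dim_preimage_ge[OF lf P(1) vec.subspace_UNIV subspace_SK]) auto
  then have "vec.dim P + vec.dim S \<le> vec.dim ?P + CARD('n)" by (simp only: vec_dim_card)
  moreover have "vec.dim ?P \<le> morse_pos (\<lambda>x y. - hform A x y) S"
  proof -
    have sub: "vec.subspace ?P" by (rule subspace_restrict_preimage[OF lf P(1) subspace_SK])
    have p: "0 < Re (- hform A (?f l) (?f l))" if "l \<in> ?P" "l \<noteq> 0" for l
    proof -
      have "0 < Re (- q l l)" using that P(3) unfolding pos_def_on_def by blast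
      also have "\<dots> \<le> Re (- hform A (?f l) (?f l))" using q_lower[of l] that P(2) by auto
      finally show ?thesis .
    qed
    have inj: "l = 0" if "l \<in> ?P" "?f l = 0" for l
      using p[OF that(1)] that(2) by (auto simp: sesq_simps[OF sesquilinear_hform])
    have "pos_def_on (\<lambda>x y. - hform A x y) (?f ` ?P)"
      unfolding pos_def_on_def using p hform_real lin_0[OF lf] Reals_minus by blast
    then have "vec.dim (?f ` ?P) \<le> morse_pos (\<lambda>x y. - hform A x y) S"
      by (intro morse_pos_ge[OF subspace_image[OF lf sub]]) auto
    then show ?thesis using dim_injective_image[OF lf sub inj] by simp
  qed
  ultimately show ?thesis using P(4) by linarith
qed

text \<open>
  By inertia, the positive and the negative index of the reference form add up to
  \<open>2 n - dim (L \<inter> W\<^sub>K(R))\<close>. By the formula for the dimension of the intersection this is also the sum of the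
  two upper bounds, so both bounds are attained.
\<close>

theorem morse_pos_reference:
  "morse_pos q L + vec.dim S = morse_pos (hform A) S + vec.dim (RK K R)"
proof -
  have "form_ker q L = L \<inter> WK K R"
    by (rule form_ker_pform_transversal[OF symplectic_omegaW[OF K] W_rho WK_lagrangian[OF K R] L_lagrangian])
      (use L_rho in \<open>simp add: complementary_def\<close>)
  moreover have "vec.dim L = 2 * CARD('n)" unfolding dim_Gr by (simp add: CARD_plus)
  ultimately have "morse_pos q L + morse_pos (\<lambda>x y. - q x y) L + vec.dim (L \<inter> WK K R) = 2 * CARD('n)"
    using sylvester_inertia[OF q_sesq q_herm subspace_Gr] by simp
  then show ?thesis
    using morse_pos_q_le morse_neg_q_le dim_intersection
      sylvester_inertia[OF sesquilinear_hform herm subspace_SK, of K R M11] by linarith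
qed

end

end

text \<open>
  The identity matrix satisfies the hypotheses on the blocks with \<open>M\<^sub>2\<^sub>1 = 0\<close>, and the diagonal is its own
  annihilator.
\<close>

lemma dim_diagonal_difference:
  fixes K :: "complex^'n^'n"
  assumes K: "invertible K" and R: "vec.subspace R"
  shows "vec.dim (Gr (mat 1 :: complex^'n^'n) \<inter> R) + vec.dim (RK K R) =
    vec.dim (Gr (mat 1 :: complex^'n^'n) \<inter> RK K R) + CARD('n)"
proof -
  interpret boundary_data K "mat 1" 0 "mat 1" R
  proof
    show "cadj (mat 1) ** K ** mat 1 = K" by simp
    have "cadj (mat 1) ** cadj K ** (0 :: complex^'n^'n) = 0" "cadj (0 :: complex^'n^'n) = 0"
      by (simp_all add: matrix_matrix_mult_def cadj_def vec_eq_iff)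
    then show "cadj (cadj (mat 1) ** cadj K ** (0 :: complex^'n^'n)) = cadj (mat 1) ** cadj K ** 0" by simp
  qed (fact K R)+
  show ?thesis
    using dim_R_Gr dim_SK[of K R "mat 1"] by (simp add: Int_commute)
qed

section \<open>Admissible choices for the Maslov index\<close>

text \<open>
  The Hermitian form \<open>- \<i> * \<omega>\<close> has no kernel, so its inertia decomposition is a splitting.
\<close>

lemma symplectic_splitting_exists:
  fixes \<omega> :: "complex^'m \<Rightarrow> complex^'m \<Rightarrow> complex"
  assumes w: "symplectic_form \<omega>"
  obtains Vp Vm where "symplectic_splitting \<omega> Vp Vm"
proof -
  note s = symplectic_sesquilinear[OF w]
  let ?q = "\<lambda>x y. - \<i> * \<omega> x y"
  have q: "sesquilinear ?q" using s by (simp add: sesquilinear_def algebra_simps)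
  have h: "hermitian_on ?q UNIV"
    unfolding hermitian_on_def by (intro ballI) (subst symplectic_skew[OF w], simp)
  obtain P N where PN: "vec.subspace P" "vec.subspace N" "pos_def_on ?q P" "pos_def_on (\<lambda>x y. - ?q x y) N"
      "\<And>x y. x \<in> P \<Longrightarrow> y \<in> N \<Longrightarrow> ?q x y = 0"
      "vec.dim P + vec.dim N + vec.dim (form_ker ?q UNIV) = vec.dim (UNIV :: (complex^'m) set)"
    by (rule inertia_decomposition[OF q h vec.subspace_UNIV]) blast
  have "form_ker ?q UNIV \<subseteq> {0}"
  proof
    fix x assume "x \<in> form_ker ?q UNIV"
    then have "\<omega> x y = 0" for y by (auto simp: form_ker_def)
    then show "x \<in> {0}" using symplectic_nondegenerate[OF w] by blast
  qed
  then have d0: "vec.dim (form_ker ?q UNIV) = 0" by simp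
  have "CARD('m) \<le> vec.dim P + vec.dim N" using PN(6) unfolding d0 vec_dim_card by linarith
  moreover have disj: "P \<inter> N \<subseteq> {0}"
  proof (rule definite_disjoint[OF PN(3)])
    fix x assume "x \<in> N"
    then show "Re (?q x x) \<le> 0"
      using PN(4) sesq_simps(5)[OF s] unfolding pos_def_on_def by (cases "x = 0") force+
  qed
  ultimately have c: "complementary P N" by (intro complementary_dim PN(1,2))
  have "symplectic_splitting \<omega> P N"
    unfolding symplectic_splitting_def
  proof (intro conjI ballI PN(1-3))
    show "P \<inter> N = {0}" using disj vec.subspace_0 PN(1,2) by blast
    show "{x + y |x y. x \<in> P \<and> y \<in> N} = UNIV"
    proof (intro set_eqI iffI UNIV_I CollectI)
      fix v
      show "\<exists>x y. v = x + y \<and> x \<in> P \<and> y \<in> N"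
        using proj_in[OF c, of v] proj_diff_in[OF c, of v]
        by (intro exI[of _ "proj P N v"] exI[of _ "v - proj P N v"]) auto
    qed
    show "\<omega> x y = 0" if "x \<in> P" "y \<in> N" for x y using PN(5)[OF that] by simp
    show "pos_def_on (\<lambda>x y. \<i> * \<omega> x y) N" using PN(4) by simp
  qed
  then show thesis by (rule that)
qed

lemma finite_relative_spectrum:
  assumes w: "symplectic_form \<omega>" and sp: "symplectic_splitting \<omega> Vp Vm"
    and l: "lagrangian \<omega> \<Lambda>" and m: "lagrangian \<omega> \<mu>"
  shows "finite (spectrum_on Vm (relative_unitary Vp Vm \<Lambda> \<mu>))"
proof -
  have "spectrum_on Vm (relative_unitary Vp Vm \<Lambda> \<mu>) = spectrum_on Vm (\<lambda>y. proj Vm \<Lambda> (proj Vp \<mu> y))"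
    by (rule spectrum_on_cong[OF relative_unitary_eq[OF w sp l m]])
  then show ?thesis
    using definite_isometry.finite_spectrum[OF relative_unitary_isometry[OF w sp l m]] by simp
qed

text \<open>
  Angles in \<open>(0, pi)\<close> are recovered from the real part of \<open>cis \<epsilon>\<close>, which is also that of \<open>cis (- \<epsilon>)\<close>.
\<close>

lemma avoid_angles:
  assumes "finite S"
  obtains \<epsilon> :: real where "0 < \<epsilon>" "\<epsilon> < pi" "cis \<epsilon> \<notin> S" "cis (- \<epsilon>) \<notin> S"
proof -
  have "infinite ({0<..<pi} - (\<lambda>z. arccos (Re z)) ` S)"
    using assms by (intro Diff_infinite_finite) (auto simp: infinite_Ioo)
  then obtain \<epsilon> where e: "\<epsilon> \<in> {0<..<pi}" "\<epsilon> \<notin> (\<lambda>z. arccos (Re z)) ` S"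
    by (metis DiffE all_not_in_conv finite.emptyI)
  have "arccos (Re (cis \<epsilon>)) = \<epsilon>" "arccos (Re (cis (- \<epsilon>))) = \<epsilon>"
    using e(1) by (auto simp: arccos_cos)
  then have "cis \<epsilon> \<notin> S" "cis (- \<epsilon>) \<notin> S" using e(2) by (metis image_eqI)+
  then show thesis using that e(1) by auto
qed

text \<open>
  Every time has a neighbourhood on which one choice of \<open>\<epsilon>\<close> works. Steps shorter than a Lebesgue
  number of this cover do the rest.
\<close>

lemma fine_subdivision:
  fixes a b :: real
  assumes ab: "a < b"
    and loc: "\<And>t. t \<in> {a..b} \<Longrightarrow> \<exists>\<epsilon> \<delta>. 0 < \<delta> \<and> (\<forall>t'\<in>{a..b}. dist t t' < \<delta> \<longrightarrow> P t' (\<epsilon> :: real))"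
  obtains N :: nat and s \<epsilon> :: "nat \<Rightarrow> real" where "s 0 = a" "s N = b"
    "\<And>k. k < N \<Longrightarrow> s k < s (Suc k)" "\<And>k t. k < N \<Longrightarrow> t \<in> {s k..s (Suc k)} \<Longrightarrow> P t (\<epsilon> k)"
proof -
  obtain e d where ed: "\<And>t. t \<in> {a..b} \<Longrightarrow> 0 < d t \<and> (\<forall>t'\<in>{a..b}. dist t t' < d t \<longrightarrow> P t' (e t))"
    using loc by metis
  let ?C = "(\<lambda>t. ball t (d t)) ` {a..b}"
  have "{a..b} \<subseteq> \<Union>?C" using ed by force
  moreover have "?C \<noteq> {}" using ab by auto
  ultimately obtain \<delta> where \<delta>: "0 < \<delta>" "\<And>U. U \<subseteq> {a..b} \<Longrightarrow> diameter U < \<delta> \<Longrightarrow> \<exists>B\<in>?C. U \<subseteq> B"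
    using Lebesgue_number_lemma[of "{a..b}" ?C] by (metis (no_types, lifting) compact_Icc imageE open_ball)
  obtain N :: nat where N: "(b - a) / \<delta> < real N" using reals_Archimedean2 by blast
  have "0 < (b - a) / \<delta>" using ab \<delta>(1) by simp
  then have N0: "0 < N" using N by linarith
  define h where "h = (b - a) / real N"
  have h: "0 < h" "h < \<delta>"
    using N N0 ab \<delta>(1) by (simp_all add: h_def field_simps)
  define s where "s k = a + real k * h" for k
  have hN: "real N * h = b - a" using N0 by (simp add: h_def)
  have Suc: "s (Suc k) = s k + h" for k by (simp add: s_def algebra_simps)
  have s: "s 0 = a" "s N = b" "s k < s (Suc k)" "s (Suc k) - s k = h" for k
    using hN h(1) by (simp_all add: Suc) (simp_all add: s_def)
  have ex: "\<exists>\<epsilon>. \<forall>t\<in>{s k..s (Suc k)}. P t \<epsilon>" if k: "k < N" for k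
  proof -
    have "real (Suc k) * h \<le> real N * h" using k h(1) by (intro mult_right_mono) auto
    then have "s (Suc k) \<le> b" using s(2) unfolding s_def by linarith
    moreover have "a \<le> s k" using h(1) by (simp add: s_def)
    ultimately have sub: "{s k..s (Suc k)} \<subseteq> {a..b}" by auto
    have "diameter {s k..s (Suc k)} = h"
      using s(3,4)[of k] by (simp add: diameter_closed_interval)
    then obtain t where t: "t \<in> {a..b}" "{s k..s (Suc k)} \<subseteq> ball t (d t)"
      using \<delta>(2)[OF sub] h(2) by auto
    then show ?thesis using ed[OF t(1)] sub by (intro exI[of _ "e t"]) auto
  qed
  then obtain \<epsilon> where "\<And>k. k < N \<Longrightarrow> \<forall>t\<in>{s k..s (Suc k)}. P t (\<epsilon> k)" by metis
  then show thesis using that[of s N \<epsilon>] s by blast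
qed

lemma Gr_range: "Gr M = range (\<lambda>u. vpair u (M *v u))"
  by (auto simp: Gr_def)

lemma lin_graph: "lin (\<lambda>u. vpair u (M *v u))"
  by (rule lin_vpair[OF lin_id lin_mult])

lemma graph_injective:
  fixes u :: "complex^'m"
  assumes "vpair u (M *v u) = 0" shows "u = 0"
  using arg_cong[OF assms, of vfst] by simp

lemma continuous_on_graph:
  fixes \<gamma> :: "real \<Rightarrow> complex^'m^'m"
  assumes "continuous_on I \<gamma>" shows "continuous_on I (\<lambda>t. vpair u (\<gamma> t *v u))"
proof (rule continuous_on_cart)
  fix i :: "'m + 'm"
  have "continuous_on I (\<lambda>t. \<Sum>k\<in>UNIV. \<gamma> t $ j $ k * u $ k)" for j
    by (intro continuous_intros assms)
  then show "continuous_on I (\<lambda>t. vpair u (\<gamma> t *v u) $ i)"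
    by (cases i) (simp_all add: vpair_def matrix_vector_mult_def)
qed

lemma continuous_on_proj_graph:
  fixes \<gamma> :: "real \<Rightarrow> complex^'m^'m"
  assumes w: "symplectic_form \<omega>" and sp: "symplectic_splitting \<omega> Vp Vm"
    and cont: "continuous_on I \<gamma>" and l: "\<And>t. t \<in> I \<Longrightarrow> lagrangian \<omega> (Gr (\<gamma> t))"
  shows "continuous_on I (\<lambda>t. proj Vm (Gr (\<gamma> t)) x)"
proof -
  note c = splitting_dim(2)[OF w sp l]
  have "continuous_on I (\<lambda>t. proj (Gr (\<gamma> t)) Vm x)"
    unfolding Gr_range
    by (rule continuous_on_proj[OF lin_graph graph_injective continuous_on_graph[OF cont]
          complementary_sym[OF c, unfolded Gr_range]])
  then have "continuous_on I (\<lambda>t. x - proj (Gr (\<gamma> t)) Vm x)" by (intro continuous_intros)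
  then show ?thesis
    by (simp add: proj_swap[OF complementary_sym[OF c]] cong: continuous_on_cong)
qed

text \<open>
  Extend \<open>U V\<^sup>-\<^sup>1 - z\<close> from \<open>Vm\<close> to the whole space by the identity on \<open>Vp\<close>. Then \<open>z\<close> is outside the
  spectrum exactly if the determinant of this operator, which depends continuously on \<open>t\<close>, is nonzero.
\<close>

lemma spectral_gap_stable:
  fixes \<gamma> :: "real \<Rightarrow> complex^'m^'m" and I :: "real set"
  assumes w: "symplectic_form \<omega>" and sp: "symplectic_splitting \<omega> Vp Vm"
    and cont: "continuous_on I \<gamma>" and l: "\<And>t. t \<in> I \<Longrightarrow> lagrangian \<omega> (Gr (\<gamma> t))"
    and m: "lagrangian \<omega> \<mu>"
    and a: "a \<in> I" and z: "z \<notin> spectrum_on Vm (relative_unitary Vp Vm (Gr (\<gamma> a)) \<mu>)"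
  shows "\<exists>\<delta>>0. \<forall>t\<in>I. dist a t < \<delta> \<longrightarrow> z \<notin> spectrum_on Vm (relative_unitary Vp Vm (Gr (\<gamma> t)) \<mu>)"
proof -
  note cp = splitting_dim(1)[OF w sp m] and c = splitting_complementary[OF sp]
    and cl = splitting_dim(2)[OF w sp l]
  note Vm = complementary_subspaces(2)[OF c]
  define pm pp where "pm = proj Vm Vp" and "pp = proj Vp Vm"
  have lp: "lin pm" "lin pp" unfolding pm_def pp_def by (rule proj_lin[OF complementary_sym[OF c]], rule proj_lin[OF c])
  define G where "G t y = proj Vm (Gr (\<gamma> t)) (proj Vp \<mu> y)" for t y
  define E where "E t v = (G t (pm v) - z *s pm v) + pp v" for t v
  have linG: "lin (G t)" if "t \<in> I" for t
    unfolding G_def by (rule lin_compose[OF proj_lin[OF cp] proj_lin[OF cl[OF that]]])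
  have linE: "lin (E t)" if "t \<in> I" for t
    unfolding E_def by (rule lin_plus[OF lin_minus[OF lin_compose[OF lp(1) linG[OF that]] lin_cmult[OF lp(1)]] lp(2)])
  have RU: "relative_unitary Vp Vm (Gr (\<gamma> t)) \<mu> y = G t y" if "t \<in> I" "y \<in> Vm" for t y
    unfolding G_def by (rule relative_unitary_eq[OF w sp l[OF that(1)] m that(2)])
  have spec: "z \<in> spectrum_on Vm (relative_unitary Vp Vm (Gr (\<gamma> t)) \<mu>) \<longleftrightarrow> (\<exists>v. v \<noteq> 0 \<and> E t v = 0)"
    if t: "t \<in> I" for t
  proof
    assume "z \<in> spectrum_on Vm (relative_unitary Vp Vm (Gr (\<gamma> t)) \<mu>)"
    then obtain y where y: "y \<in> Vm" "y \<noteq> 0" "G t y = z *s y"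
      unfolding spectrum_on_def using RU[OF t] by auto
    have "pm y = y" "pp y = 0"
      unfolding pm_def pp_def using proj_id[OF complementary_sym[OF c] y(1)] proj_zero[OF c y(1)] by auto
    then show "\<exists>v. v \<noteq> 0 \<and> E t v = 0" using y by (intro exI[of _ y]) (simp add: E_def)
  next
    assume "\<exists>v. v \<noteq> 0 \<and> E t v = 0"
    then obtain v where v: "v \<noteq> 0" "E t v = 0" by blast
    have pv: "pm v \<in> Vm" "pp v \<in> Vp"
      unfolding pm_def pp_def using proj_in[OF complementary_sym[OF c]] proj_in[OF c] by auto
    have "G t (pm v) - z *s pm v \<in> Vm"
      using proj_in[OF cl[OF t]] pv(1) unfolding G_def by (intro vec.subspace_diff[OF Vm] vec.subspace_scale[OF Vm])
    moreover have "G t (pm v) - z *s pm v = - pp v" using v(2) by (simp add: E_def add_eq_0_iff2)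
    moreover have "- pp v \<in> Vp" using pv(2) complementary_subspaces(1)[OF c] vec.subspace_neg by blast
    ultimately have "- pp v \<in> Vp \<inter> Vm" by simp
    then have "- pp v = 0" using c unfolding complementary_def by blast
    then have p0: "pp v = 0" by simp
    then have e: "G t (pm v) = z *s pm v" using v(2) by (simp add: E_def)
    have "pm v \<noteq> 0"
      using v(1) p0 proj_decomp[OF c, of v] unfolding pm_def pp_def by auto
    then show "z \<in> spectrum_on Vm (relative_unitary Vp Vm (Gr (\<gamma> t)) \<mu>)"
      unfolding spectrum_on_def using e pv(1) RU[OF t pv(1)] by auto
  qed
  have contE: "continuous_on I (\<lambda>t. E t v)" for v
    unfolding E_def G_def by (intro continuous_intros continuous_on_proj_graph[OF w sp cont l])
  define D where "D t = det (matrix (E t))" for t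
  have cm: "continuous_on I (\<lambda>t. matrix (E t) $ i $ j)" for i j
    unfolding matrix_def vec_lambda_beta by (intro continuous_intros contE)
  have contD: "continuous_on I D"
    unfolding D_def det_def by (intro continuous_intros cm)
  have D: "D t = 0 \<longleftrightarrow> (\<exists>v. v \<noteq> 0 \<and> E t v = 0)" if t: "t \<in> I" for t
  proof -
    have "D t \<noteq> 0 \<longleftrightarrow> (\<exists>B. B ** matrix (E t) = mat 1)"
      unfolding D_def invertible_det_nz[symmetric] invertible_left_inverse ..
    also have "\<dots> \<longleftrightarrow> (\<forall>v. E t v = 0 \<longrightarrow> v = 0)"
      unfolding matrix_left_invertible_ker lin_matrix[OF linE[OF t]] ..
    finally show ?thesis by blast
  qed
  have Da: "D a \<noteq> 0" using D[OF a] spec[OF a] z by blast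
  have "\<exists>\<delta>>0. \<forall>t\<in>I. dist t a < \<delta> \<longrightarrow> dist (D t) (D a) < norm (D a)"
    using contD a Da unfolding continuous_on_iff by simp
  then obtain \<delta> where \<delta>: "\<delta> > 0" "\<And>t. t \<in> I \<Longrightarrow> dist t a < \<delta> \<Longrightarrow> dist (D t) (D a) < norm (D a)" by blast
  have "z \<notin> spectrum_on Vm (relative_unitary Vp Vm (Gr (\<gamma> t)) \<mu>)" if t: "t \<in> I" "dist a t < \<delta>" for t
  proof -
    have "D t \<noteq> 0" using \<delta>(2)[OF t(1)] t(2) by (auto simp: dist_commute dist_norm)
    then show ?thesis using D[OF t(1)] spec[OF t(1)] by blast
  qed
  then show ?thesis using \<delta>(1) by blast
qed

text \<open>
  At each time the spectrum is finite, so some angle avoids it, and the same angle still works at nearby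
  times. Compactness of \<open>{0..T}\<close> yields a subdivision.
\<close>

theorem maslov_index_exists:
  fixes \<gamma> :: "real \<Rightarrow> complex^'m^'m"
  assumes w: "symplectic_form \<omega>" and T: "0 \<le> T"
    and cont: "continuous_on {0..T} \<gamma>" and l: "\<And>t. t \<in> {0..T} \<Longrightarrow> lagrangian \<omega> (Gr (\<gamma> t))"
    and m: "lagrangian \<omega> \<mu>"
  obtains i where "is_maslov_index \<omega> 0 T (\<lambda>t. Gr (\<gamma> t)) (\<lambda>t. \<mu>) i"
proof -
  obtain Vp Vm where sp: "symplectic_splitting \<omega> Vp Vm" by (rule symplectic_splitting_exists[OF w])
  let ?S = "\<lambda>t. spectrum_on Vm (relative_unitary Vp Vm (Gr (\<gamma> t)) \<mu>)"
  let ?P = "\<lambda>t \<epsilon>. 0 < \<epsilon> \<and> \<epsilon> < pi \<and> cis \<epsilon> \<notin> ?S t \<and> cis (- \<epsilon>) \<notin> ?S t"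
  have path: "lagrangian_path \<omega> Vp Vm 0 T (\<lambda>t. Gr (\<gamma> t))"
    unfolding lagrangian_path_def
  proof (intro conjI ballI l)
    fix x
    have "continuous_on {0..T} (\<lambda>t. - proj Vm (Gr (\<gamma> t)) x)"
      by (intro continuous_intros continuous_on_proj_graph[OF w sp cont l])
    then show "continuous_on {0..T} (\<lambda>t. graph_map Vp Vm (Gr (\<gamma> t)) x)"
    proof (rule continuous_on_eq)
      fix t assume "t \<in> {0..T}"
      then show "- proj Vm (Gr (\<gamma> t)) x = graph_map Vp Vm (Gr (\<gamma> t)) x"
        using graph_map_eq[OF w sp l] by simp
    qed
  qed
  have path': "lagrangian_path \<omega> Vp Vm 0 T (\<lambda>t. \<mu>)"
    unfolding lagrangian_path_def using m by simp
  have "\<exists>N s \<epsilon>. s 0 = 0 \<and> s N = T \<and> (\<forall>k<N. s k < s (Suc k) \<and> 0 < \<epsilon> k \<and> \<epsilon> k < pi \<and>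
      (\<forall>t\<in>{s k..s (Suc k)}. cis (\<epsilon> k) \<notin> ?S t \<and> cis (- \<epsilon> k) \<notin> ?S t))"
  proof (cases "T = 0")
    case True
    then show ?thesis by (intro exI[of _ "0 :: nat"] exI[of _ "\<lambda>_. 0"]) simp
  next
    case False
    have loc: "\<exists>\<epsilon> \<delta>. 0 < \<delta> \<and> (\<forall>t'\<in>{0..T}. dist t t' < \<delta> \<longrightarrow> ?P t' \<epsilon>)" if t: "t \<in> {0..T}" for t
    proof -
      obtain \<epsilon> where e: "0 < \<epsilon>" "\<epsilon> < pi" "cis \<epsilon> \<notin> ?S t" "cis (- \<epsilon>) \<notin> ?S t"
        by (rule avoid_angles[OF finite_relative_spectrum[OF w sp l[OF t] m]])
      obtain d1 where d1: "d1 > 0" "\<forall>t'\<in>{0..T}. dist t t' < d1 \<longrightarrow> cis \<epsilon> \<notin> ?S t'"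
        using spectral_gap_stable[OF w sp cont l m t e(3)] by blast
      obtain d2 where d2: "d2 > 0" "\<forall>t'\<in>{0..T}. dist t t' < d2 \<longrightarrow> cis (- \<epsilon>) \<notin> ?S t'"
        using spectral_gap_stable[OF w sp cont l m t e(4)] by blast
      show ?thesis
        using d1 d2 e by (intro exI[of _ \<epsilon>] exI[of _ "min d1 d2"]) auto
    qed
    have "0 < T" using False T by simp
    then obtain N s \<epsilon> where s: "s 0 = 0" "s N = T" and lt: "\<And>k. k < N \<Longrightarrow> s k < s (Suc k)"
        and P: "\<And>k t. k < N \<Longrightarrow> t \<in> {s k..s (Suc k)} \<Longrightarrow> ?P t (\<epsilon> k)"
      using fine_subdivision[where P="?P", OF _ loc] by blast
    show ?thesis
    proof (rule exI[of _ N], rule exI[of _ s], rule exI[of _ \<epsilon>], intro conjI allI impI ballI)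
      show "s 0 = 0" "s N = T" by (rule s)+
      fix k assume k: "k < N"
      show lt': "s k < s (Suc k)" by (rule lt[OF k])
      show "0 < \<epsilon> k" "\<epsilon> k < pi" using P[OF k, of "s k"] lt' by auto
      fix t assume t: "t \<in> {s k..s (Suc k)}"
      show "cis (\<epsilon> k) \<notin> ?S t" "cis (- \<epsilon> k) \<notin> ?S t" using P[OF k t] by auto
    qed
  qed
  then obtain N s \<epsilon> where "s 0 = 0" "s N = T" "\<forall>k<N. s k < s (Suc k) \<and> 0 < \<epsilon> k \<and> \<epsilon> k < pi \<and>
      (\<forall>t\<in>{s k..s (Suc k)}. cis (\<epsilon> k) \<notin> ?S t \<and> cis (- \<epsilon> k) \<notin> ?S t)" by blast
  then have "is_maslov_index \<omega> 0 T (\<lambda>t. Gr (\<gamma> t)) (\<lambda>t. \<mu>) (- (\<Sum>k<N.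
           int (eig_count Vm (relative_unitary Vp Vm (Gr (\<gamma> (s k))) \<mu>) (\<epsilon> k)) -
           int (eig_count Vm (relative_unitary Vp Vm (Gr (\<gamma> (s (Suc k)))) \<mu>) (\<epsilon> k))))"
    unfolding is_maslov_index_def using w sp path path'
    by (intro conjI exI[of _ Vp] exI[of _ Vm] exI[of _ N] exI[of _ s] exI[of _ \<epsilon>]) simp_all
  then show thesis by (rule that)
qed

text \<open>
  On each subinterval the eigenvalue count is the Morse index relative to the rotated subspace, which
  differs by a constant from the Morse index relative to \<open>\<rho>\<close>. The contributions telescope to a
  value in which the choices no longer appear. This gives uniqueness, and with it the value of the
  definite description.
\<close>

theorem maslov_index_by_reference:
  fixes \<gamma> :: "real \<Rightarrow> complex^'m^'m"
  assumes w: "symplectic_form \<omega>" and T: "0 \<le> T"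
    and cont: "continuous_on {0..T} \<gamma>" and l: "\<And>t. t \<in> {0..T} \<Longrightarrow> lagrangian \<omega> (Gr (\<gamma> t))"
    and m: "lagrangian \<omega> \<mu>" and r: "lagrangian \<omega> \<rho>" and mr: "complementary \<mu> \<rho>"
    and lr: "\<And>t. t \<in> {0..T} \<Longrightarrow> complementary (Gr (\<gamma> t)) \<rho>"
  shows "maslov_index \<omega> 0 T (\<lambda>t. Gr (\<gamma> t)) (\<lambda>t. \<mu>) =
    int (morse_pos (pform \<omega> \<mu> \<rho>) (Gr (\<gamma> T))) - int (morse_pos (pform \<omega> \<mu> \<rho>) (Gr (\<gamma> 0)))"
proof -
  let ?q = "\<lambda>t. int (morse_pos (pform \<omega> \<mu> \<rho>) (Gr (\<gamma> t)))"
  have uniq: "i = ?q T - ?q 0" if "is_maslov_index \<omega> 0 T (\<lambda>t. Gr (\<gamma> t)) (\<lambda>t. \<mu>) i" for i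
  proof -
    obtain Vp Vm N s \<epsilon> where sp: "symplectic_splitting \<omega> Vp Vm" and s: "s 0 = 0" "s N = T"
      and step: "\<forall>k<N. s k < s (Suc k) \<and> 0 < \<epsilon> k \<and> \<epsilon> k < pi \<and>
         (\<forall>t\<in>{s k..s (Suc k)}.
            cis (\<epsilon> k) \<notin> spectrum_on Vm (relative_unitary Vp Vm (Gr (\<gamma> t)) \<mu>) \<and>
            cis (- \<epsilon> k) \<notin> spectrum_on Vm (relative_unitary Vp Vm (Gr (\<gamma> t)) \<mu>))"
      and i: "i = - (\<Sum>k<N.
         int (eig_count Vm (relative_unitary Vp Vm (Gr (\<gamma> (s k))) \<mu>) (\<epsilon> k)) -
         int (eig_count Vm (relative_unitary Vp Vm (Gr (\<gamma> (s (Suc k)))) \<mu>) (\<epsilon> k)))"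
      using \<open>is_maslov_index \<omega> 0 T (\<lambda>t. Gr (\<gamma> t)) (\<lambda>t. \<mu>) i\<close> unfolding is_maslov_index_def
      by (elim exE conjE) (rule that)
    have lo: "0 \<le> s k" if "k \<le> N" for k
      using that
    proof (induction k)
      case (Suc k)
      then have "s k < s (Suc k)" using step by simp
      then show ?case using Suc by simp
    qed (simp add: s)
    have hi: "s k \<le> T" if "k \<le> N" for k
      using that
    proof (induction k rule: inc_induct)
      case (step k)
      then have "s k < s (Suc k)" using \<open>\<forall>k<N. _ k\<close> by simp
      then show ?case using step by simp
    qed (simp add: s)
    have "int (eig_count Vm (relative_unitary Vp Vm (Gr (\<gamma> (s k))) \<mu>) (\<epsilon> k)) -
         int (eig_count Vm (relative_unitary Vp Vm (Gr (\<gamma> (s (Suc k)))) \<mu>) (\<epsilon> k)) = ?q (s k) - ?q (s (Suc k))"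
      if k: "k < N" for k
    proof -
      let ?I = "{s k..s (Suc k)}" and ?\<eta> = "cis (- \<epsilon> k)"
      have st: "s k < s (Suc k)" and e: "0 < \<epsilon> k" "\<epsilon> k < pi"
        and ns: "\<And>t. t \<in> ?I \<Longrightarrow> ?\<eta> \<notin> spectrum_on Vm (relative_unitary Vp Vm (Gr (\<gamma> t)) \<mu>)"
        using step k by auto
      have sub: "?I \<subseteq> {0..T}" using lo[of k] hi[of "Suc k"] k by auto
      have \<eta>: "?\<eta> * cnj ?\<eta> = 1" "?\<eta> \<noteq> 1"
      proof -
        show "?\<eta> * cnj ?\<eta> = 1" by (simp add: cis_cnj cis_mult)
        have "sin (\<epsilon> k) > 0" using e by (rule sin_gt_zero)
        then show "?\<eta> \<noteq> 1" by (auto simp: complex_eq_iff)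
      qed
      let ?\<rho> = "rotated_lagrangian Vp Vm \<mu> ?\<eta>"
      have lt: "lagrangian \<omega> (Gr (\<gamma> t))" if "t \<in> ?I" for t using l sub that by blast
      have count: "eig_count Vm (relative_unitary Vp Vm (Gr (\<gamma> t)) \<mu>) (\<epsilon> k) = morse_pos (pform \<omega> \<mu> ?\<rho>) (Gr (\<gamma> t))"
        if "t \<in> ?I" for t
        by (rule eig_count_eq_morse_pos[OF w sp lt[OF that] m e ns[OF that]])
      have ends: "s k \<in> ?I" "s (Suc k) \<in> ?I" using st by auto
      have "int (morse_pos (pform \<omega> \<mu> ?\<rho>) (range (\<lambda>u. vpair u (\<gamma> (s k) *v u)))) -
          int (morse_pos (pform \<omega> \<mu> \<rho>) (range (\<lambda>u. vpair u (\<gamma> (s k) *v u)))) =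
        int (morse_pos (pform \<omega> \<mu> ?\<rho>) (range (\<lambda>u. vpair u (\<gamma> (s (Suc k)) *v u)))) -
          int (morse_pos (pform \<omega> \<mu> \<rho>) (range (\<lambda>u. vpair u (\<gamma> (s (Suc k)) *v u))))"
      proof (rule morse_exchange_constant[where \<iota>="\<lambda>t u. vpair u (\<gamma> t *v u)" and I="?I", OF w])
        show "lagrangian \<omega> ?\<rho>" by (rule rotated_lagrangian[OF w sp m \<eta>(1)])
        show "complementary \<mu> ?\<rho>" by (rule rotated_complementary_self[OF w sp m \<eta>])
        show "continuous_on ?I (\<lambda>t. vpair u (\<gamma> t *v u))" for u
          by (rule continuous_on_graph[OF continuous_on_subset[OF cont sub]])
        show "complementary (range (\<lambda>u. vpair u (\<gamma> t *v u))) ?\<rho>" if "t \<in> ?I" for t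
          using rotated_complementary[OF w sp lt[OF that] m \<eta>(1) ns[OF that]] by (simp only: Gr_range)
        show "complementary (range (\<lambda>u. vpair u (\<gamma> t *v u))) \<rho>" if "t \<in> ?I" for t
          using lr sub that unfolding Gr_range by blast
        show "lagrangian \<omega> (range (\<lambda>u. vpair u (\<gamma> t *v u)))" if "t \<in> ?I" for t
          using lt[OF that] by (simp only: Gr_range)
        show "lin (\<lambda>u. vpair u (\<gamma> t *v u))" for t by (rule lin_graph)
        show "u = 0" if "vpair u (\<gamma> t *v u) = 0" for t u using that by (rule graph_injective)
      qed (use m r mr ends connected_Icc in auto)
      then show ?thesis unfolding count[OF ends(1)] count[OF ends(2)] unfolding Gr_range by linarith
    qed
    then have "i = - (\<Sum>k<N. ?q (s k) - ?q (s (Suc k)))"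
      unfolding i by (intro arg_cong[of _ _ uminus] sum.cong) auto
    also have "\<dots> = ?q (s N) - ?q (s 0)"
      using sum_lessThan_telescope'[of "\<lambda>k. ?q (s k)" N] by simp
    finally show ?thesis unfolding s .
  qed
  obtain i where "is_maslov_index \<omega> 0 T (\<lambda>t. Gr (\<gamma> t)) (\<lambda>t. \<mu>) i"
    by (rule maslov_index_exists[OF w T cont l m])
  then show ?thesis
    unfolding maslov_index_def using uniq by (intro the_equality) blast+
qed

section \<open>The index formula\<close>

text \<open>
  This provides the constant for the Lagrangian subspace that is transversal to the whole path.
\<close>

lemma uniform_lower_bound:
  fixes A :: "real \<Rightarrow> complex^'n^'n"
  assumes "compact I" "continuous_on I A"
  obtains \<kappa> where "0 < \<kappa>" "\<And>t x. t \<in> I \<Longrightarrow> x \<noteq> 0 \<Longrightarrow> 0 < \<kappa> * (norm x)\<^sup>2 + Re (hform (A t) x x)"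
proof -
  define B where "B t = (\<Sum>i\<in>UNIV. \<Sum>j\<in>UNIV. cmod (hform (A t) (axis i 1) (axis j 1)))" for t
  have "continuous_on I B"
    unfolding B_def hform_def cinner_def matrix_vector_mult_def vec_lambda_beta
    by (intro continuous_intros assms(2))
  then have "bounded (B ` I)"
    using assms(1) compact_continuous_image compact_imp_bounded by blast
  then obtain b where b: "b > 0" "\<And>t. t \<in> I \<Longrightarrow> norm (B t) \<le> b"
    unfolding bounded_pos by blast
  have "0 < (b + 1) * (norm x)\<^sup>2 + Re (hform (A t) x x)" if t: "t \<in> I" and x: "x \<noteq> 0" for t x
  proof -
    have "- Re (hform (A t) x x) \<le> cmod (hform (A t) x x)" using abs_Re_le_cmod[of "hform (A t) x x"] by linarith
    also have "\<dots> \<le> B t * (norm x)\<^sup>2" unfolding B_def by (rule sesq_bound[OF sesquilinear_hform])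
    also have "\<dots> \<le> b * (norm x)\<^sup>2" using b(2)[OF t] by (intro mult_right_mono) auto
    also have "\<dots> < (b + 1) * (norm x)\<^sup>2" using x by (simp add: algebra_simps)
    finally show ?thesis by linarith
  qed
  then show thesis using that[of "b + 1"] b(1) by simp
qed

lemma continuous_on_blocks:
  fixes \<gamma> :: "real \<Rightarrow> complex^('n + 'n)^('n::finite + 'n)"
  assumes "continuous_on I \<gamma>" "\<And>t. t \<in> I \<Longrightarrow> \<gamma> t = block (M11 t) 0 (M21 t) (M22 t)"
  shows "continuous_on I M11" "continuous_on I M21"
proof -
  have e: "M11 t $ i $ j = \<gamma> t $ Inl i $ Inl j" "M21 t $ i $ j = \<gamma> t $ Inr i $ Inl j" if "t \<in> I" for t i j
    unfolding assms(2)[OF that] by (simp_all add: block_def vpair_def)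
  have "continuous_on I (\<lambda>t. \<chi> i j. \<gamma> t $ Inl i $ Inl j)" "continuous_on I (\<lambda>t. \<chi> i j. \<gamma> t $ Inr i $ Inl j)"
    by (intro continuous_on_vec_lambda continuous_intros assms(1))+
  moreover have "(\<chi> i j. \<gamma> t $ Inl i $ Inl j) = M11 t" "(\<chi> i j. \<gamma> t $ Inr i $ Inl j) = M21 t" if "t \<in> I" for t
    using e[OF that] by (simp_all add: vec_eq_iff)
  ultimately show "continuous_on I M11" "continuous_on I M21" by (simp_all cong: continuous_on_cong)
qed

theorem theorem2p2:
  fixes K :: "complex^'n^'n"
    and M11 M21 M22 :: "real \<Rightarrow> complex^'n^'n"
    and \<gamma> :: "real \<Rightarrow> complex^('n + 'n)^('n + 'n)"
    and R :: "(complex^('n + 'n)) set"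
    and T :: real
  assumes "invertible K"
    and "0 \<le> T"
    and "continuous_on {0..T} \<gamma>"
    and "\<And>t. t \<in> {0..T} \<Longrightarrow> invertible (\<gamma> t)"
    and "\<And>t. t \<in> {0..T} \<Longrightarrow> \<gamma> t = block (M11 t) 0 (M21 t) (M22 t)"
    and "\<And>t. t \<in> {0..T} \<Longrightarrow> cadj (M22 t) ** K ** M11 t = K"
    and "\<And>t. t \<in> {0..T} \<Longrightarrow>
           cadj (cadj (M11 t) ** cadj K ** M21 t) = cadj (M11 t) ** cadj K ** M21 t"
    and "vec.subspace R"
  shows "(\<forall>t\<in>{0..T}.
            int (vec.dim (Gr (\<gamma> t) \<inter> WK K R)) =
              int (vec.dim (form_ker (hform (cadj (M11 t) ** cadj K ** M21 t)) (SK K R (M11 t))))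
              + int (vec.dim (SK K R (M11 t)))
              + int (vec.dim (Gr (mat 1 :: complex^'n^'n) \<inter> R))
              - int (vec.dim (Gr (mat 1 :: complex^'n^'n) \<inter> RK K R)))
         \<and> path_index K (WK K R) T \<gamma> =
              int (morse_pos (hform (cadj (M11 T) ** cadj K ** M21 T)) (SK K R (M11 T)))
              - int (morse_pos (hform (cadj (M11 0) ** cadj K ** M21 0)) (SK K R (M11 0)))
              + int (vec.dim (SK K R (M11 0))) - int (vec.dim (SK K R (M11 T)))"
proof (intro conjI ballI)
  have bd: "boundary_data K (M11 t) (M21 t) (M22 t) R" if "t \<in> {0..T}" for t
    using assms(1,8) assms(6,7)[OF that] by (rule boundary_data.intro)
  define A where "A t = cadj (M11 t) ** cadj K ** M21 t" for t
  have A: "boundary_data.A K (M11 t) (M21 t) = A t" if "t \<in> {0..T}" for t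
    unfolding A_def by (rule boundary_data.A_def[OF bd[OF that]])
  show "int (vec.dim (Gr (\<gamma> t) \<inter> WK K R)) =
      int (vec.dim (form_ker (hform (cadj (M11 t) ** cadj K ** M21 t)) (SK K R (M11 t))))
      + int (vec.dim (SK K R (M11 t)))
      + int (vec.dim (Gr (mat 1 :: complex^'n^'n) \<inter> R))
      - int (vec.dim (Gr (mat 1 :: complex^'n^'n) \<inter> RK K R))" if t: "t \<in> {0..T}" for t
    using boundary_data.dim_intersection[OF bd[OF t]] dim_diagonal_difference[OF assms(1,8)]
    unfolding A[OF t] assms(5)[OF t, symmetric] A_def by linarith
  note blocks = continuous_on_blocks[OF assms(3,5)]
  have "continuous_on {0..T} A"
  proof -
    have "continuous_on {0..T} (\<lambda>t. \<chi> i j. A t $ i $ j)"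
      unfolding A_def matrix_matrix_mult_def cadj_def vec_lambda_beta
      by (intro continuous_on_vec_lambda continuous_intros blocks)
    then show ?thesis by simp
  qed
  then obtain \<kappa> where k: "0 < \<kappa>" "\<And>t x. t \<in> {0..T} \<Longrightarrow> x \<noteq> 0 \<Longrightarrow> 0 < \<kappa> * (norm x)\<^sup>2 + Re (hform (A t) x x)"
    using uniform_lower_bound[OF compact_Icc] by blast
  have large: "0 < \<kappa> * (norm x)\<^sup>2 + Re (hform (boundary_data.A K (M11 t) (M21 t)) x x)"
    if "t \<in> {0..T}" "x \<noteq> 0" for t x
    unfolding A[OF that(1)] by (rule k(2)[OF that])
  let ?q = "pform (omegaW K) (WK K R) (rho_kappa K \<kappa>)"
  have "path_index K (WK K R) T \<gamma> = int (morse_pos ?q (Gr (\<gamma> T))) - int (morse_pos ?q (Gr (\<gamma> 0)))"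
    unfolding path_index_def
  proof (rule maslov_index_by_reference[OF symplectic_omegaW[OF assms(1)] assms(2,3)])
    show "lagrangian (omegaW K) (Gr (\<gamma> t))" if "t \<in> {0..T}" for t
      unfolding assms(5)[OF that] by (rule boundary_data.L_lagrangian[OF bd[OF that]])
    show "lagrangian (omegaW K) (WK K R)" by (rule WK_lagrangian[OF assms(1,8)])
    show "lagrangian (omegaW K) (rho_kappa K \<kappa>)" by (rule rho_kappa_lagrangian[OF assms(1)])
    show "complementary (WK K R) (rho_kappa K \<kappa>)"
      by (rule WK_rho_kappa[OF assms(1,8)]) (use k(1) in simp)
    show "complementary (Gr (\<gamma> t)) (rho_kappa K \<kappa>)" if "t \<in> {0..T}" for t
      unfolding assms(5)[OF that] by (rule boundary_data.L_rho[OF bd[OF that] k(1) large[OF that]])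
  qed
  moreover have "int (morse_pos ?q (Gr (\<gamma> t))) + int (vec.dim (SK K R (M11 t))) =
      int (morse_pos (hform (A t)) (SK K R (M11 t))) + int (vec.dim (RK K R))" if "t \<in> {0..T}" for t
    using boundary_data.morse_pos_reference[OF bd[OF that] k(1) large[OF that]]
    unfolding A[OF that] assms(5)[OF that, symmetric] by linarith
  from this[of 0] this[of T] have
    "int (morse_pos ?q (Gr (\<gamma> 0))) + int (vec.dim (SK K R (M11 0))) =
      int (morse_pos (hform (A 0)) (SK K R (M11 0))) + int (vec.dim (RK K R))"
    "int (morse_pos ?q (Gr (\<gamma> T))) + int (vec.dim (SK K R (M11 T))) =
      int (morse_pos (hform (A T)) (SK K R (M11 T))) + int (vec.dim (RK K R))"
    using assms(2) by auto
  ultimately show "path_index K (WK K R) T \<gamma> =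
      int (morse_pos (hform (cadj (M11 T) ** cadj K ** M21 T)) (SK K R (M11 T)))
      - int (morse_pos (hform (cadj (M11 0) ** cadj K ** M21 0)) (SK K R (M11 0)))
      + int (vec.dim (SK K R (M11 0))) - int (vec.dim (SK K R (M11 T)))"
    unfolding A_def by linarith
qed

end
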